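(* For every rational mapping $f:\widehat{\mathbb{C}}\to\widehat{\mathbb{C}}$ of degree at least $2$ and for every $t>0$, $$P_{\mathrm{spanning}}(t)<\infty.$$
   Context: $J(f)$ is the Julia set of $f$; distances $\rho$ and derivatives are with respect to the spherical metric. **Spanning pressure.** For $n\ge0$ let $\rho_n(x,y)=\max_{0\le j\le n}\rho(f^j(x),f^j(y))$. A set $Y\subset J(f)$ is $(n,\varepsilon)$-spanning if for every $x\in J(f)$ there is $y\in Y$ with $\rho_n(x,y)<\varepsilon$. Then $$P_{\mathrm{spanning}}(t):=\lim_{\varepsilon\to0}\ \limsup_{n\to\infty}\frac1n\log\Big(\inf_Y\sum_{y\in Y}|(f^n)'(y)|^{-t}\Big),$$ the infimum being over all $(n,\varepsilon)$-spanning sets $Y\subset J(f)$, with the convention $0^{-t}=+\infty$. *)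

theory Defs
  imports "HOL-Analysis.Analysis" "HOL-Computational_Algebra.Computational_Algebra"
begin

section \<open>The Riemann sphere with its spherical metric\<close>

datatype riemann_sphere = Fin complex | Infty

text \<open>Stereographic parametrisation of the unit sphere in \<open>\<complex> \<times> \<real> = \<real>\<^sup>3\<close>.\<close>

fun stereo :: "riemann_sphere \<Rightarrow> complex \<times> real" where
  "stereo (Fin z) =
     (2 * z / of_real ((cmod z)\<^sup>2 + 1), ((cmod z)\<^sup>2 - 1) / ((cmod z)\<^sup>2 + 1))"
| "stereo Infty = (0, 1)"

lemma norm_stereo: "norm (stereo x) = 1"
proof (cases x)
  case (Fin z)
  define c where "c = (cmod z)\<^sup>2"
  have c: "c \<ge> 0" by (simp add: c_def)
  have n: "cmod (2 * z / of_real (c + 1)) = 2 * cmod z / (c + 1)"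
    using c by (simp add: norm_divide norm_mult del: of_real_add)
  have "(2 * cmod z / (c + 1))\<^sup>2 + ((c - 1) / (c + 1))\<^sup>2 = (4 * c + (c - 1)\<^sup>2) / (c + 1)\<^sup>2"
    by (simp add: power_divide power_mult_distrib c_def add_divide_distrib)
  also have "4 * c + (c - 1)\<^sup>2 = (c + 1)\<^sup>2"
    by (simp add: power2_eq_square algebra_simps)
  finally show ?thesis
    using c n by (simp add: Fin norm_prod_def c_def[symmetric] power_divide)
qed (simp add: norm_prod_def)

lemma stereo_inject: "stereo x = stereo y \<longleftrightarrow> x = y"
proof -
  have pos: "(cmod z)\<^sup>2 + 1 > 0" for z by (smt (verit) zero_le_power2)
  have ninf: "stereo (Fin z) \<noteq> stereo Infty" for z
    using pos[of z] by (auto simp: field_simps)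
  have "z = w" if "stereo (Fin z) = stereo (Fin w)" for z w
  proof -
    have s: "((cmod u)\<^sup>2 - 1) / ((cmod u)\<^sup>2 + 1) = 1 - 2 / ((cmod u)\<^sup>2 + 1)" for u
      using pos[of u] by (simp add: field_simps)
    have "1 - 2 / ((cmod z)\<^sup>2 + 1) = 1 - 2 / ((cmod w)\<^sup>2 + 1)"
      using that s[of z] s[of w] by simp
    then have e: "(cmod z)\<^sup>2 + 1 = (cmod w)\<^sup>2 + 1"
      using pos[of z] pos[of w] by (simp add: field_simps)
    have "2 * z / of_real ((cmod w)\<^sup>2 + 1) = 2 * w / of_real ((cmod w)\<^sup>2 + 1)"
      using that e by simp
    moreover have "complex_of_real ((cmod w)\<^sup>2 + 1) \<noteq> 0"
      using pos[of w] by (metis of_real_eq_0_iff less_irrefl)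
    ultimately show "z = w"
      by (simp add: field_simps del: of_real_add)
  qed
  then show ?thesis
    using ninf by (cases x; cases y) (metis)+
qed

lemma arccos_inner_triangle:
  fixes u v w :: "'a :: real_inner"
  assumes "norm u = 1" "norm v = 1" "norm w = 1"
  shows "arccos (u \<bullet> w) \<le> arccos (u \<bullet> v) + arccos (v \<bullet> w)"
proof -
  have b: "\<bar>x \<bullet> y\<bar> \<le> 1" if "norm x = 1" "norm y = 1" for x y :: 'a
    using Cauchy_Schwarz_ineq2[of x y] that by simp
  have uu: "u \<bullet> u = 1" "v \<bullet> v = 1" "w \<bullet> w = 1"
    using assms by (simp_all add: norm_eq_1)
  define \<alpha> \<beta> where "\<alpha> = arccos (u \<bullet> v)" and "\<beta> = arccos (v \<bullet> w)"
  have ab: "0 \<le> \<alpha>" "\<alpha> \<le> pi" "0 \<le> \<beta>" "\<beta> \<le> pi"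
    using b[of u v] b[of v w] assms
    by (auto simp: \<alpha>_def \<beta>_def abs_le_iff intro!: arccos_lbound arccos_ubound)
  have cs: "cos \<alpha> = u \<bullet> v" "cos \<beta> = v \<bullet> w"
    using b assms by (simp_all add: \<alpha>_def \<beta>_def cos_arccos_abs)
  have sn: "sin \<alpha> = sqrt (1 - (u \<bullet> v)\<^sup>2)" "sin \<beta> = sqrt (1 - (v \<bullet> w)\<^sup>2)"
    using b assms by (simp_all add: \<alpha>_def \<beta>_def sin_arccos_abs)
  define p q where "p = u - (u \<bullet> v) *\<^sub>R v" and "q = w - (v \<bullet> w) *\<^sub>R v"
  have "p \<bullet> p = 1 - (u \<bullet> v)\<^sup>2" "q \<bullet> q = 1 - (v \<bullet> w)\<^sup>2"
    by (simp_all add: p_def q_def inner_diff_left inner_diff_right uu power2_eq_square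
        inner_commute algebra_simps)
  then have np: "norm p = sin \<alpha>" "norm q = sin \<beta>"
    by (simp_all add: norm_eq_sqrt_inner sn)
  have pq: "p \<bullet> q = u \<bullet> w - (u \<bullet> v) * (v \<bullet> w)"
    by (simp add: p_def q_def inner_diff_left inner_diff_right uu inner_commute algebra_simps)
  have "\<bar>p \<bullet> q\<bar> \<le> sin \<alpha> * sin \<beta>"
    using Cauchy_Schwarz_ineq2[of p q] by (simp add: np)
  then have le: "cos (\<alpha> + \<beta>) \<le> u \<bullet> w"
    using pq by (simp add: cos_add cs)
  show ?thesis
  proof (cases "\<alpha> + \<beta> \<le> pi")
    case True
    have "arccos (u \<bullet> w) \<le> arccos (cos (\<alpha> + \<beta>))"
      using le b[of u w] assms by (intro arccos_le_arccos) auto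
    then show ?thesis
      using True ab by (simp add: arccos_cos \<alpha>_def \<beta>_def)
  next
    case False
    then show ?thesis
      using arccos_ubound[of "u \<bullet> w"] b[of u w] assms
      by (simp add: \<alpha>_def \<beta>_def abs_le_iff)
  qed
qed

text \<open>The spherical distance is the great-circle distance on the unit sphere, i.e. the
  Riemannian distance of \<open>2 |dz| / (1 + |z|\<^sup>2)\<close>.\<close>

instantiation riemann_sphere :: metric_space
begin

definition dist_riemann_sphere :: "riemann_sphere \<Rightarrow> riemann_sphere \<Rightarrow> real" where
  "dist_riemann_sphere x y = arccos (stereo x \<bullet> stereo y)"

definition uniformity_riemann_sphere :: "(riemann_sphere \<times> riemann_sphere) filter" where
  "uniformity_riemann_sphere = (INF e\<in>{0<..}. principal {(x, y). dist x y < e})"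

definition open_riemann_sphere :: "riemann_sphere set \<Rightarrow> bool" where
  "open_riemann_sphere U \<longleftrightarrow>
     (\<forall>x\<in>U. \<forall>\<^sub>F (x', y) in uniformity. x' = x \<longrightarrow> y \<in> U)"

instance
proof
  fix x y z :: riemann_sphere
  have b: "\<bar>stereo x \<bullet> stereo y\<bar> \<le> 1"
    using Cauchy_Schwarz_ineq2[of "stereo x" "stereo y"] by (simp add: norm_stereo)
  have "dist x y = 0 \<longleftrightarrow> stereo x \<bullet> stereo y = 1"
    unfolding dist_riemann_sphere_def using b by (intro arccos_eq_0_iff) (auto simp: abs_le_iff)
  also have "\<dots> \<longleftrightarrow> stereo x = stereo y"
    using norm_cauchy_schwarz_eq[of "stereo x" "stereo y"] by (auto simp: norm_stereo)
  finally show "dist x y = 0 \<longleftrightarrow> x = y"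
    by (simp add: stereo_inject)
  show "dist x y \<le> dist x z + dist y z"
    using arccos_inner_triangle[OF norm_stereo norm_stereo norm_stereo, of x y z]
    by (simp add: dist_riemann_sphere_def inner_commute)
qed (simp_all add: uniformity_riemann_sphere_def open_riemann_sphere_def)

end

section \<open>Rational maps\<close>

text \<open>The self-map of the sphere induced by \<open>p / q\<close>, for coprime \<open>p\<close> and \<open>q\<close>. The value at
  \<open>\<infinity>\<close> is the limit of \<open>p(z) / q(z)\<close>, read off from the coefficients in degree
  \<open>max (degree p) (degree q)\<close>, which are not both zero.\<close>

fun rational_fun :: "complex poly \<Rightarrow> complex poly \<Rightarrow> riemann_sphere \<Rightarrow> riemann_sphere" where
  "rational_fun p q (Fin z) =
     (if poly q z = 0 then Infty else Fin (poly p z / poly q z))"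
| "rational_fun p q Infty =
     (let d = max (degree p) (degree q)
      in if coeff q d = 0 then Infty else Fin (coeff p d / coeff q d))"

definition rational_map_of_degree :: "nat \<Rightarrow> (riemann_sphere \<Rightarrow> riemann_sphere) \<Rightarrow> bool" where
  "rational_map_of_degree d f \<longleftrightarrow>
     (\<exists>p q. coprime p q \<and> max (degree p) (degree q) = d \<and> f = rational_fun p q)"

section \<open>Julia set\<close>

definition normal_family_on ::
    "riemann_sphere set \<Rightarrow> (riemann_sphere \<Rightarrow> riemann_sphere) set \<Rightarrow> bool" where
  "normal_family_on U F \<longleftrightarrow>
     (\<forall>s :: nat \<Rightarrow> riemann_sphere \<Rightarrow> riemann_sphere. range s \<subseteq> F \<longrightarrow>
        (\<exists>r g. strict_mono (r :: nat \<Rightarrow> nat) \<and>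
           (\<forall>K. compact K \<and> K \<subseteq> U \<longrightarrow> uniform_limit K (s \<circ> r) g sequentially)))"

definition fatou_set :: "(riemann_sphere \<Rightarrow> riemann_sphere) \<Rightarrow> riemann_sphere set" where
  "fatou_set f =
     {x. \<exists>U. open U \<and> x \<in> U \<and> normal_family_on U (range (\<lambda>n. f ^^ n))}"

definition julia_set :: "(riemann_sphere \<Rightarrow> riemann_sphere) \<Rightarrow> riemann_sphere set" where
  "julia_set f = - fatou_set f"

section \<open>Spherical derivative\<close>

text \<open>The isometry \<open>z \<mapsto> 1 / z\<close> of the sphere, and the affine coordinate (with a dummy value
  at \<open>\<infinity>\<close>).\<close>

fun sphere_inv :: "riemann_sphere \<Rightarrow> riemann_sphere" where
  "sphere_inv (Fin z) = (if z = 0 then Infty else Fin (1 / z))"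
| "sphere_inv Infty = Fin 0"

fun affine_coord :: "riemann_sphere \<Rightarrow> complex" where
  "affine_coord (Fin z) = z"
| "affine_coord Infty = 0"

text \<open>An isometry of the sphere moving \<open>x\<close> to a finite point; it is its own inverse.\<close>

definition flip :: "riemann_sphere \<Rightarrow> riemann_sphere \<Rightarrow> riemann_sphere" where
  "flip x = (if x = Infty then sphere_inv else id)"

text \<open>Modulus of the derivative of \<open>f\<close> at \<open>x\<close> with respect to the spherical metric: in the
  coordinates \<open>z\<close> (near finite points) and \<open>1 / z\<close> (near \<open>\<infinity>\<close>), in both of which the metric
  has density \<open>2 / (1 + |z|\<^sup>2)\<close>. For \<open>x\<close> and \<open>f x\<close> finite it is
  \<open>|f'(x)| (1 + |x|\<^sup>2) / (1 + |f(x)|\<^sup>2)\<close>.\<close>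

definition sph_deriv :: "(riemann_sphere \<Rightarrow> riemann_sphere) \<Rightarrow> riemann_sphere \<Rightarrow> real" where
  "sph_deriv f x =
     (let g = (\<lambda>z. affine_coord (flip (f x) (f (flip x (Fin z)))));
          a = affine_coord (flip x x)
      in cmod (deriv g a) * (1 + (cmod a)\<^sup>2) / (1 + (cmod (g a))\<^sup>2))"

lemma sph_deriv_Fin:
  assumes "f (Fin a) = Fin b"
  shows "sph_deriv f (Fin a) =
    cmod (deriv (\<lambda>z. affine_coord (f (Fin z))) a) * (1 + (cmod a)\<^sup>2) / (1 + (cmod b)\<^sup>2)"
  using assms by (simp add: sph_deriv_def flip_def Let_def)

section \<open>Spanning pressure\<close>

definition bowen_dist ::
    "(riemann_sphere \<Rightarrow> riemann_sphere) \<Rightarrow> nat \<Rightarrow> riemann_sphere \<Rightarrow> riemann_sphere \<Rightarrow> real" where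
  "bowen_dist f n x y = (MAX j\<in>{0..n}. dist ((f ^^ j) x) ((f ^^ j) y))"

definition spanning ::
    "(riemann_sphere \<Rightarrow> riemann_sphere) \<Rightarrow> nat \<Rightarrow> real \<Rightarrow> riemann_sphere set \<Rightarrow> bool" where
  "spanning f n \<epsilon> Y \<longleftrightarrow>
     Y \<subseteq> julia_set f \<and> (\<forall>x\<in>julia_set f. \<exists>y\<in>Y. bowen_dist f n x y < \<epsilon>)"

text \<open>\<open>c\<^sup>-\<^sup>t\<close> with the convention \<open>0\<^sup>-\<^sup>t = \<infinity>\<close>.\<close>

definition neg_power :: "real \<Rightarrow> real \<Rightarrow> ennreal" where
  "neg_power c t = (if c = 0 then \<infinity> else ennreal (c powr (- t)))"

definition eln :: "ennreal \<Rightarrow> ereal" where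
  "eln a = (if a = 0 then - \<infinity> else if a = \<infinity> then \<infinity> else ereal (ln (enn2real a)))"

definition spanning_sum ::
    "(riemann_sphere \<Rightarrow> riemann_sphere) \<Rightarrow> real \<Rightarrow> nat \<Rightarrow> real \<Rightarrow> ennreal" where
  "spanning_sum f t n \<epsilon> =
     (INF Y\<in>{Y. spanning f n \<epsilon> Y}. \<Sum>\<^sub>\<infinity>y\<in>Y. neg_power (sph_deriv (f ^^ n) y) t)"

definition spanning_growth ::
    "(riemann_sphere \<Rightarrow> riemann_sphere) \<Rightarrow> real \<Rightarrow> real \<Rightarrow> ereal" where
  "spanning_growth f t \<epsilon> =
     limsup (\<lambda>n. ereal (1 / real n) * eln (spanning_sum f t n \<epsilon>))"

definition P_spanning :: "(riemann_sphere \<Rightarrow> riemann_sphere) \<Rightarrow> real \<Rightarrow> ereal" where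
  "P_spanning f t = Lim (at_right 0) (spanning_growth f t)"

text \<open>The limit in \<open>P_spanning\<close> always exists in the extended reals.\<close>

lemma eln_mono: "a \<le> b \<Longrightarrow> eln a \<le> eln b"
  by (cases a rule: ennreal_cases; cases b rule: ennreal_cases)
     (auto simp: eln_def ennreal_eq_0_iff top_unique)

lemma spanning_growth_antimono:
  assumes "\<epsilon> \<le> \<delta>"
  shows "spanning_growth f t \<delta> \<le> spanning_growth f t \<epsilon>"
proof -
  have "{Y. spanning f n \<epsilon> Y} \<subseteq> {Y. spanning f n \<delta> Y}" for n
    using assms unfolding spanning_def by (blast intro: less_le_trans)
  then have "spanning_sum f t n \<delta> \<le> spanning_sum f t n \<epsilon>" for n
    unfolding spanning_sum_def by (intro INF_superset_mono) auto
  then show ?thesis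
    unfolding spanning_growth_def
    by (intro Limsup_mono always_eventually allI ereal_mult_left_mono eln_mono) auto
qed

lemma spanning_growth_tendsto:
  "(spanning_growth f t \<longlongrightarrow> (SUP \<epsilon>\<in>{0<..}. spanning_growth f t \<epsilon>)) (at_right 0)"
proof (rule order_tendstoI)
  fix a assume "a < (SUP \<epsilon>\<in>{0<..}. spanning_growth f t \<epsilon>)"
  then obtain \<delta> where \<delta>: "\<delta> > 0" "a < spanning_growth f t \<delta>"
    by (auto simp: less_SUP_iff)
  then have "a < spanning_growth f t \<epsilon>" if "\<epsilon> < \<delta>" for \<epsilon>
    using spanning_growth_antimono[of \<epsilon> \<delta> f t] that by auto
  then show "\<forall>\<^sub>F \<epsilon> in at_right 0. a < spanning_growth f t \<epsilon>"
    using \<delta>(1) by (auto simp: eventually_at_right_field)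
next
  fix a assume a: "(SUP \<epsilon>\<in>{0<..}. spanning_growth f t \<epsilon>) < a"
  have "spanning_growth f t \<epsilon> < a" if "\<epsilon> > 0" for \<epsilon>
    using SUP_upper[of \<epsilon> "{0<..}" "spanning_growth f t"] that a by auto
  then show "\<forall>\<^sub>F \<epsilon> in at_right 0. spanning_growth f t \<epsilon> < a"
    by (auto simp: eventually_at_right_field intro!: exI[of _ 1])
qed

lemma P_spanning_tendsto: "(spanning_growth f t \<longlongrightarrow> P_spanning f t) (at_right 0)"
  unfolding P_spanning_def
  using spanning_growth_tendsto tendsto_Lim trivial_limit_at_right_real by metis

end

theory Submission
  imports Defs "HOL-Complex_Analysis.Complex_Analysis"
begin

text \<open>
  For \<open>x\<close> in the Julia set and a small base \<open>\<theta>\<close> we find a point \<open>y\<close> of the Julia set within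
  \<open>O(\<theta>\<^sup>n)\<close> of \<open>x\<close> at which the derivative of \<open>f ^^ n\<close> is at least \<open>\<mu>\<^sup>n\<close>. Moving the points of a
  \<open>\<theta>\<^sup>n\<close>-net of the Julia set in this way yields an \<open>(n, \<epsilon>)\<close>-spanning set of exponential size, and its
  sum is bounded by \<open>125 G\<^sup>n\<close> with \<open>G\<close> independent of \<open>\<epsilon>\<close>.

  Two facts give \<open>y\<close>. First, a critical point \<open>c\<close> in the Julia set is not attracted to itself, so an orbit
  passing at distance \<open>r\<close> from \<open>c\<close> needs time of order \<open>log (1 / r)\<close> to come back as close; more precisely
  (Denker, Przytycki, Urbanski) the sum of \<open>- log (dist (f\<^sup>l y, c))\<close> over \<open>l < n\<close>, without its largest
  term, is \<open>O(n)\<close>. Hence it suffices that the orbit of \<open>y\<close> stays at distance at least \<open>q\<^sup>n\<close> from the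
  critical points in the Julia set. Second, the Julia set is uniformly perfect, so this can be achieved
  by finitely many exponentially small moves within the Julia set, one for each critical point.
\<close>

section \<open>The chordal metric and homogeneous coordinates\<close>

text \<open>The obstacle is that \<open>f ^^ n\<close> may have a tiny or vanishing derivative at
  the points of a net, which must therefore be moved without losing the spanning property. With
  \<open>\<theta>\<close> equal to 1 / (2 L), where L is a Lipschitz constant of \<open>f\<close>, a
  displacement of order \<open>\<theta> ^ n\<close> grows at most to order (1 / 2)^n within n steps.
  For fixed \<open>\<epsilon>\<close> this is eventually harmless, which is why
  \<open>\<epsilon>\<close> has no influence on G.

  Expansion is handled by two-point inequalities for the chordal distance and turned into
  \<open>sph_deriv\<close> only at the end. One step of \<open>f\<close> expands small distances at
  x by at least a constant times the product of the distances from x to the critical points, with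
  multiplicity. Over n steps a bound \<open>\<rho>\<close> for every single factor would give only
  \<open>\<rho> ^ n\<close>, which for \<open>\<rho>\<close> = q^n is the useless q^(n^2). The
  recurrence estimate lets \<open>\<rho>\<close> enter only once per critical factor, which leaves
  an exponential bound. Critical points outside the Julia set keep a fixed distance from it and cost
  a constant factor per step.\<close>

definition chd :: "riemann_sphere \<Rightarrow> riemann_sphere \<Rightarrow> real" where
  "chd x y = norm (stereo x - stereo y) / 2"

text \<open>The point [P : Q] of the projective line. The value at (0, 0) is a dummy, hence the
  assumptions below that P and Q do not both vanish.\<close>

definition pt :: "complex \<Rightarrow> complex \<Rightarrow> riemann_sphere" where
  "pt P Q = (if Q = 0 then Infty else Fin (P / Q))"

lemma chd_nonneg [simp]: "0 \<le> chd x y"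
  by (simp add: chd_def)

lemma chd_le_1: "chd x y \<le> 1"
  using norm_triangle_ineq4[of "stereo x" "stereo y"] by (simp add: chd_def norm_stereo)

lemma chd_self [simp]: "chd x x = 0"
  by (simp add: chd_def)

lemma chd_eq_0_iff [simp]: "chd x y = 0 \<longleftrightarrow> x = y"
  by (simp add: chd_def stereo_inject)

lemma chd_commute: "chd x y = chd y x"
  by (simp add: chd_def norm_minus_commute)

lemma chd_triangle: "chd x z \<le> chd x y + chd y z"
  using norm_triangle_ineq[of "stereo x - stereo y" "stereo y - stereo z"] by (simp add: chd_def)

lemma chd_sq: "(chd x y)\<^sup>2 = (1 - stereo x \<bullet> stereo y) / 2"
  using norm_stereo[of x] norm_stereo[of y]
  by (simp add: chd_def power_divide power2_norm_eq_inner inner_diff_left inner_diff_right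
      inner_commute norm_eq_1)

text \<open>The half-angle formula: both sides have square (1 - cos d) / 2 with d the spherical
  distance, and d / 2 lies between 0 and pi / 2.\<close>

lemma chd_eq_sin: "chd x y = sin (dist x y / 2)"
proof -
  have b: "\<bar>stereo x \<bullet> stereo y\<bar> \<le> 1"
    using Cauchy_Schwarz_ineq2[of "stereo x" "stereo y"] by (simp add: norm_stereo)
  have "cos (2 * (dist x y / 2)) = stereo x \<bullet> stereo y"
    using b by (simp add: dist_riemann_sphere_def cos_arccos_abs)
  then have "(sin (dist x y / 2))\<^sup>2 = (chd x y)\<^sup>2"
    unfolding chd_sq cos_double_sin by simp
  moreover have "0 \<le> dist x y" "dist x y \<le> pi"
    using b by (auto simp: dist_riemann_sphere_def abs_le_iff intro!: arccos_lbound arccos_ubound)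
  then have "0 \<le> sin (dist x y / 2)"
    using pi_gt_zero by (intro sin_ge_zero) linarith+
  ultimately show ?thesis by (metis chd_nonneg power2_eq_iff_nonneg)
qed

lemma chd_le_dist: "chd x y \<le> dist x y"
  using sin_x_le_x[of "dist x y / 2"] zero_le_dist[of x y] by (simp add: chd_eq_sin del: zero_le_dist)

lemma dist_le_chd: "dist x y \<le> 4 * chd x y"
proof -
  define u where "u = dist x y / 2"
  have "\<bar>stereo x \<bullet> stereo y\<bar> \<le> 1"
    using Cauchy_Schwarz_ineq2[of "stereo x" "stereo y"] by (simp add: norm_stereo)
  then have "dist x y \<le> pi"
    by (auto simp: dist_riemann_sphere_def abs_le_iff intro!: arccos_ubound)
  \<comment> \<open>1.6 exceeds pi / 2. On [0, 1.6] the Taylor remainder u^3 / 6 is at most (2.56 /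
    6) u, which is less than u / 2, so sin u is at least u / 2.\<close>
  then have u: "0 \<le> u" "u \<le> 1.6" using pi_approx by (auto simp: u_def)
  have "\<bar>sin u - (\<Sum>m<3. sin_coeff m * u ^ m)\<bar> \<le> inverse (fact 3) * \<bar>u\<bar> ^ 3"
    by (rule Maclaurin_sin_bound)
  then have "\<bar>sin u - u\<bar> \<le> u ^ 3 / 6"
    using u by (simp add: sin_coeff_def eval_nat_numeral)
  moreover have "u ^ 3 \<le> u * 1.6\<^sup>2"
    using u mult_left_mono[OF power_mono[OF u(2,1), of 2] u(1)]
    by (simp add: power2_eq_square power3_eq_cube)
  ultimately have "u - sin u \<le> u * 2.56 / 6"
    using abs_ge_minus_self[of "sin u - u"] by (simp add: power2_eq_square)
  then have "u / 2 \<le> sin u" using u by (simp add: field_simps)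
  then show ?thesis by (simp add: chd_eq_sin u_def)
qed

lemma sqrt_pos': "0 < sqrt (1 + (cmod a)\<^sup>2)"
  by (smt (verit) real_sqrt_gt_zero zero_le_power2)

lemma chd_Fin: "chd (Fin a) (Fin b) =
    cmod (a - b) / (sqrt (1 + (cmod a)\<^sup>2) * sqrt (1 + (cmod b)\<^sup>2))"
proof -
  define A B where "A = (cmod a)\<^sup>2" and "B = (cmod b)\<^sup>2"
  have AB: "A + 1 > 0" "B + 1 > 0" by (simp_all add: A_def B_def add_nonneg_pos)
  have i: "(2 * a / of_real (A + 1)) \<bullet> (2 * b / of_real (B + 1)) = 4 * (a \<bullet> b) / ((A + 1) * (B + 1))"
    using AB by (simp add: inner_complex_def field_simps del: of_real_add)
      (simp add: add_divide_distrib add.assoc)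
  have "stereo (Fin a) \<bullet> stereo (Fin b) =
     4 * (a \<bullet> b) / ((A + 1) * (B + 1)) + (A - 1) / (A + 1) * ((B - 1) / (B + 1))"
    using i by (simp add: A_def B_def)
  also have "\<dots> = 1 - 2 * ((A + B - 2 * (a \<bullet> b)) / ((A + 1) * (B + 1)))"
    using AB by (simp add: divide_simps) (simp add: algebra_simps)
  finally have "(chd (Fin a) (Fin b))\<^sup>2 = (A + B - 2 * (a \<bullet> b)) / ((A + 1) * (B + 1))"
    using chd_sq[of "Fin a" "Fin b"] by argo
  also have "A + B - 2 * (a \<bullet> b) = (cmod (a - b))\<^sup>2"
    unfolding A_def B_def by (simp add: power2_norm_eq_inner inner_diff_left inner_diff_right inner_commute)
  also have "\<dots> / ((A + 1) * (B + 1)) =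
     (cmod (a - b) / (sqrt (1 + (cmod a)\<^sup>2) * sqrt (1 + (cmod b)\<^sup>2)))\<^sup>2"
    using AB by (simp add: power_divide power_mult_distrib A_def B_def add.commute)
  finally show ?thesis
    by (metis chd_nonneg power2_eq_iff_nonneg divide_nonneg_nonneg norm_ge_zero mult_nonneg_nonneg
        real_sqrt_ge_zero add_nonneg_nonneg zero_le_one zero_le_power2)
qed

lemma chd_Fin_Infty: "chd (Fin a) Infty = 1 / sqrt (1 + (cmod a)\<^sup>2)"
proof -
  define A where "A = (cmod a)\<^sup>2"
  have A: "A + 1 > 0" by (simp add: A_def add_nonneg_pos)
  have "(chd (Fin a) Infty)\<^sup>2 = 1 / (A + 1)"
    unfolding chd_sq using A by (simp add: A_def[symmetric] field_simps)
  also have "\<dots> = (1 / sqrt (1 + (cmod a)\<^sup>2))\<^sup>2"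
    using A by (simp add: power_divide A_def add.commute)
  finally show ?thesis
    by (metis chd_nonneg power2_eq_iff_nonneg divide_nonneg_nonneg
        real_sqrt_ge_zero add_nonneg_nonneg zero_le_one zero_le_power2)
qed

section \<open>Chordal distance in homogeneous coordinates\<close>

definition nrm :: "complex \<Rightarrow> complex \<Rightarrow> real" where
  "nrm P Q = sqrt ((cmod P)\<^sup>2 + (cmod Q)\<^sup>2)"

lemma nrm_pos: "P \<noteq> 0 \<or> Q \<noteq> 0 \<Longrightarrow> 0 < nrm P Q"
  unfolding nrm_def by (auto intro: add_pos_nonneg add_nonneg_pos)

lemma nrm_nonneg [simp]: "0 \<le> nrm P Q"
  by (simp add: nrm_def)

lemma nrm_sq: "(nrm P Q)\<^sup>2 = (cmod P)\<^sup>2 + (cmod Q)\<^sup>2"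
  by (simp add: nrm_def)

lemma nrm_scale: "Q \<noteq> 0 \<Longrightarrow> nrm P Q = cmod Q * sqrt (1 + (cmod (P / Q))\<^sup>2)"
proof -
  assume Q: "Q \<noteq> 0"
  have "(cmod P)\<^sup>2 + (cmod Q)\<^sup>2 = (cmod Q)\<^sup>2 * (1 + (cmod (P / Q))\<^sup>2)"
    using Q by (simp add: norm_divide power_divide field_simps)
  then show ?thesis by (simp add: nrm_def real_sqrt_mult)
qed

lemma nrm_commute: "nrm P Q = nrm Q P"
  by (simp add: nrm_def add.commute)

text \<open>The numerator is the determinant of the two lifts to C^2, so the right-hand side is
  invariant under rescaling them. The formula treats infinity like any other point and turns
  estimates for rational maps into estimates for polynomials.\<close>

lemma chd_pt:
  assumes "P \<noteq> 0 \<or> Q \<noteq> 0" "R \<noteq> 0 \<or> S \<noteq> 0"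
  shows "chd (pt P Q) (pt R S) = cmod (P * S - R * Q) / (nrm P Q * nrm R S)"
proof -
  have *: "chd Infty (pt R S) = cmod S / nrm R S" if "R \<noteq> 0 \<or> S \<noteq> 0" for R S
    using that by (cases "S = 0") (auto simp: pt_def chd_commute[of Infty] chd_Fin_Infty nrm_scale)
  consider "Q = 0" | "S = 0" | "Q \<noteq> 0" "S \<noteq> 0" by blast
  then show ?thesis
  proof cases
    case 1
    then show ?thesis using assms *[of R S]
      by (auto simp: pt_def nrm_def norm_mult)
  next
    case 2
    then show ?thesis using assms *[of P Q]
      by (auto simp: pt_def nrm_def norm_mult chd_commute[of _ Infty])
  next
    case 3
    have "cmod (P * S - R * Q) = cmod (Q * S * (P / Q - R / S))"
      using 3 by (simp add: right_diff_distrib mult.commute)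
    then have "cmod (P * S - R * Q) = cmod Q * cmod S * cmod (P / Q - R / S)"
      by (simp add: norm_mult)
    then show ?thesis using 3
      by (simp add: pt_def chd_Fin nrm_scale)
  qed
qed

lemma pt_surj: obtains P Q where "x = pt P Q" "P \<noteq> 0 \<or> Q \<noteq> 0" "nrm P Q = 1"
proof (cases x)
  case Infty
  then show ?thesis using that[of 1 0] by (auto simp: pt_def nrm_def)
next
  case (Fin z)
  define s where "s = sqrt (1 + (cmod z)\<^sup>2)"
  have s: "s > 0" using sqrt_pos' by (simp add: s_def)
  have n1: "nrm (z / of_real s) (1 / of_real s) = 1"
    using s by (subst nrm_scale) (auto simp: norm_divide s_def)
  show ?thesis using s by (intro that[OF _ _ n1]) (auto simp: pt_def Fin)
qed

lemma pt_eq_iff: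
  assumes "P \<noteq> 0 \<or> Q \<noteq> 0" "R \<noteq> 0 \<or> S \<noteq> 0"
  shows "pt P Q = pt R S \<longleftrightarrow> P * S = R * Q"
  using assms nrm_pos[of P Q] nrm_pos[of R S]
  by (subst chd_eq_0_iff[symmetric], subst chd_pt) auto

section \<open>The charts z and 1 / z\<close>

definition chart :: "bool \<Rightarrow> complex \<Rightarrow> riemann_sphere" where
  "chart b z = (if b then pt z 1 else pt 1 z)"

lemma chart_True: "chart True z = Fin z"
  by (simp add: chart_def pt_def)

lemma chart_False: "chart False z = sphere_inv (Fin z)"
  by (simp add: chart_def pt_def)

lemma chd_chart:
  "chd (chart b z) (chart b w) = cmod (z - w) / (sqrt (1 + (cmod z)\<^sup>2) * sqrt (1 + (cmod w)\<^sup>2))"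
  by (cases b) (simp_all add: chart_def chd_pt nrm_def add.commute norm_minus_commute)

lemma chd_chart_le: "chd (chart b z) (chart b w) \<le> cmod (z - w)"
proof -
  have "1 \<le> sqrt (1 + (cmod z)\<^sup>2) * sqrt (1 + (cmod w)\<^sup>2)"
    by (intro mult_ge1_I) auto
  then show ?thesis unfolding chd_chart
    by (intro divide_le_eq[THEN iffD2]) (auto simp: mult_left_le mult_le_cancel_left1)
qed

lemma sqrt_le_add: "sqrt (1 + (cmod z)\<^sup>2) \<le> 1 + cmod z"
  by (rule real_le_lsqrt) (auto simp: power2_eq_square algebra_simps)

lemma cmod_le_chd_chart:
  assumes "cmod z \<le> T" "cmod w \<le> T"
  shows "cmod (z - w) \<le> (1 + T)\<^sup>2 * chd (chart b z) (chart b w)"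
proof -
  have T: "0 \<le> T" using assms(1) norm_ge_zero order_trans by blast
  have "sqrt (1 + (cmod z)\<^sup>2) * sqrt (1 + (cmod w)\<^sup>2) \<le> (1 + T) * (1 + T)"
    using sqrt_le_add[of z] sqrt_le_add[of w] assms T by (intro mult_mono) auto
  then have "cmod (z - w) / ((1 + T) * (1 + T)) \<le> chd (chart b z) (chart b w)"
    unfolding chd_chart using sqrt_pos'[of z] sqrt_pos'[of w] by (intro divide_left_mono) (auto intro!: mult_pos_pos add_nonneg_pos simp: T add_pos_nonneg)
  then show ?thesis using T by (simp add: pos_divide_le_eq power2_eq_square mult.commute)
qed

lemma chart_cover: obtains b a where "x = chart b a" "cmod a \<le> 1"
proof (cases x)
  case Infty
  then show ?thesis using that[of False 0] by (simp add: chart_def pt_def)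
next
  case (Fin z)
  show ?thesis
  proof (cases "cmod z \<le> 1")
    case True then show ?thesis using that[of True z] Fin by (simp add: chart_True)
  next
    case False
    then have "z \<noteq> 0" by auto
    then show ?thesis using that[of False "1 / z"] Fin False by (simp add: chart_False norm_divide)
  qed
qed

text \<open>The radius plays two roles: it excludes the one point of the sphere that chart
  \<open>b\<close> misses, and it forces the coordinate into the disc of radius e, because for |a -
  r| at least e the chordal distance is at least e / ((2 + |r|) (1 + |r|)).\<close>

lemma chart_near:
  assumes "0 < e" "e \<le> 1" and d: "chd x (chart b r) < e / ((2 + cmod r) * (1 + cmod r))"
  obtains a where "x = chart b a" "cmod (a - r) < e"
proof -
  have far: "chd Infty (Fin r) \<ge> e / ((2 + cmod r) * (1 + cmod r))" for r
  proof -
    have "1 / ((2 + cmod r) * (1 + cmod r)) \<le> 1 / sqrt (1 + (cmod r)\<^sup>2)"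
    proof (rule frac_le[OF _ order_refl sqrt_pos'])
      have "1 * (1 + cmod r) \<le> (2 + cmod r) * (1 + cmod r)" by (rule mult_right_mono) auto
      then show "sqrt (1 + (cmod r)\<^sup>2) \<le> (2 + cmod r) * (1 + cmod r)"
        using order_trans[OF sqrt_le_add[of r]] by simp
    qed simp
    moreover have "e / ((2 + cmod r) * (1 + cmod r)) \<le> 1 / ((2 + cmod r) * (1 + cmod r))"
      using assms(2) by (intro divide_right_mono) auto
    ultimately show ?thesis
      unfolding chd_commute[of Infty] chd_Fin_Infty by linarith
  qed
  have "\<exists>a. x = chart b a"
  proof (cases b)
    case True
    then have "x \<noteq> Infty" using d far[of r] by (auto simp: chart_True)
    then show ?thesis using True by (cases x) (auto simp: chart_True)
  next
    case False
    have "x \<noteq> Fin 0"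
    proof
      assume x: "x = Fin 0"
      have "chd (pt 0 1) (pt 1 r) = chd (pt 1 0) (pt r 1)"
        by (simp add: chd_pt nrm_commute[of r])
          (simp add: nrm_def)
      then have "chd x (chart b r) = chd Infty (Fin r)"
        using False x by (simp add: chart_def pt_def)
      then show False using d far[of r] by simp
    qed
    show ?thesis
    proof (cases x)
      case (Fin z)
      then have "x = chart b (1 / z)" using False \<open>x \<noteq> Fin 0\<close> by (auto simp: chart_False)
      then show ?thesis ..
    next
      case Infty
      then have "x = chart b 0" using False by (simp add: chart_False)
      then show ?thesis ..
    qed
  qed
  then obtain a where a: "x = chart b a" by blast
  have "cmod (a - r) < e"
  proof (rule ccontr)
    assume "\<not> cmod (a - r) < e"
    then have ge: "e \<le> cmod (a - r)" by simp
    have "sqrt (1 + (cmod a)\<^sup>2) \<le> 1 + cmod r + cmod (a - r)"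
      using sqrt_le_add[of a] norm_triangle_ineq[of "a - r" r] by simp
    also have "e * \<dots> \<le> (2 + cmod r) * cmod (a - r)"
    proof -
      have "e * (1 + cmod r) \<le> cmod (a - r) * (1 + cmod r)" using ge by (intro mult_right_mono) auto
      moreover have "e * cmod (a - r) \<le> cmod (a - r)" using assms(2) by (simp add: mult_left_le_one_le assms(1) less_imp_le)
      ultimately show ?thesis by (simp add: algebra_simps)
    qed
    finally have 1: "e * sqrt (1 + (cmod a)\<^sup>2) \<le> (2 + cmod r) * cmod (a - r)"
      using assms(1) by simp
    have "e * (sqrt (1 + (cmod a)\<^sup>2) * sqrt (1 + (cmod r)\<^sup>2)) \<le> ((2 + cmod r) * cmod (a - r)) * (1 + cmod r)"
      unfolding mult.assoc[symmetric]
      by (intro mult_mono 1 sqrt_le_add) auto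
    then have "e / ((2 + cmod r) * (1 + cmod r)) \<le> chd x (chart b r)"
      unfolding a chd_chart using sqrt_pos'[of a] sqrt_pos'[of r]
      by (simp add: divide_le_eq pos_le_divide_eq field_simps add_pos_nonneg)
    then show False using d by simp
  qed
  then show thesis using that a by blast
qed

lemma chd_affine_le:
  assumes "v \<noteq> 0" "w \<noteq> 0"
  shows "chd (pt u v) (pt u' w) \<le> cmod (u / v - u' / w)"
  using chd_chart_le[of True "u / v" "u' / w"] assms by (simp add: chart_True pt_def)

section \<open>Metric estimates for rational maps\<close>

lemma poly_bounded_cball:
  fixes P :: "complex poly"
  obtains M where "M \<ge> 0" "\<And>z. cmod z \<le> T \<Longrightarrow> cmod (poly P z) \<le> M"
proof -
  have "bounded (poly P ` cball 0 T)"
    by (intro compact_imp_bounded compact_continuous_image continuous_intros compact_cball)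
  then obtain M where M: "\<And>y. y \<in> poly P ` cball 0 T \<Longrightarrow> norm y \<le> M" by (meson bounded_iff)
  show thesis
    by (rule that[of "max M 0"]) (use M in \<open>auto intro: max.coboundedI1\<close>)
qed

text \<open>Induction on the coefficients: for c + X P the error is b times the error of P plus (b -
  a)^2 P'(a), so one constant serves all pairs of points of the disc.\<close>

lemma poly_taylor:
  fixes P :: "complex poly"
  shows "\<exists>M\<ge>0. \<forall>a b. cmod a \<le> T \<longrightarrow> cmod b \<le> T \<longrightarrow>
           cmod (poly P b - poly P a - poly (pderiv P) a * (b - a)) \<le> M * (cmod (b - a))\<^sup>2"
proof (induction P)
  case 0
  then show ?case by (intro exI[of _ 0]) auto
next
  case (pCons c P)
  then obtain M where M: "M \<ge> 0" "\<And>a b. cmod a \<le> T \<Longrightarrow> cmod b \<le> T \<Longrightarrow>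
      cmod (poly P b - poly P a - poly (pderiv P) a * (b - a)) \<le> M * (cmod (b - a))\<^sup>2" by blast
  obtain N where N: "N \<ge> 0" "\<And>z. cmod z \<le> T \<Longrightarrow> cmod (poly (pderiv P) z) \<le> N"
    using poly_bounded_cball by blast
  show ?case
  proof (intro exI[of _ "\<bar>T\<bar> * M + N"] conjI allI impI)
    fix a b assume ab: "cmod a \<le> T" "cmod b \<le> T"
    have "poly (pCons c P) b - poly (pCons c P) a - poly (pderiv (pCons c P)) a * (b - a) =
       b * (poly P b - poly P a - poly (pderiv P) a * (b - a)) + (b - a)\<^sup>2 * poly (pderiv P) a"
      by (simp add: pderiv_pCons algebra_simps power2_eq_square)
    also have "cmod \<dots> \<le> cmod b * cmod (poly P b - poly P a - poly (pderiv P) a * (b - a))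
        + (cmod (b - a))\<^sup>2 * cmod (poly (pderiv P) a)"
      by (rule order_trans[OF norm_triangle_ineq]) (simp add: norm_mult norm_power)
    also have "\<dots> \<le> \<bar>T\<bar> * (M * (cmod (b - a))\<^sup>2) + (cmod (b - a))\<^sup>2 * N"
      using ab M N by (intro add_mono mult_mono) auto
    finally show "cmod (poly (pCons c P) b - poly (pCons c P) a - poly (pderiv (pCons c P)) a * (b - a))
        \<le> (\<bar>T\<bar> * M + N) * (cmod (b - a))\<^sup>2" by (simp add: algebra_simps)
  qed (use M N in auto)
qed

lemma coprime_imp_no_common_root:
  fixes P Q :: "'a :: field poly"
  assumes "coprime P Q"
  shows "poly P z \<noteq> 0 \<or> poly Q z \<noteq> 0"
proof (rule ccontr)
  assume "\<not> ?thesis"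
  then have "[:-z, 1:] dvd P" "[:-z, 1:] dvd Q" by (auto simp: poly_eq_0_iff_dvd)
  then have "is_unit [:-z, 1:]" using assms by (meson coprime_common_divisor)
  then show False by (simp add: is_unit_poly_iff)
qed

text \<open>At a zero of Q of order k, P does not vanish, so P Q' has order k - 1 while P' Q has
  order at least k. If the two agree, Q has no zero, and by symmetry neither has P, so both are
  constant.\<close>

lemma wronskian_nonzero:
  fixes P Q :: "complex poly"
  assumes cp: "\<And>z. poly P z \<noteq> 0 \<or> poly Q z \<noteq> 0" and deg: "degree P > 0 \<or> degree Q > 0"
  shows "pderiv P * Q - P * pderiv Q \<noteq> 0"
proof
  assume eq: "pderiv P * Q - P * pderiv Q = 0"
  have *: "degree Q = 0" if cp: "\<And>z. poly P z \<noteq> 0 \<or> poly Q z \<noteq> 0" and eq: "pderiv P * Q = P * pderiv Q"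
    for P Q :: "complex poly"
  proof (rule ccontr)
    assume "degree Q \<noteq> 0"
    then have nz: "Q \<noteq> 0" "pderiv Q \<noteq> 0" and nc: "\<not> constant (poly Q)"
      by (auto simp: pderiv_eq_0_iff constant_degree)
    obtain z where z: "poly Q z = 0" using Fundamental_Theorem_Algebra.fundamental_theorem_of_algebra[OF nc] by auto
    have Pz: "poly P z \<noteq> 0" using cp z by blast
    then have nz': "P * pderiv Q \<noteq> 0" using nz by auto
    have "order z (P * pderiv Q) = order z P + order z (pderiv Q)"
      by (rule order_mult[OF nz'])
    moreover have "order z P = 0" using Pz by (rule order_0I)
    moreover have "order z Q = Suc (order z (pderiv Q))"
      using nz z by (intro order_pderiv) (simp_all add: order_root)
    ultimately have lt: "order z (P * pderiv Q) < order z Q" by simp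
    have "[:-z, 1:] ^ order z Q dvd pderiv P * Q"
      by (intro dvd_mult order_1)
    then have "order z Q \<le> order z (P * pderiv Q)"
      unfolding eq using nz' by (simp add: order_divides)
    then show False using lt by simp
  qed
  have "degree Q = 0" using *[OF cp] eq by simp
  moreover have "degree P = 0"
    by (rule *[of Q P]) (use cp eq in \<open>auto simp: mult.commute\<close>)
  ultimately show False using deg by simp
qed

section \<open>Rational maps in homogeneous coordinates and in charts\<close>

locale rational =
  fixes p q :: "complex poly" and d :: nat and f :: "riemann_sphere \<Rightarrow> riemann_sphere"
  assumes coprime: "coprime p q" and d_def: "d = max (degree p) (degree q)" and d_ge: "d \<ge> 2"
    and f_def: "f = rational_fun p q"
begin

text \<open>Homogenisation in degree d, whatever the degree of r, so that the pair for p and q is a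
  lift of \<open>f\<close> to C^2 without zeros outside the origin.\<close>

definition hom :: "complex poly \<Rightarrow> complex \<Rightarrow> complex \<Rightarrow> complex" where
  "hom r P Q = (\<Sum>i\<le>d. coeff r i * P ^ i * Q ^ (d - i))"

lemma deg_le: "degree p \<le> d" "degree q \<le> d"
  by (auto simp: d_def)

lemma hom_nz:
  assumes "Q \<noteq> 0" "degree r \<le> d" shows "hom r P Q = Q ^ d * poly r (P / Q)"
proof -
  have "poly r (P / Q) = (\<Sum>i\<le>d. coeff r i * (P / Q) ^ i)"
  proof -
    have "(\<Sum>i\<le>d. coeff r i * (P / Q) ^ i) = (\<Sum>i\<le>degree r. coeff r i * (P / Q) ^ i)"
      using assms by (intro sum.mono_neutral_right) (auto simp: coeff_eq_0)
    then show ?thesis by (simp add: poly_altdef)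
  qed
  then show ?thesis
    unfolding hom_def using assms(1)
    by (auto simp: sum_distrib_left power_divide power_diff intro!: sum.cong)
qed

lemma hom_0: "hom r P 0 = coeff r d * P ^ d"
proof -
  have "hom r P 0 = (\<Sum>i\<in>{d}. coeff r i * P ^ i * 0 ^ (d - i))"
    unfolding hom_def by (intro sum.mono_neutral_right) auto
  then show ?thesis by simp
qed

lemma no_common_root: "poly p z \<noteq> 0 \<or> poly q z \<noteq> 0"
  using coprime by (rule coprime_imp_no_common_root)

lemma coeff_d: "coeff p d \<noteq> 0 \<or> coeff q d \<noteq> 0"
proof (cases "degree p = d")
  case True
  then have "p \<noteq> 0" using d_ge by auto
  then show ?thesis using True by auto
next
  case False
  then have "degree q = d" by (auto simp: d_def max_def split: if_splits)
  moreover from this have "q \<noteq> 0" using d_ge by auto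
  ultimately show ?thesis by auto
qed

lemma hom_nonzero:
  assumes "P \<noteq> 0 \<or> Q \<noteq> 0" shows "hom p P Q \<noteq> 0 \<or> hom q P Q \<noteq> 0"
proof (cases "Q = 0")
  case True
  then show ?thesis using assms coeff_d by (auto simp: hom_0)
next
  case False
  then show ?thesis using no_common_root[of "P / Q"] by (auto simp: hom_nz deg_le)
qed

lemma f_pt:
  assumes "P \<noteq> 0 \<or> Q \<noteq> 0" shows "f (pt P Q) = pt (hom p P Q) (hom q P Q)"
proof (cases "Q = 0")
  case True
  then show ?thesis using assms
    by (auto simp: pt_def f_def hom_0 d_def[symmetric] Let_def)
next
  case False
  then show ?thesis by (auto simp: hom_nz deg_le pt_def f_def)
qed

text \<open>For the chart at infinity this is the reversed polynomial z^d r(1 / z). Only the source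
  is put into a chart; the target stays in homogeneous coordinates, so poles need no separate
  treatment.\<close>

definition chart_poly :: "bool \<Rightarrow> complex poly \<Rightarrow> complex poly" where
  "chart_poly b r = (if b then r else (\<Sum>i\<le>d. monom (coeff r i) (d - i)))"

lemma poly_chart_poly:
  assumes "degree r \<le> d"
  shows "poly (chart_poly b r) z = (if b then hom r z 1 else hom r 1 z)"
proof (cases b)
  case True
  then show ?thesis using assms by (simp add: chart_poly_def hom_nz)
next
  case False
  then show ?thesis by (simp add: chart_poly_def poly_sum poly_monom hom_def)
qed

lemma f_chart: "f (chart b z) = pt (poly (chart_poly b p) z) (poly (chart_poly b q) z)"
  by (cases b) (simp_all add: chart_def f_pt poly_chart_poly deg_le)

lemma chart_poly_no_common_root: "poly (chart_poly b p) z \<noteq> 0 \<or> poly (chart_poly b q) z \<noteq> 0"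
  using hom_nonzero[of z 1] hom_nonzero[of 1 z] by (cases b) (simp_all add: poly_chart_poly deg_le)

lemma coeff_chart_poly_False: "coeff (chart_poly False r) d = coeff r 0"
proof -
  have "coeff (chart_poly False r) d = (\<Sum>i\<le>d. if d - i = d then coeff r i else 0)"
    by (simp add: chart_poly_def coeff_sum)
  also have "\<dots> = (\<Sum>i\<in>{0}. if d - i = d then coeff r i else 0)"
    using d_ge by (intro sum.mono_neutral_right) auto
  finally show ?thesis by simp
qed

lemma chart_poly_nonconst: "degree (chart_poly b p) > 0 \<or> degree (chart_poly b q) > 0"
proof (cases b)
  case True
  have "degree p = d \<or> degree q = d" unfolding d_def by linarith
  moreover have "chart_poly b r = r" for r using True by (simp add: chart_poly_def)
  moreover have "0 < d" using d_ge by linarith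
  ultimately show ?thesis by metis
next
  case False
  have "coeff p 0 \<noteq> 0 \<or> coeff q 0 \<noteq> 0" using no_common_root[of 0] by (simp add: poly_0_coeff_0)
  then have "degree (chart_poly False p) \<ge> d \<or> degree (chart_poly False q) \<ge> d"
    using coeff_chart_poly_False[of p] coeff_chart_poly_False[of q]
      le_degree[of "chart_poly False p" d] le_degree[of "chart_poly False q" d] by argo
  moreover have "0 < d" using d_ge by linarith
  ultimately show ?thesis using False by (simp, linarith)
qed

text \<open>The Wronskian of the two components of \<open>f\<close> in chart \<open>b\<close>. It
  vanishes exactly where the derivative does, whichever chart is used at the image point.\<close>

definition W :: "bool \<Rightarrow> complex poly" where
  "W b = pderiv (chart_poly b p) * chart_poly b q - chart_poly b p * pderiv (chart_poly b q)"

lemma W_nonzero: "W b \<noteq> 0"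
  unfolding W_def by (intro wronskian_nonzero chart_poly_no_common_root chart_poly_nonconst)

text \<open>By \<open>chd_pt\<close> the distance of the images is |A(z) B(a) - A(a) B(z)| / (N(a)
  N(z)). The numerator is |W(a) (z - a)| up to O(|z - a|^2), and N lies between positive bounds on
  the disc.\<close>

lemma local_estimate:
  "\<exists>K\<ge>1. \<forall>a z. cmod a \<le> T \<longrightarrow> cmod z \<le> T \<longrightarrow>
     chd (f (chart b a)) (f (chart b z)) \<le> K * (cmod (poly (W b) a) + cmod (z - a)) * cmod (z - a) \<and>
     (cmod (poly (W b) a) / K - K * cmod (z - a)) * cmod (z - a) \<le> chd (f (chart b a)) (f (chart b z))"
proof -
  define A B where "A = chart_poly b p" and "B = chart_poly b q"
  define N where "N z = nrm (poly A z) (poly B z)" for z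
  have Npos: "N z > 0" for z
    using chart_poly_no_common_root[of b z] by (simp add: N_def A_def B_def nrm_pos)
  have Ncont: "continuous_on X N" for X unfolding N_def nrm_def by (intro continuous_intros)
  obtain m where m: "m > 0" "\<And>z. cmod z \<le> T \<Longrightarrow> m \<le> N z"
  proof (cases "T < 0")
    case True
    then have "\<not> cmod z \<le> T" for z using norm_ge_zero[of z] by linarith
    then show ?thesis using that[of 1] by auto
  next
    case False
    then obtain z where "z \<in> cball 0 T" "\<And>y. y \<in> cball 0 T \<Longrightarrow> N z \<le> N y"
      using continuous_attains_inf[OF compact_cball _ Ncont, of 0 T] by auto
    then show ?thesis using that[of "N z"] Npos by auto
  qed
  obtain MA where MA: "MA \<ge> 0" "\<And>a z. cmod a \<le> T \<Longrightarrow> cmod z \<le> T \<Longrightarrow>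
      cmod (poly A z - poly A a - poly (pderiv A) a * (z - a)) \<le> MA * (cmod (z - a))\<^sup>2"
    using poly_taylor by blast
  obtain MB where MB: "MB \<ge> 0" "\<And>a z. cmod a \<le> T \<Longrightarrow> cmod z \<le> T \<Longrightarrow>
      cmod (poly B z - poly B a - poly (pderiv B) a * (z - a)) \<le> MB * (cmod (z - a))\<^sup>2"
    using poly_taylor by blast
  obtain BA where BA: "BA \<ge> 0" "\<And>z. cmod z \<le> T \<Longrightarrow> cmod (poly A z) \<le> BA" using poly_bounded_cball by blast
  obtain BB where BB: "BB \<ge> 0" "\<And>z. cmod z \<le> T \<Longrightarrow> cmod (poly B z) \<le> BB" using poly_bounded_cball by blast
  define M where "M = BB * MA + BA * MB"
  have M0: "M \<ge> 0" using MA MB BA BB by (simp add: M_def)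
  have Nle: "N z \<le> BA + BB" if "cmod z \<le> T" for z
    unfolding N_def nrm_def
    using BA(2)[OF that] BB(2)[OF that] sqrt_sum_squares_le_sum[of "cmod (poly A z)" "cmod (poly B z)"] by simp
  have W: "cmod (poly A z * poly B a - poly A a * poly B z - poly (W b) a * (z - a)) \<le> M * (cmod (z - a))\<^sup>2"
    if "cmod a \<le> T" "cmod z \<le> T" for a z
  proof -
    have "poly A z * poly B a - poly A a * poly B z - poly (W b) a * (z - a) =
       poly B a * (poly A z - poly A a - poly (pderiv A) a * (z - a))
       - poly A a * (poly B z - poly B a - poly (pderiv B) a * (z - a))"
      by (simp add: W_def A_def[symmetric] B_def[symmetric] algebra_simps)
    also have "cmod \<dots> \<le> BB * (MA * (cmod (z - a))\<^sup>2) + BA * (MB * (cmod (z - a))\<^sup>2)"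
      by (rule order_trans[OF norm_triangle_ineq4], unfold norm_mult, intro add_mono mult_mono)
        (use that MA MB BA BB in auto)
    finally show ?thesis by (simp add: M_def algebra_simps)
  qed
  have chd_f: "chd (f (chart b a)) (f (chart b z)) =
      cmod (poly A z * poly B a - poly A a * poly B z) / (N a * N z)" for a z
    using chart_poly_no_common_root[of b a] chart_poly_no_common_root[of b z]
    by (simp add: f_chart chd_pt A_def B_def N_def norm_minus_commute mult.commute)
  define S where "S = BA + BB + 1"
  define K where "K = 1 + S\<^sup>2 + 1 / m\<^sup>2 + M / m\<^sup>2"
  have K1: "K \<ge> 1" using m M0 by (simp add: K_def)
  show ?thesis
  proof (intro exI[of _ K] conjI allI impI)
    fix a z assume az: "cmod a \<le> T" "cmod z \<le> T"
    define w e where "w = cmod (poly (W b) a)" and "e = cmod (z - a)"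
    define X where "X = cmod (poly A z * poly B a - poly A a * poly B z)"
    have we: "w \<ge> 0" "e \<ge> 0" by (simp_all add: w_def e_def)
    have NN: "m\<^sup>2 \<le> N a * N z" "N a * N z \<le> S\<^sup>2"
      unfolding power2_eq_square
       using m(2)[OF az(1)] m(2)[OF az(2)] m(1) Nle[OF az(1)] Nle[OF az(2)] BA(1) BB(1)
      by (auto intro!: mult_mono simp: S_def)
    have Xw: "\<bar>X - w * e\<bar> \<le> M * e\<^sup>2"
      using W[OF az] norm_triangle_ineq3[of "poly A z * poly B a - poly A a * poly B z" "poly (W b) a * (z - a)"]
      by (simp add: X_def w_def e_def norm_mult)
    have Np: "0 < N a * N z" using Npos by simp
    have chd: "chd (f (chart b a)) (f (chart b z)) = X / (N a * N z)" by (simp add: chd_f X_def)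
    have "X / (N a * N z) \<le> (w * e + M * e\<^sup>2) / m\<^sup>2"
    proof (rule frac_le)
      show "X \<le> w * e + M * e\<^sup>2" using Xw by linarith
      show "0 \<le> w * e + M * e\<^sup>2" using we M0 by simp
    qed (use m NN in auto)
    also have "\<dots> = (1 / m\<^sup>2) * (w * e) + (M / m\<^sup>2) * (e * e)"
      by (simp add: add_divide_distrib power2_eq_square)
    also have "\<dots> \<le> K * (w * e) + K * (e * e)"
      by (intro add_mono mult_right_mono) (use we m M0 in \<open>auto simp: K_def\<close>)
    finally show "chd (f (chart b a)) (f (chart b z)) \<le> K * (w + e) * e"
      by (simp add: chd algebra_simps)
    have "w * e / K - K * e\<^sup>2 \<le> w * e / S\<^sup>2 - M * e\<^sup>2 / m\<^sup>2"
    proof -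
      have "w * e / K \<le> w * e / S\<^sup>2"
      proof (rule divide_left_mono)
        show "S\<^sup>2 \<le> K" using m M0 by (simp add: K_def)
        show "0 < K * S\<^sup>2" using K1 BA BB by (simp add: S_def)
      qed (use we in simp)
      moreover have "M / m\<^sup>2 * e\<^sup>2 \<le> K * e\<^sup>2" 
        by (intro mult_right_mono) (use m M0 in \<open>auto simp: K_def\<close>)
      ultimately show ?thesis by simp
    qed
    also have "\<dots> \<le> w * e / (N a * N z) - M * e\<^sup>2 / (N a * N z)"
    proof (intro diff_mono)
      have "0 < S" using BA BB by (simp add: S_def)
      then show "w * e / S\<^sup>2 \<le> w * e / (N a * N z)"
        using divide_left_mono[OF NN(2), of "w * e"] Np we by simp
      show "M * e\<^sup>2 / (N a * N z) \<le> M * e\<^sup>2 / m\<^sup>2"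
        using divide_left_mono[OF NN(1), of "M * e\<^sup>2"] Np we m M0 by simp
    qed
    also have "\<dots> \<le> X / (N a * N z)"
      unfolding diff_divide_distrib[symmetric] using Xw Np by (intro divide_right_mono) auto
    finally show "(w / K - K * e) * e \<le> chd (f (chart b a)) (f (chart b z))"
      by (simp add: chd algebra_simps power2_eq_square)
  qed (rule K1)
qed

text \<open>6 is the value of (2 + |r|) (1 + |r|) at |r| = 1, so that \<open>chart_near\<close>
  applies with e = 1 at every centre in the closed unit disc.\<close>

lemma chart_neighbour:
  assumes "x = chart b a" "cmod a \<le> 1" "chd x y < 1 / 6"
  obtains z where "y = chart b z" "cmod (z - a) < 1" "cmod z \<le> 2"
proof -
  have "(2 + cmod a) * (1 + cmod a) \<le> 3 * 2"
    using assms(2) by (intro mult_mono) auto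
  moreover have "0 < (2 + cmod a) * (1 + cmod a)"
    by (intro mult_pos_pos add_pos_nonneg) auto
  ultimately have "1 / 6 \<le> 1 / ((2 + cmod a) * (1 + cmod a))"
    by (intro divide_left_mono) auto
  then have "chd y (chart b a) < 1 / ((2 + cmod a) * (1 + cmod a))"
    using assms by (simp add: chd_commute)
  then obtain z where z: "y = chart b z" "cmod (z - a) < 1"
    using chart_near[of 1 y b a] by auto
  moreover have "cmod z \<le> 2" using z(2) assms(2) norm_triangle_ineq[of "z - a" a] by simp
  ultimately show thesis using that by blast
qed

text \<open>Points closer than 1 / 6 lie in a common chart, where \<open>local_estimate\<close>
  applies; for all others the factor 6 suffices because chordal distances are at most 1.\<close>

lemma lipschitz:
  obtains L where "L \<ge> 1" "\<And>x y. chd (f x) (f y) \<le> L * chd x y"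
proof -
  have "\<exists>L\<ge>0. \<forall>a z. cmod a \<le> 2 \<longrightarrow> cmod z \<le> 2 \<longrightarrow>
      chd (f (chart b a)) (f (chart b z)) \<le> L * chd (chart b a) (chart b z)" for b
  proof -
    obtain K where K: "K \<ge> 1" "\<And>a z. cmod a \<le> 2 \<Longrightarrow> cmod z \<le> 2 \<Longrightarrow>
       chd (f (chart b a)) (f (chart b z)) \<le> K * (cmod (poly (W b) a) + cmod (z - a)) * cmod (z - a)"
      "\<And>a z. cmod a \<le> 2 \<Longrightarrow> cmod z \<le> 2 \<Longrightarrow>
       (cmod (poly (W b) a) / K - K * cmod (z - a)) * cmod (z - a) \<le> chd (f (chart b a)) (f (chart b z))"
      using local_estimate[of 2 b] by auto
    obtain M where M: "M \<ge> 0" "\<And>z. cmod z \<le> 2 \<Longrightarrow> cmod (poly (W b) z) \<le> M"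
      using poly_bounded_cball by blast
    show ?thesis
    proof (intro exI[of _ "K * (M + 4) * 9"] conjI allI impI)
      fix a z assume az: "cmod a \<le> 2" "cmod z \<le> 2"
      have e: "cmod (z - a) \<le> 4" using az norm_triangle_ineq4[of z a] by linarith
      have e9: "cmod (z - a) \<le> 9 * chd (chart b a) (chart b z)"
        using cmod_le_chd_chart[OF az(2,1), of b] by (simp add: chd_commute)
      have "chd (f (chart b a)) (f (chart b z)) \<le> K * (cmod (poly (W b) a) + cmod (z - a)) * cmod (z - a)"
        by (rule K(2)[OF az])
      also have "\<dots> \<le> K * (M + 4) * (9 * chd (chart b a) (chart b z))"
        using M(2)[OF az(1)] e e9 K(1) M(1) by (intro mult_mono add_mono) auto
      finally show "chd (f (chart b a)) (f (chart b z)) \<le> K * (M + 4) * 9 * chd (chart b a) (chart b z)"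
        by (simp only: mult.assoc)
    qed (use K M in auto)
  qed
  then obtain L where L: "\<And>b. L b \<ge> (0::real)" "\<And>b a z. cmod a \<le> 2 \<Longrightarrow> cmod z \<le> 2 \<Longrightarrow>
      chd (f (chart b a)) (f (chart b z)) \<le> L b * chd (chart b a) (chart b z)" by metis
  show thesis
  proof (rule that[of "L True + L False + 6"])
    show "1 \<le> L True + L False + 6" using L(1)[of True] L(1)[of False] by linarith
    fix x y
    obtain b a where x: "x = chart b a" "cmod a \<le> 1" by (rule chart_cover)
    have Lb: "L b + 6 \<le> L True + L False + 6" using L(1)[of True] L(1)[of False] by (cases b) auto
    have "chd (f x) (f y) \<le> (L b + 6) * chd x y"
    proof (cases "chd x y < 1 / 6")
      case True
      then obtain z where z: "y = chart b z" "cmod z \<le> 2" using chart_neighbour[OF x] by blast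
      have "chd (f x) (f y) \<le> L b * chd x y" using L(2)[of a z b] x z by simp
      moreover have "0 \<le> 6 * chd x y" by simp
      ultimately show ?thesis by (simp add: distrib_right add_increasing2)
    next
      case False
      have "chd (f x) (f y) \<le> 6 * chd x y" using chd_le_1[of "f x" "f y"] False by linarith
      moreover have "0 \<le> L b * chd x y" using L(1) by simp
      ultimately show ?thesis by (simp only: distrib_right)
    qed
    also have "\<dots> \<le> (L True + L False + 6) * chd x y" by (intro mult_right_mono Lb) simp
    finally show "chd (f x) (f y) \<le> (L True + L False + 6) * chd x y" .
  qed
qed

text \<open>Since W vanishes at r, |W(a)| is O(|a - r|), and the upper bound of
  \<open>local_estimate\<close> gains a factor of the order of the distances to the critical point.
  Away from it the Lipschitz bound suffices, at the cost of the factor 1 / \<delta>.\<close>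

lemma critical_contraction:
  assumes "poly (W b) r = 0"
  obtains A where "A \<ge> 0"
    "\<And>x y. chd (f x) (f y) \<le> A * max (chd x (chart b r)) (chd y (chart b r)) * chd x y"
proof -
  define T c where "T = cmod r + 1" and "c = chart b r"
  have T: "T \<ge> 0" by (simp add: T_def)
  obtain L where L: "L \<ge> 1" "\<And>x y. chd (f x) (f y) \<le> L * chd x y" by (rule lipschitz) blast
  obtain K where K: "K \<ge> 1" "\<And>a z. cmod a \<le> T \<Longrightarrow> cmod z \<le> T \<Longrightarrow>
     chd (f (chart b a)) (f (chart b z)) \<le> K * (cmod (poly (W b) a) + cmod (z - a)) * cmod (z - a)"
      "\<And>a z. cmod a \<le> T \<Longrightarrow> cmod z \<le> T \<Longrightarrow>
       (cmod (poly (W b) a) / K - K * cmod (z - a)) * cmod (z - a) \<le> chd (f (chart b a)) (f (chart b z))"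
    using local_estimate[of T b] by auto
  obtain M0 where M0: "M0 \<ge> 0" "\<And>a z. cmod a \<le> T \<Longrightarrow> cmod z \<le> T \<Longrightarrow>
      cmod (poly (W b) z - poly (W b) a - poly (pderiv (W b)) a * (z - a)) \<le> M0 * (cmod (z - a))\<^sup>2"
    using poly_taylor by blast
  define M where "M = cmod (poly (pderiv (W b)) r) + M0"
  have M: "M \<ge> 0" using M0 by (simp add: M_def)
  have rT: "cmod r \<le> T" by (simp add: T_def)
  have WM: "cmod (poly (W b) a) \<le> M * cmod (a - r)" if "cmod (a - r) < 1" for a
  proof -
    have aT: "cmod a \<le> T" using that norm_triangle_ineq[of "a - r" r] by (simp add: T_def)
    have "cmod (poly (W b) a) \<le> cmod (poly (pderiv (W b)) r * (a - r)) + M0 * (cmod (a - r))\<^sup>2"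
      using M0(2)[OF rT aT] norm_triangle_ineq2[of "poly (W b) a" "poly (pderiv (W b)) r * (a - r)"] assms
      by simp
    also have "(cmod (a - r))\<^sup>2 \<le> cmod (a - r)"
      using that by (simp add: power2_eq_square mult_left_le)
    finally show ?thesis using M0(1) by (simp add: M_def norm_mult distrib_right mult_left_mono)
  qed
  define \<delta> where "\<delta> = 1 / ((2 + cmod r) * (1 + cmod r))"
  have \<delta>: "\<delta> > 0" unfolding \<delta>_def by (intro divide_pos_pos mult_pos_pos add_pos_nonneg) auto
  define U where "U = (1 + T)\<^sup>2"
  have U: "U \<ge> 1" using T by (simp add: U_def power2_eq_square algebra_simps)
  define A where "A = K * (M + 2) * U * U + L / \<delta>"
  show thesis
  proof (rule that[of A])
    show "A \<ge> 0" using K(1) M U L(1) \<delta> by (simp add: A_def)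
    fix x y
    define m where "m = max (chd x c) (chd y c)"
    have m0: "0 \<le> m" by (simp add: m_def max.coboundedI1)
    have "chd (f x) (f y) \<le> A * m * chd x y"
    proof (cases "m < \<delta>")
      case True
      obtain a where a: "x = chart b a" "cmod (a - r) < 1"
        using chart_near[of 1 x b r] True by (auto simp: m_def c_def \<delta>_def)
      obtain z where z: "y = chart b z" "cmod (z - r) < 1"
        using chart_near[of 1 y b r] True by (auto simp: m_def c_def \<delta>_def)
      have aT: "cmod a \<le> T" using a norm_triangle_ineq[of "a - r" r] by (simp add: T_def)
      have zT: "cmod z \<le> T" using z norm_triangle_ineq[of "z - r" r] by (simp add: T_def)
      have ar: "cmod (a - r) \<le> U * m"
      proof -
        have "cmod (a - r) \<le> U * chd x c"
          using cmod_le_chd_chart[OF aT rT, of b] by (simp add: U_def a c_def)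
        also have "\<dots> \<le> U * m" using U by (intro mult_left_mono) (auto simp: m_def)
        finally show ?thesis .
      qed
      have zr: "cmod (z - r) \<le> U * m"
      proof -
        have "cmod (z - r) \<le> U * chd y c"
          using cmod_le_chd_chart[OF zT rT, of b] by (simp add: U_def z c_def)
        also have "\<dots> \<le> U * m" using U by (intro mult_left_mono) (auto simp: m_def)
        finally show ?thesis .
      qed
      have za: "cmod (z - a) \<le> U * chd x y"
        using cmod_le_chd_chart[OF zT aT, of b] by (simp add: U_def a z chd_commute)
      have za2: "cmod (z - a) \<le> 2 * (U * m)"
        using norm_triangle_ineq4[of "z - r" "a - r"] ar zr by simp
      have "cmod (poly (W b) a) \<le> M * (U * m)"
        using WM[OF a(2)] mult_left_mono[OF ar M] by linarith
      then have "K * (cmod (poly (W b) a) + cmod (z - a)) * cmod (z - a) \<le> K * (M * (U * m) + 2 * (U * m)) * (U * chd x y)"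
        using K(1) za za2 M U m0 by (intro mult_mono add_mono) auto
      then have "chd (f x) (f y) \<le> K * (M + 2) * U * U * m * chd x y"
        using K(2)[OF aT zT] by (simp add: a z algebra_simps)
      moreover have "0 \<le> L / \<delta> * m * chd x y" using L \<delta> m0 by simp
      ultimately show ?thesis by (simp add: A_def distrib_right)
    next
      case False
      have "chd (f x) (f y) \<le> L * chd x y" by (rule L(2))
      also have "L * chd x y \<le> L / \<delta> * m * chd x y"
      proof (rule mult_right_mono)
        show "L \<le> L / \<delta> * m" using False \<delta> L by (simp add: field_simps)
      qed simp
      also have "\<dots> \<le> A * m * chd x y"
        using K(1) M U m0 by (intro mult_right_mono) (auto simp: A_def)
      finally show ?thesis .
    qed
    then show "chd (f x) (f y) \<le> A * max (chd x (chart b r)) (chd y (chart b r)) * chd x y"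
      by (simp add: m_def c_def)
  qed
qed

section \<open>Critical points and local expansion\<close>

definition critical :: "riemann_sphere set" where
  "critical = {chart b r | b r. poly (W b) r = 0}"

lemma prod_list_chd_bounds: "0 \<le> (\<Prod>c\<leftarrow>cs. chd x c)" "(\<Prod>c\<leftarrow>cs. chd x c) \<le> 1"
proof -
  have "0 \<le> (\<Prod>c\<leftarrow>cs. chd x c) \<and> (\<Prod>c\<leftarrow>cs. chd x c) \<le> 1"
    by (induction cs) (auto intro!: mult_le_one chd_le_1)
  then show "0 \<le> (\<Prod>c\<leftarrow>cs. chd x c)" "(\<Prod>c\<leftarrow>cs. chd x c) \<le> 1" by auto
qed

text \<open>W splits into linear factors, and |z - x| is at least the chordal distance. The roots
  form a list in order to keep their multiplicities.\<close>

lemma W_lower_bound: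
  obtains rs l where "l > 0" "set rs \<subseteq> {r. poly (W b) r = 0}"
    "\<And>z. l * (\<Prod>c\<leftarrow>map (chart b) rs. chd (chart b z) c) \<le> cmod (poly (W b) z)"
proof -
  obtain R where "W b = smult (lead_coeff (W b)) (\<Prod>x\<in>#R. [:-x, 1:])"
    using alg_closed_imp_factorization[OF W_nonzero[of b]] by blast
  moreover obtain rs where "mset rs = R" using ex_mset by blast
  ultimately have Wb: "W b = smult (lead_coeff (W b)) (\<Prod>x\<leftarrow>rs. [:-x, 1:])"
    by (metis mset_map prod_mset_prod_list)
  have ev: "poly (\<Prod>x\<leftarrow>rs. [:-x, 1:]) z = (\<Prod>x\<leftarrow>rs. z - x)" for z
    by (induction rs) (auto simp: algebra_simps)
  have Wz: "poly (W b) z = lead_coeff (W b) * (\<Prod>x\<leftarrow>rs. z - x)" for z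
    by (subst Wb) (simp add: ev)
  show thesis
  proof (rule that[of "cmod (lead_coeff (W b))" rs])
    show "0 < cmod (lead_coeff (W b))" using W_nonzero by simp
    show "set rs \<subseteq> {r. poly (W b) r = 0}"
      by (auto simp: Wz prod_list_zero_iff)
    fix z
    have "(\<Prod>c\<leftarrow>map (chart b) rs. chd (chart b z) c) \<le> cmod (\<Prod>x\<leftarrow>rs. z - x)"
    proof (induction rs)
      case (Cons r rs)
      then show ?case
        by (simp add: norm_mult) (intro mult_mono chd_chart_le; simp add: prod_list_chd_bounds[of _ "map _ _", simplified])
    qed simp
    then show "cmod (lead_coeff (W b)) * (\<Prod>c\<leftarrow>map (chart b) rs. chd (chart b z) c) \<le> cmod (poly (W b) z)"
      by (simp add: Wz norm_mult mult_left_mono)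
  qed
qed

text \<open>The lower bound of \<open>local_estimate\<close> with W replaced by its factorisation;
  the term with A absorbs the second-order error. The list joins the roots found in both charts: all
  factors are at most 1, so surplus ones only weaken the claim, and the bound holds whichever chart
  contains x.\<close>

lemma expansion:
  obtains cs \<kappa> A where "set cs \<subseteq> critical" "0 < \<kappa>" "\<kappa> \<le> 1" "1 \<le> A"
    "\<And>x y. chd x y * (\<kappa> * (\<Prod>c\<leftarrow>cs. chd x c) - A * chd x y) \<le> chd (f x) (f y)"
proof -
  have "\<exists>rs l. l > 0 \<and> set rs \<subseteq> {r. poly (W b) r = 0} \<and>
    (\<forall>z. l * (\<Prod>c\<leftarrow>map (chart b) rs. chd (chart b z) c) \<le> cmod (poly (W b) z))" for b
    by (rule W_lower_bound[of b]) blast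
  then obtain rs l where rs: "\<And>b. l b > (0::real)" "\<And>b. set (rs b) \<subseteq> {r. poly (W b) r = 0}"
    "\<And>b z. l b * (\<Prod>c\<leftarrow>map (chart b) (rs b). chd (chart b z) c) \<le> cmod (poly (W b) z)"
    by metis
  have "\<exists>K\<ge>1. \<forall>a z. cmod a \<le> 2 \<longrightarrow> cmod z \<le> 2 \<longrightarrow>
       (cmod (poly (W b) a) / K - K * cmod (z - a)) * cmod (z - a) \<le> chd (f (chart b a)) (f (chart b z))" for b
    using local_estimate[of 2 b] by blast
  then obtain K where K: "\<And>b. K b \<ge> (1::real)" "\<And>a z b. cmod a \<le> 2 \<Longrightarrow> cmod z \<le> 2 \<Longrightarrow>
       (cmod (poly (W b) a) / K b - K b * cmod (z - a)) * cmod (z - a) \<le> chd (f (chart b a)) (f (chart b z))"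
    by metis
  define cs where "cs = map (chart True) (rs True) @ map (chart False) (rs False)"
  define \<kappa> where "\<kappa> = min 1 (min (l True / K True) (l False / K False))"
  \<comment> \<open>81 is the square of the distortion 9 of the charts on the disc of radius 2; 6
    makes the left-hand side nonpositive once the points are at least 1 / 6 apart.\<close>
  define A where "A = 81 * (K True + K False) + 6"
  have Kp: "K b > 0" for b using K(1)[of b] by linarith
  show thesis
  proof (rule that[of cs \<kappa> A])
    show "set cs \<subseteq> critical" using rs(2) by (auto simp: cs_def critical_def)
    show "0 < \<kappa>" using rs(1) Kp by (simp add: \<kappa>_def)
    show "\<kappa> \<le> 1" by (simp add: \<kappa>_def)
    show "1 \<le> A" using K(1)[of True] K(1)[of False] by (simp add: A_def)
    fix x y
    define D where "D = (\<Prod>c\<leftarrow>cs. chd x c)"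
    have D: "0 \<le> D" "D \<le> 1" using prod_list_chd_bounds by (simp_all add: D_def)
    obtain b a where x: "x = chart b a" "cmod a \<le> 1" by (rule chart_cover)
    have Ab: "81 * K b \<le> A" "6 \<le> A" using Kp[of True] Kp[of False] by (cases b; simp add: A_def)+
    have \<kappa>b: "\<kappa> \<le> l b / K b" by (cases b) (simp_all add: \<kappa>_def)
    have "chd x y * (\<kappa> * D - A * chd x y) \<le> chd (f x) (f y)"
    proof (cases "chd x y < 1 / 6")
      case True
      then obtain z where z: "y = chart b z" "cmod z \<le> 2" using chart_neighbour[OF x] by blast
      have a2: "cmod a \<le> 2" using x by simp
      define e where "e = cmod (z - a)"
      have e0: "0 \<le> e" by (simp add: e_def)
      have ce: "chd x y \<le> e" using chd_chart_le[of b a z] by (simp add: x z e_def norm_minus_commute)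
      have ec: "e \<le> 9 * chd x y" using cmod_le_chd_chart[OF z(2) a2, of b] by (simp add: e_def x z chd_commute)
      have "D \<le> (\<Prod>c\<leftarrow>map (chart b) (rs b). chd (chart b a) c)"
        using prod_list_chd_bounds[of x "map (chart True) (rs True)"]
          prod_list_chd_bounds[of x "map (chart False) (rs False)"]
        by (cases b) (auto simp: D_def cs_def x mult_left_le mult_left_le_one_le)
      then have "l b * D \<le> cmod (poly (W b) a)"
        using rs(1)[of b] rs(3)[of b a] by (meson mult_left_mono less_imp_le order_trans)
      then have "l b / K b * D \<le> cmod (poly (W b) a) / K b"
        using Kp[of b] by (simp add: divide_right_mono less_imp_le)
      moreover have "\<kappa> * D \<le> l b / K b * D" using \<kappa>b D(1) by (rule mult_right_mono)
      ultimately have "\<kappa> * D \<le> cmod (poly (W b) a) / K b" by linarith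
      then have "(\<kappa> * D) * chd x y \<le> cmod (poly (W b) a) / K b * e"
        using ce D(1) Kp[of b] by (intro mult_mono) (auto simp: e_def)
      moreover have "K b * (e * e) \<le> A * (chd x y * chd x y)"
      proof -
        have "K b * (e * e) \<le> K b * ((9 * chd x y) * (9 * chd x y))"
          using Kp[of b] ec e0 by (intro mult_left_mono mult_mono) auto
        also have "\<dots> = 81 * K b * (chd x y * chd x y)" by simp
        also have "\<dots> \<le> A * (chd x y * chd x y)" by (intro mult_right_mono Ab) simp
        finally show ?thesis .
      qed
      ultimately show ?thesis using K(2)[OF a2 z(2), of b] unfolding e_def[symmetric] x(1)[symmetric] z(1)[symmetric]
        by (simp add: algebra_simps)
    next
      case False
      have "\<kappa> * D \<le> 1" using D \<kappa>b by (intro mult_le_one) (auto simp: \<kappa>_def)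
      moreover have "6 * (1 / 6) \<le> A * chd x y" using False Ab by (intro mult_mono) auto
      ultimately have "chd x y * (\<kappa> * D - A * chd x y) \<le> 0" by (intro mult_nonneg_nonpos) auto
      then show ?thesis using chd_nonneg order_trans by blast
    qed
    then show "chd x y * (\<kappa> * (\<Prod>c\<leftarrow>cs. chd x c) - A * chd x y) \<le> chd (f x) (f y)" by (simp add: D_def)
  qed
qed

end

section \<open>Normality and invariance of the Julia set\<close>

lemma range_stereo: "range stereo = sphere 0 1"
proof
  show "range stereo \<subseteq> sphere 0 1" using norm_stereo by auto
  show "sphere 0 1 \<subseteq> range stereo"
  proof
    fix v :: "complex \<times> real"
    assume "v \<in> sphere 0 1"
    moreover obtain w h where v: "v = (w, h)" by (cases v)
    ultimately have wh: "(cmod w)\<^sup>2 + h\<^sup>2 = 1" by (simp add: norm_Pair)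
    show "v \<in> range stereo"
    proof (cases "h = 1")
      case True
      then have "w = 0" using wh by simp
      then have "v = stereo Infty" using True v by simp
      then show ?thesis by blast
    next
      case False
      have "h\<^sup>2 \<le> 1" using wh zero_le_power2[of "cmod w"] by linarith
      then have h: "h < 1" using False by (simp add: abs_square_le_1)
      define z where "z = w / of_real (1 - h)"
      have cz: "cmod z = cmod w / (1 - h)"
        using h by (simp add: z_def norm_divide del: of_real_diff)
      have cw: "(cmod w)\<^sup>2 = (1 - h) * (1 + h)" using wh by (simp add: power2_eq_square algebra_simps)
      have z2: "(cmod z)\<^sup>2 = (1 + h) / (1 - h)"
        using h by (simp add: cz power_divide cw) (simp add: power2_eq_square)
      have z21: "(cmod z)\<^sup>2 + 1 = 2 / (1 - h)" "(cmod z)\<^sup>2 - 1 = 2 * h / (1 - h)"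
        using h by (simp_all add: z2 field_simps)
      have "stereo (Fin z) = (2 * z / of_real (2 / (1 - h)), (2 * h / (1 - h)) / (2 / (1 - h)))"
        unfolding stereo.simps z21 ..
      also have "2 * z / of_real (2 / (1 - h)) = w"
        using h by (simp add: z_def field_simps flip: of_real_diff)
      also have "(2 * h / (1 - h)) / (2 / (1 - h)) = h" using h by simp
      finally show ?thesis using v by (metis rangeI)
    qed
  qed
qed

lemma stereo_inv: "norm v = 1 \<Longrightarrow> stereo (inv stereo v) = v"
  using range_stereo by (intro f_inv_into_f) auto

lemma inv_stereo: "inv stereo (stereo x) = x"
  using stereo_inject by (intro inv_f_f) (auto simp: inj_def)

lemma compact_sphere_UNIV: "compact (UNIV :: riemann_sphere set)"
proof -
  have "continuous_on (sphere 0 1) (inv stereo)"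
  proof (rule continuous_onI)
    fix v :: "complex \<times> real" and e :: real assume v: "v \<in> sphere 0 1" "e > 0"
    show "\<exists>d>0. \<forall>v'\<in>sphere 0 1. dist v' v < d \<longrightarrow> dist (inv stereo v') (inv stereo v) \<le> e"
    proof (intro exI[of _ "e / 2"] conjI ballI impI)
      fix v' assume v': "v' \<in> sphere (0 :: complex \<times> real) 1" "dist v' v < e / 2"
      have "dist (inv stereo v') (inv stereo v) \<le> 4 * chd (inv stereo v') (inv stereo v)"
        by (rule dist_le_chd)
      also have "\<dots> = 2 * dist v' v" using v v' by (simp add: chd_def stereo_inv dist_norm)
      finally show "dist (inv stereo v') (inv stereo v) \<le> e" using v' by simp
    qed (use v in simp)
  qed
  then have "compact (inv stereo ` sphere 0 1)" by (rule compact_continuous_image) (rule compact_sphere)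
  moreover have "inv stereo ` sphere 0 1 = UNIV"
    using inv_stereo norm_stereo by (auto intro!: image_eqI[of _ _ "stereo _"])
  ultimately show ?thesis by simp
qed

lemma open_chd_ball: "open {y. chd x y < r}"
  unfolding open_dist
proof safe
  fix y assume y: "chd x y < r"
  have "chd x z < r" if "dist z y < r - chd x y" for z
    using chd_triangle[of x z y] chd_le_dist[of y z] that by (simp add: dist_commute)
  then show "\<exists>e>0. \<forall>z. dist z y < e \<longrightarrow> z \<in> {y. chd x y < r}"
    using y by (intro exI[of _ "r - chd x y"]) auto
qed

lemma open_contains_chd_ball:
  assumes "open U" "x \<in> U"
  obtains r where "r > 0" "\<And>y. chd x y < r \<Longrightarrow> y \<in> U"
proof -
  obtain e where e: "e > 0" "\<And>y. dist y x < e \<Longrightarrow> y \<in> U" using assms unfolding open_dist by blast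
  show thesis
  proof (rule that[of "e / 4"])
    fix y assume "chd x y < e / 4"
    then show "y \<in> U" using dist_le_chd[of x y] by (intro e(2)) (simp add: dist_commute)
  qed (use e in simp)
qed

lemma open_if_chd:
  assumes "\<And>x. x \<in> U \<Longrightarrow> \<exists>r>0. \<forall>y. chd x y < r \<longrightarrow> y \<in> U"
  shows "open U"
  unfolding open_dist
proof
  fix x assume "x \<in> U"
  then obtain r where "r > 0" "\<And>y. chd x y < r \<Longrightarrow> y \<in> U" using assms by blast
  then show "\<exists>e>0. \<forall>y. dist y x < e \<longrightarrow> y \<in> U"
    using le_less_trans[OF chd_le_dist] by (intro exI[of _ r]) (auto simp: dist_commute[of _ x])
qed

text \<open>Arzela-Ascoli for the iterates carried to the unit sphere of R^3 by
  \<open>stereo\<close>, since values in a normed space are needed. The limit again has values of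
  norm 1, so it can be carried back.\<close>

lemma fatou_if_equilipschitz:
  assumes r: "r > 0" and \<Lambda>: "\<Lambda> > 0"
    and lip: "\<And>n y z. chd x y < r \<Longrightarrow> chd x z < r \<Longrightarrow> chd ((f ^^ n) y) ((f ^^ n) z) \<le> \<Lambda> * chd y z"
  shows "x \<in> fatou_set f"
proof -
  define U where "U = {y. chd x y < r / 2}"
  have "normal_family_on U (range (\<lambda>n. f ^^ n))"
    unfolding normal_family_on_def
  proof safe
    fix s :: "nat \<Rightarrow> riemann_sphere \<Rightarrow> riemann_sphere"
    assume "range s \<subseteq> range (\<lambda>n. f ^^ n)"
    then have "\<exists>m. s i = f ^^ m" for i by blast
    then have slip: "chd (s i y) (s i z) \<le> \<Lambda> * chd y z" if "chd x y < r" "chd x z < r" for i y z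
      using lip[OF that] by metis
    \<comment> \<open>A compact cap containing the image of U on which the hypothesis is available:
      norm r corresponds to chordal distance r / 2, which is below r.\<close>
    define S where "S = sphere 0 1 \<inter> cball (stereo x) r"
    have S: "norm v = 1" "chd x (inv stereo v) < r" if "v \<in> S" for v
    proof -
      show v: "norm v = 1" using that by (simp add: S_def)
      show "chd x (inv stereo v) < r"
        using that r v by (simp add: S_def chd_def stereo_inv dist_norm)
    qed
    have sS: "stereo y \<in> S" if "y \<in> U" for y
      using that by (simp add: S_def U_def chd_def dist_norm norm_stereo)
    define F where "F i v = stereo (s i (inv stereo v))" for i v
    have Flip: "norm (F i v - F i w) \<le> \<Lambda> * norm (v - w)" if "v \<in> S" "w \<in> S" for i v w
      using slip[OF S(2)[OF that(1)] S(2)[OF that(2)], of i] S(1)[OF that(1)] S(1)[OF that(2)]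
      by (simp add: F_def chd_def stereo_inv)
    have cS: "compact S" unfolding S_def by (simp add: compact_Int)
    have bd: "norm (F i v) \<le> 1" if "v \<in> S" for i v
      by (simp add: F_def norm_stereo)
    have eqc: "\<exists>d>0. \<forall>i w. w \<in> S \<and> norm (v - w) < d \<longrightarrow> norm (F i v - F i w) < e"
      if "v \<in> S" "0 < e" for v e
    proof (intro exI[of _ "e / \<Lambda>"] conjI allI impI)
      fix i w assume "w \<in> S \<and> norm (v - w) < e / \<Lambda>"
      then show "norm (F i v - F i w) < e"
        using Flip[OF that(1), of w i] \<Lambda> by (simp add: pos_less_divide_eq mult.commute)
    qed (use \<Lambda> that in simp)
    obtain g k where gk: "strict_mono (k :: nat \<Rightarrow> nat)"
        "\<And>e. 0 < e \<Longrightarrow> \<exists>N. \<forall>n v. n \<ge> N \<and> v \<in> S \<longrightarrow> norm (F (k n) v - g v) < e"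
      using Arzela_Ascoli[OF cS bd eqc] by metis
    have gnorm: "norm (g v) = 1" if "v \<in> S" for v
    proof -
      have "(\<lambda>n. F (k n) v) \<longlonglongrightarrow> g v"
        unfolding LIMSEQ_iff using gk(2) that by meson
      then have "(\<lambda>n. norm (F (k n) v)) \<longlonglongrightarrow> norm (g v)" by (rule tendsto_norm)
      then show ?thesis by (simp add: F_def norm_stereo LIMSEQ_const_iff)
    qed
    show "\<exists>r g. strict_mono r \<and> (\<forall>K. compact K \<and> K \<subseteq> U \<longrightarrow> uniform_limit K (s \<circ> r) g sequentially)"
    proof (intro exI[of _ k] exI[of _ "\<lambda>y. inv stereo (g (stereo y))"] conjI allI impI)
      fix K assume K: "compact K \<and> K \<subseteq> U"
      show "uniform_limit K (s \<circ> k) (\<lambda>y. inv stereo (g (stereo y))) sequentially"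
      proof (rule uniform_limitI)
        fix e :: real assume "e > 0"
        then obtain N where N: "\<And>n v. n \<ge> N \<Longrightarrow> v \<in> S \<Longrightarrow> norm (F (k n) v - g v) < e / 2"
          using gk(2)[of "e / 2"] by auto
        have "dist ((s \<circ> k) n y) (inv stereo (g (stereo y))) < e" if "n \<ge> N" "y \<in> K" for n y
        proof -
          have yS: "stereo y \<in> S" using that K sS by blast
          have "dist ((s \<circ> k) n y) (inv stereo (g (stereo y))) \<le> 4 * chd (s (k n) y) (inv stereo (g (stereo y)))"
            using dist_le_chd by simp
          also have "\<dots> = 2 * norm (F (k n) (stereo y) - g (stereo y))"
            by (simp add: chd_def F_def inv_stereo stereo_inv[OF gnorm[OF yS]])
          also have "\<dots> < e" using N[OF that(1) yS] by simp
          finally show ?thesis .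
        qed
        then show "\<forall>\<^sub>F n in sequentially. \<forall>y\<in>K. dist ((s \<circ> k) n y) (inv stereo (g (stereo y))) < e"
          unfolding eventually_sequentially by blast
      qed
    qed (rule gk(1))
  qed
  moreover have "open U" unfolding U_def by (rule open_chd_ball)
  moreover have "x \<in> U" using r by (simp add: U_def)
  ultimately show ?thesis unfolding fatou_set_def by blast
qed

section \<open>Openness and total invariance of the Fatou set\<close>

lemma open_fatou_set: "open (fatou_set f)"
proof -
  have "fatou_set f = \<Union>{U. open U \<and> normal_family_on U (range (\<lambda>n. f ^^ n))}"
    unfolding fatou_set_def by blast
  then show ?thesis by auto
qed

text \<open>An iterate with positive exponent is an iterate with smaller exponent applied after
  \<open>f\<close>, so normality near \<open>f x\<close> pulls back along \<open>f\<close>.\<close>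

lemma fatou_set_preimage:
  assumes cont: "continuous_on UNIV f" and fx: "f x \<in> fatou_set f"
  shows "x \<in> fatou_set f"
proof -
  obtain U where U: "open U" "f x \<in> U" "normal_family_on U (range (\<lambda>n. f ^^ n))"
    using fx unfolding fatou_set_def by blast
  have "normal_family_on (f -` U) (range (\<lambda>n. f ^^ n))"
    unfolding normal_family_on_def
  proof safe
    fix s :: "nat \<Rightarrow> riemann_sphere \<Rightarrow> riemann_sphere"
    assume "range s \<subseteq> range (\<lambda>n. f ^^ n)"
    then have "\<forall>i. \<exists>n. s i = f ^^ n" by blast
    then obtain n where n: "\<And>i. s i = f ^^ n i" by metis
    show "\<exists>r g. strict_mono r \<and> (\<forall>K. compact K \<and> K \<subseteq> f -` U \<longrightarrow> uniform_limit K (s \<circ> r) g sequentially)"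
    \<comment> \<open>Exponent 0 leaves no application of \<open>f\<close> to split off. If it
      occurs infinitely often, a subsequence is constantly the identity; otherwise a tail avoids
      it.\<close>
    proof (cases "infinite {i. n i = 0}")
      case True
      then obtain r where r: "strict_mono (r :: nat \<Rightarrow> nat)" "\<And>i. r i \<in> {i. n i = 0}"
        using infinite_enumerate by blast
      then have "s \<circ> r = (\<lambda>_. id)" by (auto simp: n)
      then show ?thesis using r(1) by (intro exI[of _ r] exI[of _ id]) (auto intro: uniform_limit_const)
    next
      case False
      then have "finite {i. n i = 0}" by simp
      then obtain i0 where i0: "\<And>i. n (i + i0) \<noteq> 0"
        by (metis (mono_tags, lifting) finite_nat_set_iff_bounded mem_Collect_eq not_add_less2)
      define s' where "s' i = f ^^ (n (i + i0) - 1)" for i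
      have "range s' \<subseteq> range (\<lambda>n. f ^^ n)" by (auto simp: s'_def)
      then obtain r g where rg: "strict_mono (r :: nat \<Rightarrow> nat)"
          "\<And>K. compact K \<Longrightarrow> K \<subseteq> U \<Longrightarrow> uniform_limit K (s' \<circ> r) g sequentially"
        using U(3) unfolding normal_family_on_def by meson
      have ss': "s (r i + i0) y = s' (r i) (f y)" for i y
        using i0[of "r i"] by (simp add: n s'_def) (metis Suc_pred comp_apply funpow_Suc_right neq0_conv)
      show ?thesis
      proof (intro exI[of _ "\<lambda>i. r i + i0"] exI[of _ "g \<circ> f"] conjI allI impI)
        show "strict_mono (\<lambda>i. r i + i0)" using rg(1) by (simp add: strict_mono_def)
        fix K assume K: "compact K \<and> K \<subseteq> f -` U"
        have "uniform_limit (f ` K) (s' \<circ> r) g sequentially"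
          using K cont by (intro rg(2) compact_continuous_image) (auto intro: continuous_on_subset)
        then show "uniform_limit K (s \<circ> (\<lambda>i. r i + i0)) (g \<circ> f) sequentially"
          unfolding uniform_limit_iff by (simp add: ss')
      qed
    qed
  qed
  moreover have "open (f -` U)" using cont U(1) by (simp add: open_vimage)
  ultimately show ?thesis using U(2) unfolding fatou_set_def by blast
qed

text \<open>On the image of a ball, the iterate of exponent n is the iterate of exponent n + 1
  evaluated at a preimage. Convergence is uniform on the whole closed ball, so the choice of
  preimages need not be continuous.\<close>

lemma fatou_set_image:
  assumes op: "\<And>U. open U \<Longrightarrow> open (f ` U)" and x: "x \<in> fatou_set f"
  shows "f x \<in> fatou_set f"
proof -
  obtain U where U: "open U" "x \<in> U" "normal_family_on U (range (\<lambda>n. f ^^ n))"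
    using x unfolding fatou_set_def by blast
  obtain e where e: "e > 0" "cball x e \<subseteq> U" using U open_contains_cball by blast
  have "compact (UNIV \<inter> cball x e)" by (rule compact_Int_closed[OF compact_sphere_UNIV closed_cball])
  then have cK: "compact (cball x e)" by simp
  define V where "V = f ` ball x e"
  have "normal_family_on V (range (\<lambda>n. f ^^ n))"
    unfolding normal_family_on_def
  proof safe
    fix s :: "nat \<Rightarrow> riemann_sphere \<Rightarrow> riemann_sphere"
    assume "range s \<subseteq> range (\<lambda>n. f ^^ n)"
    then have "\<forall>i. \<exists>n. s i = f ^^ n" by blast
    then obtain n where n: "\<And>i. s i = f ^^ n i" by metis
    define s' where "s' i = f ^^ Suc (n i)" for i
    have "range s' \<subseteq> range (\<lambda>n. f ^^ n)" unfolding s'_def by blast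
    then obtain r g where rg: "strict_mono (r :: nat \<Rightarrow> nat)"
        "\<And>K. compact K \<Longrightarrow> K \<subseteq> U \<Longrightarrow> uniform_limit K (s' \<circ> r) g sequentially"
      using U(3) unfolding normal_family_on_def by meson
    define w where "w y = (SOME z. z \<in> ball x e \<and> f z = y)" for y
    have w: "w y \<in> ball x e" "f (w y) = y" if "y \<in> V" for y
    proof -
      have "\<exists>z. z \<in> ball x e \<and> f z = y" using that by (auto simp: V_def)
      then have "w y \<in> ball x e \<and> f (w y) = y" unfolding w_def by (rule someI_ex)
      then show "w y \<in> ball x e" "f (w y) = y" by auto
    qed
    have ss': "s i y = s' i (w y)" if "y \<in> V" for i y
    proof -
      have "s' i (w y) = s i (f (w y))" unfolding s'_def n funpow_Suc_right by simp
      then show ?thesis using w(2)[OF that] by simp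
    qed
    have lim: "uniform_limit (cball x e) (s' \<circ> r) g sequentially" using rg(2) cK e(2) by blast
    show "\<exists>r g. strict_mono r \<and> (\<forall>K. compact K \<and> K \<subseteq> V \<longrightarrow> uniform_limit K (s \<circ> r) g sequentially)"
    proof (intro exI[of _ r] exI[of _ "\<lambda>y. g (w y)"] conjI allI impI)
      fix K assume K: "compact K \<and> K \<subseteq> V"
      show "uniform_limit K (s \<circ> r) (\<lambda>y. g (w y)) sequentially"
      proof (rule uniform_limitI)
        fix \<eta> :: real assume "\<eta> > 0"
        then have "\<forall>\<^sub>F i in sequentially. \<forall>z\<in>cball x e. dist ((s' \<circ> r) i z) (g z) < \<eta>"
          using uniform_limitD[OF lim] by blast
        then show "\<forall>\<^sub>F i in sequentially. \<forall>y\<in>K. dist ((s \<circ> r) i y) (g (w y)) < \<eta>"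
        proof eventually_elim
          case (elim i)
          show ?case
          proof
            fix y assume "y \<in> K"
            then have y: "y \<in> V" using K by blast
            then show "dist ((s \<circ> r) i y) (g (w y)) < \<eta>"
              using elim[rule_format, of "w y"] w(1)[OF y] ss'[OF y, of "r i"] by simp
          qed
        qed
      qed
    qed (rule rg(1))
  qed
  moreover have "open V" unfolding V_def by (intro op open_ball)
  moreover have "f x \<in> V" using e by (simp add: V_def)
  ultimately show ?thesis unfolding fatou_set_def by blast
qed

context rational
begin

lemma continuous: "continuous_on UNIV f"
proof -
  obtain L where L: "L \<ge> 1" "\<And>x y. chd (f x) (f y) \<le> L * chd x y" using lipschitz by metis
  show ?thesis
  proof (rule continuous_onI)
    fix x and e :: real assume "e > 0"
    moreover have "dist (f y) (f x) \<le> 4 * L * dist y x" for y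
    proof -
      have "dist (f y) (f x) \<le> 4 * (L * chd y x)" using dist_le_chd[of "f y" "f x"] L(2)[of y x] by linarith
      also have "\<dots> \<le> 4 * (L * dist y x)" using L(1) chd_le_dist[of y x] by (intro mult_left_mono) auto
      finally show ?thesis by (simp add: mult.assoc)
    qed
    ultimately show "\<exists>d>0. \<forall>x'\<in>UNIV. dist x' x < d \<longrightarrow> dist (f x') (f x) \<le> e"
      using L(1) by (intro exI[of _ "e / (4 * L)"])
        (auto simp: pos_less_divide_eq mult.commute intro: order_trans less_imp_le)
  qed
qed

text \<open>The open mapping theorem for the quotient h of the chart polynomials, with the chart at
  \<open>f x\<close> chosen so that h has no pole at a. h is not constant because the Wronskian is
  not zero.\<close>

lemma open_map:
  assumes U: "open U" shows "open (f ` U)"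
proof (rule open_if_chd)
  fix y assume "y \<in> f ` U"
  then obtain x where x: "x \<in> U" "y = f x" by blast
  obtain b a where a: "x = chart b a" by (rule chart_cover)
  define P Q where "P = chart_poly b p" and "Q = chart_poly b q"
  define b' where "b' = (poly Q a \<noteq> 0)"
  define N D where "N = (if b' then P else Q)" and "D = (if b' then Q else P)"
  have Da: "poly D a \<noteq> 0"
    using chart_poly_no_common_root[of b a] by (auto simp: D_def b'_def P_def Q_def)
  define h where "h z = poly N z / poly D z" for z
  have fh: "f (chart b z) = chart b' (h z)" if "poly D z \<noteq> 0" for z
  proof -
    have "f (chart b z) = pt (poly P z) (poly Q z)" by (simp add: f_chart P_def Q_def)
    also have "\<dots> = chart b' (h z)"
      using that by (cases b') (simp_all add: chart_def pt_def h_def N_def D_def)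
    finally show ?thesis .
  qed
  obtain r where r: "r > 0" "\<And>y. chd x y < r \<Longrightarrow> y \<in> U" using open_contains_chd_ball[OF U x(1)] by blast
  have oD: "open {z. poly D z \<noteq> 0}" by (intro open_Collect_neq continuous_intros)
  obtain e0 where e0: "e0 > 0" "ball a e0 \<subseteq> {z. poly D z \<noteq> 0}"
    by (rule openE[OF oD, of a]) (use Da in auto)
  define e where "e = min e0 r"
  have e: "e > 0" "e \<le> r" "\<And>z. z \<in> ball a e \<Longrightarrow> poly D z \<noteq> 0" using e0 r by (auto simp: e_def)
  have hol: "h holomorphic_on ball a e"
    unfolding h_def using e(3) by (intro holomorphic_intros) auto
  have nc: "\<not> h constant_on ball a e"
  proof
    assume "h constant_on ball a e"
    then obtain k where k: "\<And>z. z \<in> ball a e \<Longrightarrow> h z = k" unfolding constant_on_def by blast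
    have "poly (N - smult k D) z = 0" if "z \<in> ball a e" for z
      using k[OF that] e(3)[OF that] by (simp add: h_def field_simps)
    then have "ball a e \<subseteq> {z. poly (N - smult k D) z = 0}" by blast
    moreover have "infinite (ball a e)" using e(1) by (simp add: uncountable_ball uncountable_infinite)
    ultimately have "N - smult k D = 0" using poly_roots_finite finite_subset by metis
    then have N: "N = smult k D" by simp
    then have "pderiv N * D - N * pderiv D = 0" by (simp add: pderiv_smult mult.commute)
    then have "W b = 0"
      by (cases b') (simp_all add: W_def N_def D_def P_def[symmetric] Q_def[symmetric] mult.commute)
    then show False using W_nonzero by blast
  qed
  have "open (h ` ball a e)"
    by (rule open_mapping_thm[OF hol _ _ _ order_refl nc]) auto
  moreover have "h a \<in> h ` ball a e" using e by simp
  ultimately obtain \<eta>0 where \<eta>0: "\<eta>0 > 0" "ball (h a) \<eta>0 \<subseteq> h ` ball a e"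
    using open_contains_ball by blast
  define \<eta> where "\<eta> = min \<eta>0 1"
  have \<eta>: "\<eta> > 0" "\<eta> \<le> 1" "ball (h a) \<eta> \<subseteq> h ` ball a e" using \<eta>0 by (auto simp: \<eta>_def)
  show "\<exists>r>0. \<forall>y'. chd y y' < r \<longrightarrow> y' \<in> f ` U"
  proof (intro exI[of _ "\<eta> / ((2 + cmod (h a)) * (1 + cmod (h a)))"] conjI allI impI)
    show "\<eta> / ((2 + cmod (h a)) * (1 + cmod (h a))) > 0"
      using \<eta> by (intro divide_pos_pos mult_pos_pos add_pos_nonneg) auto
    fix y' assume "chd y y' < \<eta> / ((2 + cmod (h a)) * (1 + cmod (h a)))"
    then have "chd y' (chart b' (h a)) < \<eta> / ((2 + cmod (h a)) * (1 + cmod (h a)))"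
      using x a fh[OF Da] by (simp add: chd_commute)
    then obtain w where w: "y' = chart b' w" "cmod (w - h a) < \<eta>"
      using chart_near[OF \<eta>(1,2)] by blast
    then have "w \<in> h ` ball a e" using \<eta>(3) by (auto simp: dist_norm norm_minus_commute)
    then obtain z where z: "z \<in> ball a e" "w = h z" by blast
    have "chd x (chart b z) < r"
      using z(1) chd_chart_le[of b a z] e(2) by (simp add: a dist_norm)
    then have "chart b z \<in> U" using r by blast
    moreover have "y' = f (chart b z)" using fh[OF e(3)[OF z(1)]] w z by simp
    ultimately show "y' \<in> f ` U" by blast
  qed
qed

lemma f_julia: "x \<in> julia_set f \<Longrightarrow> f x \<in> julia_set f"
  using fatou_set_preimage[OF continuous] by (auto simp: julia_set_def)

lemma julia_if_image: "f x \<in> julia_set f \<Longrightarrow> x \<in> julia_set f"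
  using fatou_set_image[OF open_map] by (auto simp: julia_set_def)

lemma funpow_julia_iff: "(f ^^ n) x \<in> julia_set f \<longleftrightarrow> x \<in> julia_set f"
  by (induction n) (auto intro: f_julia dest: julia_if_image)

text \<open>The finite preimages of [w1 : w2] are the zeros of w2 p - w1 q; when its coefficient in
  degree d vanishes, infinity is a preimage.\<close>

lemma surj_f: "\<exists>x. f x = y"
proof -
  obtain w1 w2 where y: "y = pt w1 w2" "w1 \<noteq> 0 \<or> w2 \<noteq> 0" using pt_surj by metis
  define R where "R = smult w2 p - smult w1 q"
  show ?thesis
  proof (cases "coeff R d = 0")
    case True
    have "f (pt 1 0) = pt (coeff p d) (coeff q d)" by (simp add: f_pt hom_0)
    also have "\<dots> = y" unfolding y(1)
      using coeff_d y(2) True by (subst pt_eq_iff) (auto simp: R_def mult.commute)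
    finally show ?thesis by blast
  next
    case False
    then have "degree R \<ge> d" by (rule le_degree)
    then have "\<not> constant (poly R)" using d_ge by (simp add: constant_degree)
    from Fundamental_Theorem_Algebra.fundamental_theorem_of_algebra[OF this]
    obtain z where z: "poly R z = 0" by blast
    have "f (chart True z) = pt (poly p z) (poly q z)" by (simp add: f_chart chart_poly_def)
    also have "\<dots> = y" unfolding y(1)
      using no_common_root[of z] y(2) z by (subst pt_eq_iff) (auto simp: R_def mult.commute)
    finally show ?thesis by blast
  qed
qed

text \<open>The polynomial whose roots are the preimages of \<open>f c\<close> has degree \<open>d \<ge> 2\<close> and a single root,
  which is therefore a multiple one.\<close>

lemma critical_if_unique_preimage:
  assumes uniq: "\<And>x. f x = f c \<Longrightarrow> x = c" shows "c \<in> critical"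
proof -
  obtain b r where c: "c = chart b r" by (rule chart_cover)
  define P Q where "P = chart_poly b p" and "Q = chart_poly b q"
  define w1 w2 where "w1 = poly P r" and "w2 = poly Q r"
  have w: "w1 \<noteq> 0 \<or> w2 \<noteq> 0"
    using chart_poly_no_common_root[of b r] by (simp add: w1_def w2_def P_def Q_def)
  have fc: "f c = pt w1 w2" by (simp add: c f_chart w1_def w2_def P_def Q_def)
  define R where "R = smult w2 P - smult w1 Q"
  have root: "z = r" if "poly R z = 0" for z
  proof -
    have "f (chart b z) = pt (poly P z) (poly Q z)" by (simp add: f_chart P_def Q_def)
    also have "\<dots> = f c" unfolding fc
      using chart_poly_no_common_root[of b z] w that
      by (subst pt_eq_iff) (auto simp: R_def P_def Q_def mult.commute)
    finally have "chart b z = chart b r" using uniq c by blast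
    then have "chd (chart b z) (chart b r) = 0" by simp
    then show "z = r" using sqrt_pos'[of z] sqrt_pos'[of r] by (auto simp: chd_chart)
  qed
  have "coeff R d \<noteq> 0"
  proof
    assume R0: "coeff R d = 0"
    \<comment> \<open>The point that chart \<open>b\<close> misses. If the degree of R dropped, it
      would be a second preimage of \<open>f c\<close>.\<close>
    define y where "y = (if b then pt 1 0 else pt 0 1)"
    have cz: "coeff P d \<noteq> 0 \<or> coeff Q d \<noteq> 0"
      using coeff_d no_common_root[of 0]
      by (cases b) (auto simp: P_def Q_def coeff_chart_poly_False poly_0_coeff_0, auto simp: chart_poly_def)
    have "f y = pt (coeff P d) (coeff Q d)"
    proof (cases b)
      case True
      then show ?thesis by (simp add: y_def f_pt hom_0 P_def Q_def chart_poly_def)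
    next
      case False
      then show ?thesis
        by (simp add: y_def f_pt hom_nz deg_le P_def Q_def coeff_chart_poly_False poly_0_coeff_0)
    qed
    also have "\<dots> = f c" unfolding fc using cz w R0 by (subst pt_eq_iff) (auto simp: R_def mult.commute)
    finally have "y = c" by (rule uniq)
    then show False by (cases b) (auto simp: y_def c chart_def pt_def split: if_splits)
  qed
  then have dR: "degree R \<ge> d" by (rule le_degree)
  have "poly R r = 0" by (simp add: R_def w1_def w2_def)
  then obtain S where S: "R = [:-r, 1:] * S" by (auto simp: poly_eq_0_iff_dvd)
  have "S \<noteq> 0" using S dR d_ge by auto
  then have "degree R = Suc (degree S)" unfolding S by (subst degree_mult_eq) auto
  then have "\<not> constant (poly S)" using dR d_ge by (simp add: constant_degree)
  from Fundamental_Theorem_Algebra.fundamental_theorem_of_algebra[OF this]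
  obtain z where z: "poly S z = 0" by blast
  then have "z = r" using root by (simp add: S)
  then have "poly (pderiv R) r = 0" using z unfolding S pderiv_mult by simp
  \<comment> \<open>w1 and w2 are the values of P and Q at r, so \<open>pderiv R\<close> and
    \<open>W b\<close> agree at r.\<close>
  then have "poly (W b) r = 0"
    by (simp add: W_def R_def pderiv_diff pderiv_smult w1_def w2_def P_def Q_def mult.commute)
  then show ?thesis unfolding critical_def c by blast
qed

end

section \<open>Recurrence of critical points in the Julia set\<close>

lemma lipschitz_funpow:
  fixes f :: "riemann_sphere \<Rightarrow> riemann_sphere"
  assumes "1 \<le> L" "\<And>x y. chd (f x) (f y) \<le> L * chd x y"
  shows "chd ((f ^^ n) x) ((f ^^ n) y) \<le> L ^ n * chd x y"
proof (induction n)
  case (Suc n)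
  have "chd ((f ^^ Suc n) x) ((f ^^ Suc n) y) \<le> L * chd ((f ^^ n) x) ((f ^^ n) y)" using assms by simp
  also have "\<dots> \<le> L * (L ^ n * chd x y)" using Suc assms by (intro mult_left_mono) auto
  finally show ?case by simp
qed simp

text \<open>If the inequality failed for all \<open>k\<close>, then \<open>f ^^ m\<close> would map the disc of radius \<open>2 R\<close>
  about \<open>c\<close> into itself as a contraction, so that \<open>c\<close> would lie in the Fatou set.\<close>

lemma return_time:
  fixes f :: "riemann_sphere \<Rightarrow> riemann_sphere"
  assumes L: "1 \<le> L" "\<And>x y. chd (f x) (f y) \<le> L * chd x y"
    and A: "0 \<le> A" "\<And>x y. chd (f x) (f y) \<le> A * max (chd x c) (chd y c) * chd x y"
    and B: "8 * A \<le> B" and c: "c \<in> julia_set f" and R: "0 < R" and m: "1 \<le> m"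
    and y0: "chd y c \<le> R" and ym: "chd ((f ^^ m) y) c \<le> R"
    and between: "\<And>l. 0 < l \<Longrightarrow> l < m \<Longrightarrow> R \<le> chd ((f ^^ l) y) c"
  shows "\<exists>k\<in>{1..m}. 1 \<le> B ^ k * R * (\<Prod>l=1..<k. chd ((f ^^ l) y) c)"
proof (rule ccontr)
  assume "\<not> ?thesis"
  then have small: "B ^ k * R * (\<Prod>l=1..<k. chd ((f ^^ l) y) c) < 1" if "1 \<le> k" "k \<le> m" for k
    using that by (metis atLeastAtMost_iff not_le)
  \<comment> \<open>This will bound the Lipschitz constant of \<open>f ^^ k\<close> on the disc U:
    the first step contributes 2 A R, each later one 2 A times the distance from
    \<open>(f ^^ l) y\<close> to c.\<close>
  define \<Theta> where "\<Theta> k = (2 * A) ^ k * R * (\<Prod>l=1..<k. chd ((f ^^ l) y) c)" for k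
  have \<Theta>0: "0 \<le> \<Theta> k" for k using A R by (simp add: \<Theta>_def prod_nonneg)
  have \<Theta>: "\<Theta> k \<le> 1 / 4" if k: "1 \<le> k" "k \<le> m" for k
  proof -
    \<comment> \<open>8 A \<le> B turns 2 A into at most B / 4, and 4^k is at least 4.\<close>
    have "(2 * A) ^ k \<le> (B / 4) ^ k" using A B by (intro power_mono) auto
    also have "\<dots> \<le> B ^ k / 4"
      unfolding power_divide
      using A B power_increasing[OF k(1), of "4::real"] by (intro divide_left_mono) auto
    finally have "\<Theta> k \<le> B ^ k / 4 * R * (\<Prod>l=1..<k. chd ((f ^^ l) y) c)"
      unfolding \<Theta>_def using R by (intro mult_right_mono) (auto simp: prod_nonneg)
    also have "\<dots> \<le> 1 / 4" using small[OF k] by simp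
    finally show ?thesis .
  qed
  define U where "U = {z. chd z c \<le> 2 * R}"
  have yU: "y \<in> U" using y0 R by (simp add: U_def)
  have contr: "chd ((f ^^ k) z) ((f ^^ k) z') \<le> \<Theta> k * chd z z'"
    if "1 \<le> k" "k \<le> m" "z \<in> U" "z' \<in> U" for k z z'
    using that
  proof (induction k arbitrary: z z' rule: nat_induct_at_least)
    case base
    have "chd (f z) (f z') \<le> A * max (chd z c) (chd z' c) * chd z z'" by (rule A)
    also have "\<dots> \<le> A * (2 * R) * chd z z'"
      using base A(1) by (intro mult_right_mono mult_left_mono) (auto simp: U_def)
    finally show ?case by (simp add: \<Theta>_def)
  next
    case (Suc k)
    \<comment> \<open>The image of U stays within 3 R / 4 of the orbit point of y, which is itself
      at distance at least R from c before time m, so distances to c at most double.\<close>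
    have near: "chd ((f ^^ k) w) c \<le> 2 * chd ((f ^^ k) y) c" if "w \<in> U" for w
    proof -
      have "chd ((f ^^ k) w) ((f ^^ k) y) \<le> \<Theta> k * chd w y" using Suc that yU by simp
      also have "\<dots> \<le> 1 / 4 * (3 * R)"
        using \<Theta>[of k] \<Theta>0[of k] Suc.hyps Suc.prems that y0 chd_triangle[of w y c] R
        by (intro mult_mono) (auto simp: U_def chd_commute[of c])
      also have "\<dots> \<le> chd ((f ^^ k) y) c" using between[of k] Suc.hyps Suc.prems R by simp
      finally show ?thesis using chd_triangle[of "(f ^^ k) w" c "(f ^^ k) y"] by simp
    qed
    have "chd (f ((f ^^ k) z)) (f ((f ^^ k) z'))
        \<le> A * max (chd ((f ^^ k) z) c) (chd ((f ^^ k) z') c) * chd ((f ^^ k) z) ((f ^^ k) z')"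
      by (rule A)
    also have "\<dots> \<le> A * (2 * chd ((f ^^ k) y) c) * (\<Theta> k * chd z z')"
      using Suc A(1) near by (intro mult_mono) (auto simp: le_max_iff_disj)
    also have "\<dots> = \<Theta> (Suc k) * chd z z'"
      using Suc.hyps by (simp add: \<Theta>_def)
    finally show ?case by simp
  qed
  have fm: "(f ^^ m) z \<in> U" if "z \<in> U" for z
  proof -
    have "chd ((f ^^ m) z) ((f ^^ m) y) \<le> \<Theta> m * chd z y" using contr m that yU by simp
    also have "\<dots> \<le> 1 / 4 * (3 * R)"
      using \<Theta>[of m] \<Theta>0[of m] m that y0 chd_triangle[of z y c] R
      by (intro mult_mono) (auto simp: U_def chd_commute[of c])
    finally show ?thesis using chd_triangle[of "(f ^^ m) z" c "(f ^^ m) y"] ym R by (simp add: U_def)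
  qed
  have fmk: "(f ^^ (m * k)) z \<in> U \<and> (f ^^ (m * k)) z' \<in> U \<and>
      chd ((f ^^ (m * k)) z) ((f ^^ (m * k)) z') \<le> chd z z'" if "z \<in> U" "z' \<in> U" for k z z'
  proof (induction k)
    case (Suc k)
    define u v where "u = (f ^^ (m * k)) z" and "v = (f ^^ (m * k)) z'"
    have uv: "u \<in> U" "v \<in> U" "chd u v \<le> chd z z'" using Suc by (auto simp: u_def v_def)
    have "\<Theta> m * chd u v \<le> 1 * chd u v" using \<Theta>[of m] m by (intro mult_right_mono) auto
    then have "chd ((f ^^ m) u) ((f ^^ m) v) \<le> chd z z'" using contr[OF m order_refl uv(1,2)] uv(3) by linarith
    then show ?case using fm[OF uv(1)] fm[OF uv(2)] by (simp add: u_def v_def funpow_add)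
  qed (use that in simp)
  have "c \<in> fatou_set f"
  proof (rule fatou_if_equilipschitz)
    show "2 * R > 0" "L ^ m > 0" using R L by auto
    fix n z z' assume "chd c z < 2 * R" "chd c z' < 2 * R"
    then have U: "z \<in> U" "z' \<in> U" by (auto simp: U_def chd_commute)
    \<comment> \<open>Multiples of m do not increase distances in U; the remainder amounts to fewer
      than m further steps, each costing at most a factor L.\<close>
    have n: "(f ^^ n) w = (f ^^ (n mod m)) ((f ^^ (m * (n div m))) w)" for w
    proof -
      have "n = n mod m + m * (n div m)" by simp
      then show ?thesis by (metis comp_apply funpow_add)
    qed
    have "chd ((f ^^ n) z) ((f ^^ n) z') \<le>
        L ^ (n mod m) * chd ((f ^^ (m * (n div m))) z) ((f ^^ (m * (n div m))) z')"
      unfolding n[of z] n[of z'] by (rule lipschitz_funpow[OF L])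
    also have "\<dots> \<le> L ^ m * chd z z'"
      using fmk[OF U] L m by (intro mult_mono power_increasing) auto
    finally show "chd ((f ^^ n) z) ((f ^^ n) z') \<le> L ^ m * chd z z'" .
  qed
  then show False using c by (simp add: julia_set_def)
qed

text \<open>Between time i and the first return to the R-disc the orbit stays at distance at least R
  from c, so \<open>return_time\<close> applies to this piece. The product there is at most 1, which
  would make B^n R at least 1.\<close>

lemma no_early_return:
  fixes f :: "riemann_sphere \<Rightarrow> riemann_sphere"
  assumes L: "1 \<le> L" "\<And>x y. chd (f x) (f y) \<le> L * chd x y"
    and A: "0 \<le> A" "\<And>x y. chd (f x) (f y) \<le> A * max (chd x c) (chd y c) * chd x y"
    and B: "1 \<le> B" "8 * A \<le> B" and c: "c \<in> julia_set f" and R: "0 < R" "B ^ n * R < 1"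
    and ij: "i < j" "j \<le> n" "chd ((f ^^ i) y) c \<le> R" "chd ((f ^^ j) y) c \<le> R"
  shows False
proof -
  define q where "q = (LEAST l. i < l \<and> chd ((f ^^ l) y) c \<le> R)"
  have q: "i < q" "chd ((f ^^ q) y) c \<le> R" "q \<le> j"
    using LeastI[of "\<lambda>l. i < l \<and> chd ((f ^^ l) y) c \<le> R" j] ij
      Least_le[of "\<lambda>l. i < l \<and> chd ((f ^^ l) y) c \<le> R" j] by (auto simp: q_def)
  have qmin: "R \<le> chd ((f ^^ l) y) c" if "i < l" "l < q" for l
    using not_less_Least[of l "\<lambda>l. i < l \<and> chd ((f ^^ l) y) c \<le> R"] that by (auto simp: q_def)
  have sh: "(f ^^ l) ((f ^^ i) y) = (f ^^ (i + l)) y" for l by (metis add.commute comp_apply funpow_add)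
  have "\<exists>k\<in>{1..q - i}. 1 \<le> B ^ k * R * (\<Prod>l=1..<k. chd ((f ^^ l) ((f ^^ i) y)) c)"
    by (rule return_time[OF L A B(2) c R(1)]) (use q qmin ij in \<open>auto simp: sh\<close>)
  then obtain k where k: "k \<le> q - i" "1 \<le> B ^ k * R * (\<Prod>l=1..<k. chd ((f ^^ l) ((f ^^ i) y)) c)" by auto
  have "(\<Prod>l=1..<k. chd ((f ^^ l) ((f ^^ i) y)) c) \<le> 1"
    by (intro prod_le_1) (auto simp: chd_le_1)
  then have "B ^ k * R * (\<Prod>l=1..<k. chd ((f ^^ l) ((f ^^ i) y)) c) \<le> B ^ n * R * 1"
    using B R k q ij by (intro mult_mono power_increasing) (auto intro: prod_nonneg)
  then show False using k(2) R(2) by linarith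
qed

text \<open>The combinatorial core of the Denker-Przytycki-Urbanski estimate, for
  \<open>\<phi> l = - ln (chd ((f ^^ l) y) c)\<close>.\<close>

lemma sum_except_max_linear:
  fixes \<phi> :: "nat \<Rightarrow> real" and C :: real
  assumes C: "0 \<le> C"
    and H: "\<And>i j. i < j \<Longrightarrow> j < n \<Longrightarrow> (\<And>l. i < l \<Longrightarrow> l < j \<Longrightarrow> \<phi> l \<le> min (\<phi> i) (\<phi> j)) \<Longrightarrow>
      \<exists>k\<in>{1..j - i}. min (\<phi> i) (\<phi> j) + (\<Sum>l\<in>{i<..<i + k}. \<phi> l) \<le> C * real k"
    and M: "0 \<le> M" "\<And>l. l < n \<Longrightarrow> \<phi> l \<le> M"
  shows "(\<Sum>l<n. \<phi> l) \<le> M + C * real n"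
proof -
  \<comment> \<open>Terms before a dominating time p: the hypothesis for a and the next time q with
    \<phi> q at least \<phi> a pays for a block of k terms starting at a, and the remaining interval
    is shorter.\<close>
  have left: "(\<Sum>l\<in>{a..<p}. \<phi> l) \<le> C * real (p - a)"
    if "a \<le> p" "p < n" "\<And>l. a \<le> l \<Longrightarrow> l < p \<Longrightarrow> \<phi> l \<le> \<phi> p" for a p
    using that
  proof (induction "p - a" arbitrary: a rule: less_induct)
    case less
    show ?case
    proof (cases "a = p")
      case False
      then have "a < p" using less by simp
      define q where "q = (LEAST l. a < l \<and> \<phi> a \<le> \<phi> l)"
      have q: "a < q" "\<phi> a \<le> \<phi> q" "q \<le> p"
        using LeastI[of "\<lambda>l. a < l \<and> \<phi> a \<le> \<phi> l" p] Least_le[of "\<lambda>l. a < l \<and> \<phi> a \<le> \<phi> l" p]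
          less.prems \<open>a < p\<close> by (auto simp: q_def)
      have qmin: "\<phi> l < \<phi> a" if "a < l" "l < q" for l
        using not_less_Least[of l "\<lambda>l. a < l \<and> \<phi> a \<le> \<phi> l"] that by (auto simp: q_def)
      have "\<exists>k\<in>{1..q - a}. min (\<phi> a) (\<phi> q) + (\<Sum>l\<in>{a<..<a + k}. \<phi> l) \<le> C * real k"
        using q less.prems(2) by (intro H) (auto dest!: qmin simp: less_imp_le)
      then obtain k where k: "1 \<le> k" "k \<le> q - a" "\<phi> a + (\<Sum>l\<in>{a<..<a + k}. \<phi> l) \<le> C * real k"
        using q by (auto simp: min_def)
      have eq: "{a..<p} = insert a {a<..<a + k} \<union> {a + k..<p}" using k q by auto
      have "(\<Sum>l\<in>{a..<p}. \<phi> l) = (\<Sum>l\<in>insert a {a<..<a + k}. \<phi> l) + (\<Sum>l\<in>{a + k..<p}. \<phi> l)"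
        by (subst eq, rule sum.union_disjoint) (use k in auto)
      also have "(\<Sum>l\<in>insert a {a<..<a + k}. \<phi> l) = \<phi> a + (\<Sum>l\<in>{a<..<a + k}. \<phi> l)" by simp
      also have "(\<Sum>l\<in>{a + k..<p}. \<phi> l) \<le> C * real (p - (a + k))"
        using k q less.prems by (intro less.hyps) auto
      finally have "(\<Sum>l\<in>{a..<p}. \<phi> l) \<le> C * real k + C * real (p - (a + k))" using k(3) by linarith
      also have "\<dots> = C * real (p - a)"
        using k q by (simp add: of_nat_diff algebra_simps)
      finally show ?thesis .
    qed simp
  qed
  \<comment> \<open>Terms after a dominating time p: with q the position of the largest one, the
    hypothesis for p and q pays for \<phi> q and a block after p, \<open>left\<close> for the rest
    before q, and induction for what follows q.\<close>
  have right: "(\<Sum>l\<in>{p<..<b}. \<phi> l) \<le> C * real (b - p)"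
    if "p < b" "b \<le> n" "\<And>l. p < l \<Longrightarrow> l < b \<Longrightarrow> \<phi> l \<le> \<phi> p" for p b
    using that
  proof (induction "b - p" arbitrary: p rule: less_induct)
    case less
    show ?case
    proof (cases "{p<..<b} = {}")
      case False
      have "Max (\<phi> ` {p<..<b}) \<in> \<phi> ` {p<..<b}" using False by (intro Max_in) auto
      then obtain q where q: "p < q" "q < b" "\<phi> q = Max (\<phi> ` {p<..<b})" by auto
      have qmax: "\<phi> l \<le> \<phi> q" if "p < l" "l < b" for l
        unfolding q(3) using that by (intro Max_ge) auto
      have "\<phi> q \<le> \<phi> p" using q(1,2) by (rule less.prems(3))
      have "\<exists>k\<in>{1..q - p}. min (\<phi> p) (\<phi> q) + (\<Sum>l\<in>{p<..<p + k}. \<phi> l) \<le> C * real k"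
        using q less.prems by (intro H) (auto intro!: qmax)
      then obtain k where k: "1 \<le> k" "k \<le> q - p" "\<phi> q + (\<Sum>l\<in>{p<..<p + k}. \<phi> l) \<le> C * real k"
        using \<open>\<phi> q \<le> \<phi> p\<close> by (auto simp: min_def split: if_splits)
      have 1: "(\<Sum>l\<in>{p + k..<q}. \<phi> l) \<le> C * real (q - (p + k))"
        using k q less.prems by (intro left qmax) auto
      have 2: "(\<Sum>l\<in>{q<..<b}. \<phi> l) \<le> C * real (b - q)"
        using q less.prems by (intro less.hyps qmax) auto
      have eq: "{p<..<b} = ({p<..<p + k} \<union> {p + k..<q}) \<union> insert q {q<..<b}" using k q by auto
      have "(\<Sum>l\<in>{p<..<b}. \<phi> l) = (\<Sum>l\<in>{p<..<p + k} \<union> {p + k..<q}. \<phi> l) + (\<Sum>l\<in>insert q {q<..<b}. \<phi> l)"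
        by (subst eq, rule sum.union_disjoint) (use k in auto)
      also have "(\<Sum>l\<in>{p<..<p + k} \<union> {p + k..<q}. \<phi> l) = (\<Sum>l\<in>{p<..<p + k}. \<phi> l) + (\<Sum>l\<in>{p + k..<q}. \<phi> l)"
        by (rule sum.union_disjoint) auto
      also have "(\<Sum>l\<in>insert q {q<..<b}. \<phi> l) = \<phi> q + (\<Sum>l\<in>{q<..<b}. \<phi> l)" by simp
      finally have "(\<Sum>l\<in>{p<..<b}. \<phi> l) \<le> C * real k + C * real (q - (p + k)) + C * real (b - q)"
        using 1 2 k(3) by linarith
      also have "\<dots> = C * real (b - p)"
        using k q by (simp add: of_nat_diff algebra_simps)
      finally show ?thesis .
    qed (use C in simp)
  qed
  show ?thesis
  proof (cases "n = 0")
    case False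
    have "Max (\<phi> ` {..<n}) \<in> \<phi> ` {..<n}" using False by (intro Max_in) auto
    \<comment> \<open>The overall largest term is the one that no pair of times pays for; only M
      bounds it.\<close>
    then obtain p where p: "p < n" "\<phi> p = Max (\<phi> ` {..<n})" by auto
    have pmax: "\<phi> l \<le> \<phi> p" if "l < n" for l
      unfolding p(2) using that by (intro Max_ge) auto
    have eq: "{..<n} = {0..<p} \<union> insert p {p<..<n}" using p by auto
    have "(\<Sum>l<n. \<phi> l) = (\<Sum>l\<in>{0..<p}. \<phi> l) + (\<Sum>l\<in>insert p {p<..<n}. \<phi> l)"
      unfolding eq by (rule sum.union_disjoint) auto
    also have "(\<Sum>l\<in>insert p {p<..<n}. \<phi> l) = \<phi> p + (\<Sum>l\<in>{p<..<n}. \<phi> l)" by simp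
    also have "(\<Sum>l\<in>{0..<p}. \<phi> l) \<le> C * real (p - 0)" using p by (intro left pmax) auto
    also have "(\<Sum>l\<in>{p<..<n}. \<phi> l) \<le> C * real (n - p)" using p by (intro right pmax) auto
    finally have "(\<Sum>l<n. \<phi> l) \<le> C * real (p - 0) + (\<phi> p + C * real (n - p))" by simp
    also have "\<dots> = \<phi> p + C * real n" using p by (simp add: of_nat_diff algebra_simps)
    finally show ?thesis using M(2)[OF p(1)] by linarith
  qed (use M in simp)
qed

text \<open>With \<phi> the negative logarithm of the distance to c, \<open>return_time\<close>
  supplies the hypothesis of \<open>sum_except_max_linear\<close>; a minimum of \<phi> is a maximum
  R of distances. The assumed lower bound controls the one exceptional term, so \<rho> enters to the
  first power whatever n is.\<close>

lemma prod_dist_critical: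
  fixes f :: "riemann_sphere \<Rightarrow> riemann_sphere"
  assumes L: "1 \<le> L" "\<And>x y. chd (f x) (f y) \<le> L * chd x y"
    and A: "0 \<le> A" "\<And>x y. chd (f x) (f y) \<le> A * max (chd x c) (chd y c) * chd x y"
    and B: "1 \<le> B" "8 * A \<le> B" and c: "c \<in> julia_set f"
    and \<rho>: "0 < \<rho>" "\<rho> \<le> 1" "\<And>l. l < n \<Longrightarrow> \<rho> \<le> chd ((f ^^ l) y) c"
  shows "\<rho> * (1 / B) ^ n \<le> (\<Prod>l<n. chd ((f ^^ l) y) c)"
proof -
  define a where "a l = chd ((f ^^ l) y) c" for l
  define \<phi> where "\<phi> l = - ln (a l)" for l
  have a: "0 < a l" "a l \<le> 1" if "l < n" for l
    using \<rho>(1) \<rho>(3)[OF that] by (auto simp: a_def chd_le_1)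
  have "(\<Sum>l<n. \<phi> l) \<le> - ln \<rho> + ln B * real n"
  proof (rule sum_except_max_linear)
    show "0 \<le> ln B" "0 \<le> - ln \<rho>" using B \<rho> by auto
    show "\<phi> l \<le> - ln \<rho>" if "l < n" for l using \<rho> a[OF that] \<rho>(3)[OF that] by (simp add: \<phi>_def a_def)
    fix i j assume ij: "i < j" "j < n" and betw: "\<And>l. i < l \<Longrightarrow> l < j \<Longrightarrow> \<phi> l \<le> min (\<phi> i) (\<phi> j)"
    define R where "R = max (a i) (a j)"
    have R: "0 < R" using a[of i] ij by (simp add: R_def less_max_iff_disj)
    have lnR: "min (\<phi> i) (\<phi> j) = - ln R"
      using a[of i] a[of j] ij by (auto simp: \<phi>_def R_def min_def max_def)
    have sh: "(f ^^ l) ((f ^^ i) y) = (f ^^ (i + l)) y" for l by (metis add.commute comp_apply funpow_add)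
    have "\<exists>k\<in>{1..j - i}. 1 \<le> B ^ k * R * (\<Prod>l=1..<k. chd ((f ^^ l) ((f ^^ i) y)) c)"
    proof (rule return_time[OF L A B(2) c R])
      show "chd ((f ^^ i) y) c \<le> R" "chd ((f ^^ (j - i)) ((f ^^ i) y)) c \<le> R"
        using ij by (auto simp: R_def a_def sh)
      fix l assume l: "0 < l" "l < j - i"
      then have "\<phi> (i + l) \<le> min (\<phi> i) (\<phi> j)" by (intro betw) auto
      then have "- ln (a (i + l)) \<le> - ln R" unfolding lnR by (simp add: \<phi>_def)
      then show "R \<le> chd ((f ^^ l) ((f ^^ i) y)) c" using R a[of "i + l"] l ij by (simp add: a_def sh)
    qed (use ij in auto)
    then obtain k where k: "k \<in> {1..j - i}" "1 \<le> B ^ k * R * (\<Prod>l=1..<k. a (i + l))"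
      by (auto simp: sh a_def)
    have ap: "0 < a (i + l)" if "l \<in> {1..<k}" for l using that k ij by (intro a) auto
    have "0 \<le> ln (B ^ k * R * (\<Prod>l=1..<k. a (i + l)))" using k(2) by (rule ln_ge_zero)
    also have "\<dots> = real k * ln B + ln R + (\<Sum>l=1..<k. ln (a (i + l)))"
    proof -
      have "0 < (\<Prod>l=1..<k. a (i + l))" using ap by (rule prod_pos)
      then have "ln (B ^ k * R * (\<Prod>l=1..<k. a (i + l))) = ln (B ^ k) + ln R + ln (\<Prod>l=1..<k. a (i + l))"
        using B R by (simp add: ln_mult_pos)
      also have "ln (\<Prod>l=1..<k. a (i + l)) = (\<Sum>l=1..<k. ln (a (i + l)))"
        by (rule ln_prod) (use ap in force)+
      also have "ln (B ^ k) = real k * ln B" using B by (simp add: ln_realpow)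
      finally show ?thesis .
    qed
    also have "(\<Sum>l=1..<k. ln (a (i + l))) = - (\<Sum>l\<in>{i<..<i + k}. \<phi> l)"
    proof -
      have "{i<..<i + k} = {1 + i..<k + i}" by auto
      then show ?thesis by (simp only: sum.shift_bounds_nat_ivl) (simp add: \<phi>_def sum_negf add.commute)
    qed
    finally show "\<exists>k\<in>{1..j - i}. min (\<phi> i) (\<phi> j) + (\<Sum>l\<in>{i<..<i + k}. \<phi> l) \<le> ln B * real k"
      using k(1) by (intro bexI[of _ k]) (auto simp: lnR mult.commute)
  qed
  then have "ln \<rho> - ln B * real n \<le> (\<Sum>l<n. ln (a l))" by (simp add: \<phi>_def sum_negf)
  then have "exp (ln \<rho> - ln B * real n) \<le> exp (\<Sum>l<n. ln (a l))" by simp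
  also have "\<dots> = (\<Prod>l<n. a l)" using a by (simp add: exp_sum)
  also have "exp (ln \<rho> - ln B * real n) = \<rho> * (1 / B) ^ n"
    using \<rho> B by (simp add: exp_diff exp_of_nat2_mult power_divide)
  finally show ?thesis by (simp add: a_def)
qed

section \<open>Expansion along orbits that keep off the critical points\<close>

context rational
begin

lemma finite_critical: "finite critical"
proof -
  have "critical = (\<Union>b. chart b ` {r. poly (W b) r = 0})" by (auto simp: critical_def)
  then show ?thesis using W_nonzero by (simp add: poly_roots_finite)
qed

lemma criticalE:
  assumes "c \<in> critical"
  obtains A where "0 \<le> A" "\<And>x y. chd (f x) (f y) \<le> A * max (chd x c) (chd y c) * chd x y"
  using assms critical_contraction unfolding critical_def by blast

definition crit_julia :: "riemann_sphere set" where
  "crit_julia = critical \<inter> julia_set f"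

lemma finite_crit_julia: "finite crit_julia"
  using finite_critical by (simp add: crit_julia_def)

lemma no_early_return_julia:
  obtains B where "1 \<le> B"
    "\<And>c n R i j y. c \<in> crit_julia \<Longrightarrow> 0 < R \<Longrightarrow> B ^ n * R < 1 \<Longrightarrow> i < j \<Longrightarrow> j \<le> n \<Longrightarrow>
      chd ((f ^^ i) y) c \<le> R \<Longrightarrow> chd ((f ^^ j) y) c \<le> R \<Longrightarrow> False"
proof -
  obtain L where L: "L \<ge> 1" "\<And>x y. chd (f x) (f y) \<le> L * chd x y" using lipschitz by metis
  have "\<exists>A\<ge>0. \<forall>x y. chd (f x) (f y) \<le> A * max (chd x c) (chd y c) * chd x y" if "c \<in> critical" for c
    using criticalE[OF that] by metis
  then obtain A where A: "\<And>c. c \<in> critical \<Longrightarrow> A c \<ge> (0::real)"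
    "\<And>c x y. c \<in> critical \<Longrightarrow> chd (f x) (f y) \<le> A c * max (chd x c) (chd y c) * chd x y" by metis
  define B where "B = 1 + (\<Sum>c\<in>critical. 8 * A c)"
  have Bc: "8 * A c \<le> B" if "c \<in> critical" for c
    using member_le_sum[OF that, of "\<lambda>c. 8 * A c"] A(1) finite_critical by (simp add: B_def)
  have B1: "1 \<le> B" using A(1) by (simp add: B_def sum_nonneg)
  show thesis
  proof (rule that[OF B1])
    fix c n R i j y
    assume c: "c \<in> crit_julia" and *: "0 < R" "B ^ n * R < 1" "i < j" "j \<le> n"
      "chd ((f ^^ i) y) c \<le> R" "chd ((f ^^ j) y) c \<le> R"
    have c': "c \<in> critical" "c \<in> julia_set f" using c by (auto simp: crit_julia_def)
    show False by (rule no_early_return[OF L A(1)[OF c'(1)] A(2)[OF c'(1)] B1 Bc[OF c'(1)] c'(2) *])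
  qed
qed

text \<open>Induction on the list, with one factor \<rho> per entry. An entry outside the Julia set
  has a neighbourhood in the Fatou set, hence a positive distance from the Julia set; so the
  assumption on \<rho> concerns \<open>crit_julia\<close> alone.\<close>

lemma prod_dist_critical_list:
  assumes "set cs \<subseteq> critical"
  shows "\<exists>E>0. E \<le> 1 \<and> (\<forall>y n \<rho>. y \<in> julia_set f \<longrightarrow> 0 < \<rho> \<longrightarrow> \<rho> \<le> 1 \<longrightarrow>
    (\<forall>c\<in>crit_julia. \<forall>l<n. \<rho> \<le> chd ((f ^^ l) y) c) \<longrightarrow>
    E ^ n * \<rho> ^ length cs \<le> (\<Prod>l<n. \<Prod>c\<leftarrow>cs. chd ((f ^^ l) y) c))"
  using assms
proof (induction cs)
  case Nil
  then show ?case by (intro exI[of _ 1]) auto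
next
  case (Cons c cs)
  then obtain E where E: "0 < E" "E \<le> 1" "\<And>y n \<rho>. y \<in> julia_set f \<Longrightarrow> 0 < \<rho> \<Longrightarrow> \<rho> \<le> 1 \<Longrightarrow>
      \<forall>c\<in>crit_julia. \<forall>l<n. \<rho> \<le> chd ((f ^^ l) y) c \<Longrightarrow>
      E ^ n * \<rho> ^ length cs \<le> (\<Prod>l<n. \<Prod>c\<leftarrow>cs. chd ((f ^^ l) y) c)" by auto
  have "\<exists>E'>0. E' \<le> 1 \<and> (\<forall>y n \<rho>. y \<in> julia_set f \<longrightarrow> 0 < \<rho> \<longrightarrow> \<rho> \<le> 1 \<longrightarrow>
      (\<forall>c\<in>crit_julia. \<forall>l<n. \<rho> \<le> chd ((f ^^ l) y) c) \<longrightarrow> \<rho> * E' ^ n \<le> (\<Prod>l<n. chd ((f ^^ l) y) c))"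
  proof (cases "c \<in> julia_set f")
    case True
    then have c: "c \<in> critical" "c \<in> crit_julia" using Cons.prems by (auto simp: crit_julia_def)
    obtain A where A: "0 \<le> A" "\<And>x y. chd (f x) (f y) \<le> A * max (chd x c) (chd y c) * chd x y"
      using criticalE[OF c(1)] by metis
    obtain L where L: "L \<ge> 1" "\<And>x y. chd (f x) (f y) \<le> L * chd x y" using lipschitz by metis
    define B where "B = 1 + 8 * A"
    have B: "1 \<le> B" "8 * A \<le> B" using A by (auto simp: B_def)
    show ?thesis
    proof (intro exI[of _ "1 / B"] conjI allI impI)
      fix y n and \<rho> :: real
      assume "0 < \<rho>" "\<rho> \<le> 1" "\<forall>c\<in>crit_julia. \<forall>l<n. \<rho> \<le> chd ((f ^^ l) y) c"
      then show "\<rho> * (1 / B) ^ n \<le> (\<Prod>l<n. chd ((f ^^ l) y) c)"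
        using c(2) by (intro prod_dist_critical[OF L A B True]) auto
    qed (use B in auto)
  next
    case False
    then obtain r where r: "r > 0" "\<And>z. chd c z < r \<Longrightarrow> z \<in> fatou_set f"
      using open_contains_chd_ball[OF open_fatou_set, of c f] by (auto simp: julia_set_def)
    define E' where "E' = min r 1"
    have E': "0 < E'" "E' \<le> 1" using r by (auto simp: E'_def)
    have far: "E' \<le> chd z c" if "z \<in> julia_set f" for z
      using r(2)[of z] that by (force simp: julia_set_def chd_commute E'_def)
    show ?thesis
    proof (intro exI[of _ E'] conjI allI impI)
      fix y n and \<rho> :: real
      assume y: "y \<in> julia_set f" and \<rho>: "0 < \<rho>" "\<rho> \<le> 1"
      have "E' ^ n = (\<Prod>l<n. E')" by simp
      also have "\<dots> \<le> (\<Prod>l<n. chd ((f ^^ l) y) c)"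
        using E' y by (intro prod_mono) (auto intro!: far simp: funpow_julia_iff)
      finally have 1: "E' ^ n \<le> (\<Prod>l<n. chd ((f ^^ l) y) c)" .
      have "\<rho> * E' ^ n \<le> 1 * E' ^ n" using \<rho> E' by (intro mult_right_mono) auto
      then show "\<rho> * E' ^ n \<le> (\<Prod>l<n. chd ((f ^^ l) y) c)" using 1 by linarith
    qed (use E' in auto)
  qed
  then obtain E' where E': "0 < E'" "E' \<le> 1" "\<And>y n \<rho>. y \<in> julia_set f \<Longrightarrow> 0 < \<rho> \<Longrightarrow> \<rho> \<le> 1 \<Longrightarrow>
      \<forall>c\<in>crit_julia. \<forall>l<n. \<rho> \<le> chd ((f ^^ l) y) c \<Longrightarrow> \<rho> * E' ^ n \<le> (\<Prod>l<n. chd ((f ^^ l) y) c)" by auto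
  show ?case
  proof (intro exI[of _ "E' * E"] conjI allI impI)
    show "0 < E' * E" "E' * E \<le> 1" using E E' by (auto intro: mult_le_one)
    fix y n and \<rho> :: real
    assume *: "y \<in> julia_set f" "0 < \<rho>" "\<rho> \<le> 1" "\<forall>c\<in>crit_julia. \<forall>l<n. \<rho> \<le> chd ((f ^^ l) y) c"
    have "(\<rho> * E' ^ n) * (E ^ n * \<rho> ^ length cs)
        \<le> (\<Prod>l<n. chd ((f ^^ l) y) c) * (\<Prod>l<n. \<Prod>c\<leftarrow>cs. chd ((f ^^ l) y) c)"
      using E(1) *(2) by (intro mult_mono E'(3)[OF *] E(3)[OF *]) (auto intro: prod_nonneg)
    then show "(E' * E) ^ n * \<rho> ^ length (c # cs) \<le> (\<Prod>l<n. \<Prod>c\<leftarrow>c # cs. chd ((f ^^ l) y) c)"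
      by (simp add: prod.distrib power_mult_distrib algebra_simps)
  qed
qed

text \<open>The one-step bounds of \<open>expansion\<close> are multiplied along the orbit. The
  radius \<open>E ^ Suc n * \<rho> ^ N\<close> is small enough that at every time the error term
  eats at most half of the main term.\<close>

lemma orbit_expansion:
  obtains E N where "0 < E" "E \<le> 1" "1 \<le> N"
    "\<And>y y' n \<rho>. y \<in> julia_set f \<Longrightarrow> 0 < \<rho> \<Longrightarrow> \<rho> \<le> 1 \<Longrightarrow>
      (\<And>c l. c \<in> crit_julia \<Longrightarrow> l < n \<Longrightarrow> \<rho> \<le> chd ((f ^^ l) y) c) \<Longrightarrow>
      chd y y' \<le> E ^ Suc n * \<rho> ^ N \<Longrightarrow> E ^ n * \<rho> ^ N * chd y y' \<le> chd ((f ^^ n) y) ((f ^^ n) y')"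
proof -
  obtain cs \<kappa> A where cs: "set cs \<subseteq> critical" "0 < \<kappa>" "\<kappa> \<le> 1" "1 \<le> A"
    "\<And>x y. chd x y * (\<kappa> * (\<Prod>c\<leftarrow>cs. chd x c) - A * chd x y) \<le> chd (f x) (f y)"
    using expansion by metis
  obtain L where L: "L \<ge> 1" "\<And>x y. chd (f x) (f y) \<le> L * chd x y" using lipschitz by metis
  obtain E0 where E0: "0 < E0" "E0 \<le> 1" "\<And>y n \<rho>. y \<in> julia_set f \<Longrightarrow> 0 < \<rho> \<Longrightarrow> \<rho> \<le> 1 \<Longrightarrow>
    \<forall>c\<in>crit_julia. \<forall>l<n. \<rho> \<le> chd ((f ^^ l) y) c \<Longrightarrow>
    E0 ^ n * \<rho> ^ length cs \<le> (\<Prod>l<n. \<Prod>c\<leftarrow>cs. chd ((f ^^ l) y) c)"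
    using prod_dist_critical_list[OF cs(1)] by blast
  define D where "D x = \<kappa> * (\<Prod>c\<leftarrow>cs. chd x c)" for x
  have D: "0 \<le> D x" "D x \<le> 1" for x
    using prod_list_chd_bounds[of x cs] cs(2,3) by (auto simp: D_def intro: mult_le_one)
  \<comment> \<open>The 2 pays for the halves lost to the error terms, L for the growth of the
    distance between the two orbits, A for the coefficient of the error.\<close>
  define E where "E = \<kappa> * E0 / (2 * A * L)"
  have AL: "1 \<le> A * L" using cs(4) L(1) mult_mono[of 1 A 1 L] by simp
  have E: "0 < E" "E \<le> \<kappa> * E0 / 2" "E \<le> 1"
  proof -
    show "0 < E" using cs E0 L by (simp add: E_def)
    show le: "E \<le> \<kappa> * E0 / 2" unfolding E_def
      using cs E0 AL by (intro divide_left_mono) auto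
    have "\<kappa> * E0 \<le> 1" using cs E0 by (intro mult_le_one) auto
    then show "E \<le> 1" using le by simp
  qed
  define N where "N = Suc (length cs)"
  show thesis
  proof (rule that[of E N])
    fix y y' n and \<rho> :: real
    assume y: "y \<in> julia_set f" and \<rho>: "0 < \<rho>" "\<rho> \<le> 1"
      and off: "\<And>c l. c \<in> crit_julia \<Longrightarrow> l < n \<Longrightarrow> \<rho> \<le> chd ((f ^^ l) y) c"
      and near: "chd y y' \<le> E ^ Suc n * \<rho> ^ N"
    have \<rho>N: "\<rho> ^ N \<le> \<rho> ^ length cs" using \<rho> by (intro power_decreasing) (auto simp: N_def)
    have P: "(\<kappa> * E0) ^ k * \<rho> ^ N \<le> (\<Prod>i<k. D ((f ^^ i) y))" if "k \<le> n" for k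
    proof -
      have "(\<kappa> * E0) ^ k * \<rho> ^ N \<le> \<kappa> ^ k * (E0 ^ k * \<rho> ^ length cs)"
        using \<rho>N cs E0 by (simp add: power_mult_distrib mult_left_mono)
      also have "\<dots> \<le> \<kappa> ^ k * (\<Prod>l<k. \<Prod>c\<leftarrow>cs. chd ((f ^^ l) y) c)"
        using cs off that \<rho> y by (intro mult_left_mono E0(3)) auto
      also have "\<dots> = (\<Prod>i<k. D ((f ^^ i) y))" by (simp add: D_def prod.distrib)
      finally show ?thesis .
    qed
    \<comment> \<open>All factors D are at most 1, so each of them is at least the product of the
      factors up to it.\<close>
    have Dl: "(\<kappa> * E0) ^ n * \<rho> ^ N \<le> D ((f ^^ l) y)" if "l < n" for l
    proof -
      have "(\<kappa> * E0) ^ n \<le> (\<kappa> * E0) ^ Suc l"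
        using that cs E0 by (intro power_decreasing mult_le_one) auto
      then have "(\<kappa> * E0) ^ n * \<rho> ^ N \<le> (\<kappa> * E0) ^ Suc l * \<rho> ^ N" using \<rho> by (intro mult_right_mono) auto
      also have "\<dots> \<le> (\<Prod>i<Suc l. D ((f ^^ i) y))" using that by (intro P) simp
      also have "\<dots> = (\<Prod>i<l. D ((f ^^ i) y)) * D ((f ^^ l) y)" by simp
      also have "\<dots> \<le> 1 * D ((f ^^ l) y)"
        by (intro mult_right_mono prod_le_1) (auto simp: D)
      finally show ?thesis by simp
    qed
    have step: "A * chd ((f ^^ l) y) ((f ^^ l) y') \<le> D ((f ^^ l) y) / 2" if "l < n" for l
    proof -
      have "A * chd ((f ^^ l) y) ((f ^^ l) y') \<le> A * (L ^ n * (E ^ Suc n * \<rho> ^ N))"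
      proof (intro mult_left_mono)
        have "chd ((f ^^ l) y) ((f ^^ l) y') \<le> L ^ l * chd y y'" by (rule lipschitz_funpow[OF L])
        also have "\<dots> \<le> L ^ n * (E ^ Suc n * \<rho> ^ N)"
          using that L near by (intro mult_mono power_increasing) auto
        finally show "chd ((f ^^ l) y) ((f ^^ l) y') \<le> L ^ n * (E ^ Suc n * \<rho> ^ N)" .
      qed (use cs in auto)
      also have "\<dots> = (A * E) * (L * E) ^ n * \<rho> ^ N" by (simp add: power_mult_distrib)
      also have "\<dots> \<le> (1 / 2) * (\<kappa> * E0) ^ n * \<rho> ^ N"
      proof -
        have kE: "\<kappa> * E0 \<le> 1" using cs E0 by (intro mult_le_one) auto
        have "A * E = \<kappa> * E0 / L / 2" using cs by (simp add: E_def)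
        also have "\<dots> \<le> 1 / 2" using kE L by (simp add: divide_le_eq)
        finally have AE: "A * E \<le> 1 / 2" .
        have "L * E = \<kappa> * E0 / (2 * A)" using L by (simp add: E_def)
        also have "\<dots> \<le> \<kappa> * E0 / 1" using cs E0 by (intro divide_left_mono) auto
        finally have LE: "L * E \<le> \<kappa> * E0" by simp
        show ?thesis
          by (intro mult_right_mono mult_mono power_mono AE LE) (use E L \<rho> cs in auto)
      qed
      also have "\<dots> \<le> D ((f ^^ l) y) / 2" using Dl[OF that] by simp
      finally show ?thesis .
    qed
    have "(\<Prod>i<k. D ((f ^^ i) y) / 2) * chd y y' \<le> chd ((f ^^ k) y) ((f ^^ k) y')" if "k \<le> n" for k
      using that
    proof (induction k)
      case (Suc k)
      define u v where "u = (f ^^ k) y" and "v = (f ^^ k) y'"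
      have "(\<Prod>i<Suc k. D ((f ^^ i) y) / 2) * chd y y' = (\<Prod>i<k. D ((f ^^ i) y) / 2) * chd y y' * (D u / 2)"
        by (simp add: u_def)
      also have "\<dots> \<le> chd u v * (D u / 2)"
        using Suc D by (intro mult_right_mono) (auto simp: u_def v_def)
      also have "\<dots> \<le> chd u v * (D u - A * chd u v)"
        using step[of k] Suc.prems by (intro mult_left_mono) (auto simp: u_def v_def)
      also have "\<dots> \<le> chd (f u) (f v)" using cs(5)[of u v] by (simp add: D_def)
      finally show ?case by (simp add: u_def v_def)
    qed simp
    from this[of n] have 1: "(\<Prod>i<n. D ((f ^^ i) y) / 2) * chd y y' \<le> chd ((f ^^ n) y) ((f ^^ n) y')" by simp
    have "E ^ n * \<rho> ^ N \<le> (\<kappa> * E0 / 2) ^ n * \<rho> ^ N"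
      using E \<rho> by (intro mult_right_mono power_mono) auto
    also have "\<dots> = (\<kappa> * E0) ^ n * \<rho> ^ N / 2 ^ n" by (simp add: power_divide)
    also have "\<dots> \<le> (\<Prod>i<n. D ((f ^^ i) y)) / 2 ^ n" using P[of n] by (intro divide_right_mono) auto
    also have "\<dots> = (\<Prod>i<n. D ((f ^^ i) y) / 2)" by (simp add: prod_dividef)
    finally have "E ^ n * \<rho> ^ N * chd y y' \<le> (\<Prod>i<n. D ((f ^^ i) y) / 2) * chd y y'"
      by (intro mult_right_mono) auto
    then show "E ^ n * \<rho> ^ N * chd y y' \<le> chd ((f ^^ n) y) ((f ^^ n) y')" using 1 by linarith
  qed (use E in \<open>auto simp: N_def\<close>)
qed

text \<open>If J is finite, a section of \<open>f\<close> maps it injectively into itself, hence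
  onto itself, so every point of J has a single preimage and is critical. But an orbit in J repeats
  a point, an exact return to a critical point that \<open>no_early_return_julia\<close>
  forbids.\<close>

lemma infinite_julia:
  assumes "julia_set f \<noteq> {}" shows "infinite (julia_set f)"
proof
  assume fin: "finite (julia_set f)"
  define J where "J = julia_set f"
  define g where "g y = (SOME x. f x = y)" for y
  have g: "f (g y) = y" for y unfolding g_def using surj_f by (rule someI_ex)
  have gJ: "g ` J \<subseteq> J" using julia_if_image g by (auto simp: J_def)
  have "inj_on g J" by (metis g inj_onI)
  then have "g ` J = J" using gJ fin by (metis J_def endo_inj_surj)
  then have crit: "c \<in> crit_julia" if "c \<in> J" for c
  proof -
    have "x = c" if "f x = f c" for x
    proof -
      have "x \<in> J" using that \<open>c \<in> J\<close> f_julia julia_if_image by (metis J_def)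
      then show "x = c" using \<open>g ` J = J\<close> \<open>c \<in> J\<close> that g by (metis imageE)
    qed
    then show ?thesis using critical_if_unique_preimage that by (auto simp: crit_julia_def J_def)
  qed
  obtain x where x: "x \<in> J" using assms by (auto simp: J_def)
  have orb: "(f ^^ n) x \<in> J" for n using x by (simp add: J_def funpow_julia_iff)
  have "\<not> inj (\<lambda>n. (f ^^ n) x)"
  proof
    assume "inj (\<lambda>n. (f ^^ n) x)"
    then have "infinite (range (\<lambda>n. (f ^^ n) x))" by (simp add: range_inj_infinite)
    moreover have "range (\<lambda>n. (f ^^ n) x) \<subseteq> J" using orb by blast
    ultimately show False using fin J_def finite_subset by blast
  qed
  then obtain i j where ij: "i < j" "(f ^^ i) x = (f ^^ j) x"
    unfolding inj_def by (metis nat_neq_iff)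
  obtain B where B: "1 \<le> B"
    "\<And>c n R i j y. c \<in> crit_julia \<Longrightarrow> 0 < R \<Longrightarrow> B ^ n * R < 1 \<Longrightarrow> i < j \<Longrightarrow> j \<le> n \<Longrightarrow>
      chd ((f ^^ i) y) c \<le> R \<Longrightarrow> chd ((f ^^ j) y) c \<le> R \<Longrightarrow> False"
    using no_early_return_julia by metis
  have "B ^ j > 0" using B(1) by simp
  then show False
    using B(2)[OF crit[OF orb[of i]], of "1 / (2 * B ^ j)" j i j x] ij B(1) by simp
qed

end

section \<open>Uniform perfectness of the Julia set\<close>

text \<open>Cauchy's inequality on discs of radius r about the points of the smaller disc, which is
  convex.\<close>

lemma holomorphic_lipschitz:
  assumes hol: "g holomorphic_on cball a (2 * r)" and r: "0 < r"
    and bd: "\<And>z. z \<in> cball a (2 * r) \<Longrightarrow> cmod (g z) \<le> K"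
    and z: "z \<in> cball a r" "z' \<in> cball a r"
  shows "cmod (g z - g z') \<le> K / r * cmod (z - z')"
proof (rule field_differentiable_bound[OF convex_cball _ _ z])
  fix w assume w: "w \<in> cball a r"
  have sub: "cball w r \<subseteq> cball a (2 * r)"
    using w by (auto simp: subset_iff dist_norm) (smt (verit) dist_norm dist_triangle)
  have "w \<in> ball a (2 * r)" using w r by auto
  moreover have hb: "g holomorphic_on ball a (2 * r)"
    using hol ball_subset_cball holomorphic_on_subset by blast
  ultimately have "(g has_field_derivative deriv g w) (at w)"
    by (intro holomorphic_derivI[of _ "ball a (2 * r)"]) auto
  then show "(g has_field_derivative deriv g w) (at w within cball a r)"
    by (rule has_field_derivative_at_within)
  have hw: "g holomorphic_on cball w r" using hol sub holomorphic_on_subset by blast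
  have "cmod ((deriv ^^ 1) g w) \<le> fact 1 * K / r ^ 1"
  proof (rule Cauchy_inequality)
    show "g holomorphic_on ball w r" using hw ball_subset_cball holomorphic_on_subset by blast
    show "continuous_on (cball w r) g" using hw by (rule holomorphic_on_imp_continuous_on)
    show "cmod (g x) \<le> K" if "cmod (w - x) = r" for x
      using that sub by (intro bd) (auto simp: dist_norm subset_iff)
  qed (rule r)
  then show "cmod (deriv g w) \<le> K / r" by simp
qed

section \<open>A quantitative form of Montel's theorem\<close>

lemma chd_pt_swap: "chd (pt P Q) (pt R S) = chd (pt Q P) (pt S R)" if "P \<noteq> 0 \<or> Q \<noteq> 0" "R \<noteq> 0 \<or> S \<noteq> 0"
  using that by (simp add: chd_pt disj_commute nrm_commute[of P] nrm_commute[of R] norm_minus_commute mult.commute)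

lemma omit_0_1_lipschitz:
  obtains C where "C > 0"
    "\<And>g \<zeta>0 R \<zeta>. 0 < R \<Longrightarrow> g holomorphic_on cball \<zeta>0 R \<Longrightarrow>
      (\<And>z. z \<in> cball \<zeta>0 R \<Longrightarrow> g z \<noteq> 0 \<and> g z \<noteq> 1) \<Longrightarrow> cmod (g \<zeta>0) \<le> 1 \<Longrightarrow>
      \<zeta> \<in> cball \<zeta>0 (R / 4) \<Longrightarrow> cmod (g \<zeta> - g \<zeta>0) \<le> C * cmod (\<zeta> - \<zeta>0) / R"
proof (rule that)
  \<comment> \<open>Schottky's bound for a central value of modulus at most 1, on half of the unit
    disc: 2 + 2 * 1 + 12 * (1 / 2) / (1 - 1 / 2) = 16.\<close>
  define K where "K = exp (pi * exp (pi * 16))"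
  show "4 * K > 0" by (simp add: K_def)
  fix g :: "complex \<Rightarrow> complex" and \<zeta>0 \<zeta> :: complex and R :: real
  assume R: "0 < R" and hol: "g holomorphic_on cball \<zeta>0 R"
    and om: "\<And>z. z \<in> cball \<zeta>0 R \<Longrightarrow> g z \<noteq> 0 \<and> g z \<noteq> 1" and g0: "cmod (g \<zeta>0) \<le> 1"
    and \<zeta>: "\<zeta> \<in> cball \<zeta>0 (R / 4)"
  have inb: "\<zeta>0 + of_real R * z \<in> cball \<zeta>0 R" if "z \<in> cball 0 1" for z
    using that R by (simp add: dist_norm norm_mult)
  have bd: "cmod (g z) \<le> K" if "z \<in> cball \<zeta>0 (R / 2)" for z
  proof -
    define w where "w = (z - \<zeta>0) / of_real R"
    have w: "cmod w \<le> 1 / 2" "\<zeta>0 + of_real R * w = z"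
      using that R by (auto simp: w_def dist_norm norm_divide norm_minus_commute field_simps)
    have "cmod ((g \<circ> (\<lambda>z. \<zeta>0 + of_real R * z)) w) \<le> exp (pi * exp (pi * (2 + 2 * 1 + 12 * (1 / 2) / (1 - 1 / 2))))"
    proof (rule Schottky[where f = "g \<circ> (\<lambda>z. \<zeta>0 + of_real R * z)"])
      show "(g \<circ> (\<lambda>z. \<zeta>0 + of_real R * z)) holomorphic_on cball 0 1"
        by (intro holomorphic_on_compose_gen[OF _ hol] holomorphic_intros) (use inb in auto)
    qed (use g0 om inb w in auto)
    then show ?thesis by (simp add: w K_def)
  qed
  have "cmod (g \<zeta> - g \<zeta>0) \<le> K / (R / 4) * cmod (\<zeta> - \<zeta>0)"
  proof (rule holomorphic_lipschitz)
    show "g holomorphic_on cball \<zeta>0 (2 * (R / 4))" using R by (intro holomorphic_on_subset[OF hol]) auto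
  qed (use R \<zeta> bd in auto)
  then show "cmod (g \<zeta> - g \<zeta>0) \<le> 4 * K * cmod (\<zeta> - \<zeta>0) / R" by (simp add: field_simps)
qed

text \<open>Exchanging numerator and denominator is an isometry that preserves the omitted set, so
  the value at the centre may be assumed to have modulus at most 1. Hence the constant does not
  depend on that value.\<close>

lemma spherical_omit_0_1_infty:
  obtains C where "C > 0"
    "\<And>P Q \<zeta>0 R \<zeta>. 0 < R \<Longrightarrow> P holomorphic_on cball \<zeta>0 R \<Longrightarrow> Q holomorphic_on cball \<zeta>0 R \<Longrightarrow>
      (\<And>z. z \<in> cball \<zeta>0 R \<Longrightarrow> P z \<noteq> 0 \<and> Q z \<noteq> 0 \<and> P z \<noteq> Q z) \<Longrightarrow>
      \<zeta> \<in> cball \<zeta>0 (R / 4) \<Longrightarrow> chd (pt (P \<zeta>) (Q \<zeta>)) (pt (P \<zeta>0) (Q \<zeta>0)) \<le> C * cmod (\<zeta> - \<zeta>0) / R"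
proof -
  obtain C where C: "C > 0"
    "\<And>g \<zeta>0 R \<zeta>. 0 < R \<Longrightarrow> g holomorphic_on cball \<zeta>0 R \<Longrightarrow>
      (\<And>z. z \<in> cball \<zeta>0 R \<Longrightarrow> g z \<noteq> 0 \<and> g z \<noteq> 1) \<Longrightarrow> cmod (g \<zeta>0) \<le> 1 \<Longrightarrow>
      \<zeta> \<in> cball \<zeta>0 (R / 4) \<Longrightarrow> cmod (g \<zeta> - g \<zeta>0) \<le> C * cmod (\<zeta> - \<zeta>0) / R"
    using omit_0_1_lipschitz by metis
  have main: "chd (pt (P \<zeta>) (Q \<zeta>)) (pt (P \<zeta>0) (Q \<zeta>0)) \<le> C * cmod (\<zeta> - \<zeta>0) / R"
    if R: "0 < R" and hol: "P holomorphic_on cball \<zeta>0 R" "Q holomorphic_on cball \<zeta>0 R"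
      and om: "\<And>z. z \<in> cball \<zeta>0 R \<Longrightarrow> P z \<noteq> 0 \<and> Q z \<noteq> 0 \<and> P z \<noteq> Q z"
      and \<zeta>: "\<zeta> \<in> cball \<zeta>0 (R / 4)" and le: "cmod (P \<zeta>0 / Q \<zeta>0) \<le> 1"
    for P Q :: "complex \<Rightarrow> complex" and \<zeta>0 R \<zeta>
  proof -
    have "\<zeta> \<in> cball \<zeta>0 R" "\<zeta>0 \<in> cball \<zeta>0 R" using \<zeta> R by auto
    then have nz: "Q \<zeta> \<noteq> 0" "Q \<zeta>0 \<noteq> 0" using om by auto
    have "chd (pt (P \<zeta>) (Q \<zeta>)) (pt (P \<zeta>0) (Q \<zeta>0)) \<le> cmod (P \<zeta> / Q \<zeta> - P \<zeta>0 / Q \<zeta>0)"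
      using nz by (rule chd_affine_le)
    also have "\<dots> \<le> C * cmod (\<zeta> - \<zeta>0) / R"
      by (rule C(2)[of R "\<lambda>z. P z / Q z"]) (use R hol om \<zeta> le in \<open>auto intro!: holomorphic_intros\<close>)
    finally show ?thesis .
  qed
  show thesis
  proof (rule that[OF C(1)])
    fix P Q :: "complex \<Rightarrow> complex" and \<zeta>0 \<zeta> :: complex and R :: real
    assume R: "0 < R" and hol: "P holomorphic_on cball \<zeta>0 R" "Q holomorphic_on cball \<zeta>0 R"
      and om: "\<And>z. z \<in> cball \<zeta>0 R \<Longrightarrow> P z \<noteq> 0 \<and> Q z \<noteq> 0 \<and> P z \<noteq> Q z"
      and \<zeta>: "\<zeta> \<in> cball \<zeta>0 (R / 4)"
    have in': "\<zeta> \<in> cball \<zeta>0 R" "\<zeta>0 \<in> cball \<zeta>0 R" using \<zeta> R by auto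
    show "chd (pt (P \<zeta>) (Q \<zeta>)) (pt (P \<zeta>0) (Q \<zeta>0)) \<le> C * cmod (\<zeta> - \<zeta>0) / R"
    proof (cases "cmod (P \<zeta>0 / Q \<zeta>0) \<le> 1")
      case True
      then show ?thesis using main[OF R hol om \<zeta>] by blast
    next
      case False
      then have "cmod (Q \<zeta>0 / P \<zeta>0) \<le> 1" using om[OF in'(2)] by (auto simp: norm_divide field_simps)
      then have "chd (pt (Q \<zeta>) (P \<zeta>)) (pt (Q \<zeta>0) (P \<zeta>0)) \<le> C * cmod (\<zeta> - \<zeta>0) / R"
        using om by (intro main[OF R hol(2,1) _ \<zeta>]) fastforce+
      then show ?thesis using om[OF in'(1)] om[OF in'(2)] by (subst chd_pt_swap) auto
    qed
  qed
qed

lemma cmod_le_nrm: "cmod P \<le> nrm P Q" "cmod Q \<le> nrm P Q"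
  by (simp_all add: nrm_def real_le_rsqrt)

lemma nrm_le: "nrm P Q \<le> cmod P + cmod Q"
  unfolding nrm_def by (rule sqrt_sum_squares_le_sum) auto

text \<open>A Moebius transformation reduces this to 0, 1, infinity. It acts linearly on homogeneous
  coordinates and therefore distorts chordal distances by a bounded factor.\<close>

lemma spherical_omit_three:
  assumes distinct: "u \<noteq> v" "u \<noteq> w" "v \<noteq> w"
  obtains C where "C > 0"
    "\<And>P Q \<zeta>0 R \<zeta>. 0 < R \<Longrightarrow> P holomorphic_on cball \<zeta>0 R \<Longrightarrow> Q holomorphic_on cball \<zeta>0 R \<Longrightarrow>
      (\<And>z. z \<in> cball \<zeta>0 R \<Longrightarrow> (P z \<noteq> 0 \<or> Q z \<noteq> 0) \<and> pt (P z) (Q z) \<notin> {u, v, w}) \<Longrightarrow>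
      \<zeta> \<in> cball \<zeta>0 (R / 4) \<Longrightarrow> chd (pt (P \<zeta>) (Q \<zeta>)) (pt (P \<zeta>0) (Q \<zeta>0)) \<le> C * cmod (\<zeta> - \<zeta>0) / R"
proof -
  obtain C where C: "C > 0"
    "\<And>P Q \<zeta>0 R \<zeta>. 0 < R \<Longrightarrow> P holomorphic_on cball \<zeta>0 R \<Longrightarrow> Q holomorphic_on cball \<zeta>0 R \<Longrightarrow>
      (\<And>z. z \<in> cball \<zeta>0 R \<Longrightarrow> P z \<noteq> 0 \<and> Q z \<noteq> 0 \<and> P z \<noteq> Q z) \<Longrightarrow>
      \<zeta> \<in> cball \<zeta>0 (R / 4) \<Longrightarrow> chd (pt (P \<zeta>) (Q \<zeta>)) (pt (P \<zeta>0) (Q \<zeta>0)) \<le> C * cmod (\<zeta> - \<zeta>0) / R"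
    using spherical_omit_0_1_infty by metis
  obtain u1 u2 where u: "u = pt u1 u2" "u1 \<noteq> 0 \<or> u2 \<noteq> 0" by (rule pt_surj)
  obtain v1 v2 where v: "v = pt v1 v2" "v1 \<noteq> 0 \<or> v2 \<noteq> 0" by (rule pt_surj)
  obtain w1 w2 where w: "w = pt w1 w2" "w1 \<noteq> 0 \<or> w2 \<noteq> 0" by (rule pt_surj)
  \<comment> \<open>The factors \<alpha> and \<beta> are chosen so that X - Y becomes a multiple of
    P v2 - v1 Q, that is, so that v goes to 1.\<close>
  define \<alpha> \<beta> \<gamma> where "\<alpha> = v1 * w2 - w1 * v2" and "\<beta> = v1 * u2 - u1 * v2" and "\<gamma> = u1 * w2 - w1 * u2"
  have nz: "\<alpha> \<noteq> 0" "\<beta> \<noteq> 0" "\<gamma> \<noteq> 0"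
    using distinct u v w by (auto simp: pt_eq_iff \<alpha>_def \<beta>_def \<gamma>_def)
  text \<open>The Moebius transformation sending \<open>u\<close>, \<open>v\<close>, \<open>w\<close> to \<open>0\<close>, \<open>1\<close>, \<open>\<infinity>\<close>.\<close>
  define X Y where "X P Q = \<alpha> * (P * u2 - u1 * Q)" and "Y P Q = \<beta> * (P * w2 - w1 * Q)" for P Q
  define m where "m = cmod \<alpha> * (cmod u1 + cmod u2) + cmod \<beta> * (cmod w1 + cmod w2)"
  have m: "nrm (X P Q) (Y P Q) \<le> m * nrm P Q" for P Q
  proof -
    have bil: "cmod (P * c2 - c1 * Q) \<le> (cmod c1 + cmod c2) * nrm P Q" for c1 c2
    proof -
      have "cmod (P * c2 - c1 * Q) \<le> cmod P * cmod c2 + cmod c1 * cmod Q"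
        by (metis norm_mult norm_triangle_ineq4)
      also have "\<dots> \<le> nrm P Q * cmod c2 + cmod c1 * nrm P Q"
        by (intro add_mono mult_mono cmod_le_nrm) auto
      finally show ?thesis by (simp add: algebra_simps)
    qed
    have "nrm (X P Q) (Y P Q) \<le> cmod \<alpha> * cmod (P * u2 - u1 * Q) + cmod \<beta> * cmod (P * w2 - w1 * Q)"
      using nrm_le[of "X P Q" "Y P Q"] by (simp add: X_def Y_def norm_mult)
    also have "\<dots> \<le> cmod \<alpha> * ((cmod u1 + cmod u2) * nrm P Q) + cmod \<beta> * ((cmod w1 + cmod w2) * nrm P Q)"
      by (intro add_mono mult_left_mono bil) auto
    finally show ?thesis by (simp add: m_def algebra_simps)
  qed
  have det: "X P Q * Y R S - X R S * Y P Q = \<alpha> * \<beta> * \<gamma> * (P * S - R * Q)" for P Q R S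
    by (simp add: X_def Y_def \<gamma>_def algebra_simps)
  have XY: "X P Q - Y P Q = \<gamma> * (P * v2 - v1 * Q)" for P Q
    by (simp add: X_def Y_def \<alpha>_def \<beta>_def \<gamma>_def algebra_simps)
  have XYnz: "X P Q \<noteq> 0 \<and> Y P Q \<noteq> 0 \<and> X P Q \<noteq> Y P Q"
    if "P \<noteq> 0 \<or> Q \<noteq> 0" "pt P Q \<notin> {u, v, w}" for P Q
  proof -
    have 1: "P * u2 \<noteq> u1 * Q" "P * v2 \<noteq> v1 * Q" "P * w2 \<noteq> w1 * Q"
      using that u v w by (auto simp: pt_eq_iff)
    then have "X P Q - Y P Q \<noteq> 0" unfolding XY using nz by simp
    then show ?thesis using 1 nz by (auto simp: X_def Y_def)
  qed
  \<comment> \<open>\<open>\<alpha> * \<beta> * \<gamma>\<close> is the determinant of the linear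
    map (X, Y) and m a bound for its norm; \<open>chd_pt\<close> has one determinant in the
    numerator and two norms in the denominator.\<close>
  define k where "k = m\<^sup>2 / cmod (\<alpha> * \<beta> * \<gamma>)"
  have chdT: "chd (pt P Q) (pt R S) \<le> k * chd (pt (X P Q) (Y P Q)) (pt (X R S) (Y R S))"
    if nz': "P \<noteq> 0 \<or> Q \<noteq> 0" "R \<noteq> 0 \<or> S \<noteq> 0" "X P Q \<noteq> 0" "X R S \<noteq> 0" for P Q R S
  proof -
    define N1 N2 M1 M2 where "N1 = nrm P Q" and "N2 = nrm R S"
      and "M1 = nrm (X P Q) (Y P Q)" and "M2 = nrm (X R S) (Y R S)"
    have pos: "0 < N1" "0 < N2" "0 < M1" "0 < M2"
      using nz' by (auto simp: N1_def N2_def M1_def M2_def intro!: nrm_pos)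
    have dpos: "0 < cmod (\<alpha> * \<beta> * \<gamma>)" using nz by simp
    have "M1 * M2 \<le> (m * N1) * (m * N2)"
      using pos m by (intro mult_mono) (auto simp: N1_def N2_def M1_def M2_def m_def)
    then have "1 / (N1 * N2) \<le> m\<^sup>2 / (M1 * M2)"
      using pos by (simp add: divide_simps power2_eq_square) (simp add: mult_ac)
    then have "cmod (P * S - R * Q) * (1 / (N1 * N2)) \<le> cmod (P * S - R * Q) * (m\<^sup>2 / (M1 * M2))"
      by (intro mult_left_mono) auto
    also have "\<dots> = k * (cmod (X P Q * Y R S - X R S * Y P Q) / (M1 * M2))"
      unfolding det using nz by (simp add: k_def norm_mult)
    finally show ?thesis using nz' by (simp add: chd_pt N1_def N2_def M1_def M2_def)
  qed
  have k: "0 \<le> k" by (simp add: k_def)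
  show thesis
  proof (rule that[of "k * C + 1"])
    show "0 < k * C + 1" using k C by (simp add: add_nonneg_pos)
    fix P Q :: "complex \<Rightarrow> complex" and \<zeta>0 \<zeta> :: complex and R :: real
    assume R: "0 < R" and hol: "P holomorphic_on cball \<zeta>0 R" "Q holomorphic_on cball \<zeta>0 R"
      and om: "\<And>z. z \<in> cball \<zeta>0 R \<Longrightarrow> (P z \<noteq> 0 \<or> Q z \<noteq> 0) \<and> pt (P z) (Q z) \<notin> {u, v, w}"
      and \<zeta>: "\<zeta> \<in> cball \<zeta>0 (R / 4)"
    have in': "\<zeta> \<in> cball \<zeta>0 R" "\<zeta>0 \<in> cball \<zeta>0 R" using \<zeta> R by auto
    have nzR: "X (P z) (Q z) \<noteq> 0 \<and> Y (P z) (Q z) \<noteq> 0 \<and> X (P z) (Q z) \<noteq> Y (P z) (Q z)" if "z \<in> cball \<zeta>0 R" for z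
      using om[OF that] XYnz by blast
    have "chd (pt (P \<zeta>) (Q \<zeta>)) (pt (P \<zeta>0) (Q \<zeta>0)) \<le>
        k * chd (pt (X (P \<zeta>) (Q \<zeta>)) (Y (P \<zeta>) (Q \<zeta>))) (pt (X (P \<zeta>0) (Q \<zeta>0)) (Y (P \<zeta>0) (Q \<zeta>0)))"
      using om[OF in'(1)] om[OF in'(2)] nzR[OF in'(1)] nzR[OF in'(2)] by (intro chdT) auto
    also have "\<dots> \<le> k * (C * cmod (\<zeta> - \<zeta>0) / R)"
    proof (intro mult_left_mono k C(2)[OF R])
      show "(\<lambda>z. X (P z) (Q z)) holomorphic_on cball \<zeta>0 R" "(\<lambda>z. Y (P z) (Q z)) holomorphic_on cball \<zeta>0 R"
        unfolding X_def Y_def by (intro holomorphic_intros hol)+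
    qed (use nzR \<zeta> in auto)
    also have "\<dots> \<le> (k * C + 1) * cmod (\<zeta> - \<zeta>0) / R"
      using R by (simp add: field_simps)
    finally show "chd (pt (P \<zeta>) (Q \<zeta>)) (pt (P \<zeta>0) (Q \<zeta>0)) \<le> (k * C + 1) * cmod (\<zeta> - \<zeta>0) / R" .
  qed
qed

text \<open>A logarithmic change of coordinates turns a thick annulus into a wide strip, in which the
  core circle has bounded length.\<close>

lemma core_circle_small:
  assumes distinct: "u \<noteq> v" "u \<noteq> w" "v \<noteq> w"
  obtains C where "C > 0"
    "\<And>P Q a s R z z0. 4 * pi \<le> R \<Longrightarrow> 0 < s \<Longrightarrow> P holomorphic_on UNIV \<Longrightarrow> Q holomorphic_on UNIV \<Longrightarrow>
      (\<And>z. P z \<noteq> 0 \<or> Q z \<noteq> 0) \<Longrightarrow>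
      (\<And>z. s * exp (- R) \<le> cmod (z - a) \<Longrightarrow> cmod (z - a) \<le> s * exp R \<Longrightarrow> pt (P z) (Q z) \<notin> {u, v, w}) \<Longrightarrow>
      cmod (z - a) = s \<Longrightarrow> cmod (z0 - a) = s \<Longrightarrow> chd (pt (P z) (Q z)) (pt (P z0) (Q z0)) \<le> C / R"
proof -
  obtain C where C: "C > 0"
    "\<And>P Q \<zeta>0 R \<zeta>. 0 < R \<Longrightarrow> P holomorphic_on cball \<zeta>0 R \<Longrightarrow> Q holomorphic_on cball \<zeta>0 R \<Longrightarrow>
      (\<And>z. z \<in> cball \<zeta>0 R \<Longrightarrow> (P z \<noteq> 0 \<or> Q z \<noteq> 0) \<and> pt (P z) (Q z) \<notin> {u, v, w}) \<Longrightarrow>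
      \<zeta> \<in> cball \<zeta>0 (R / 4) \<Longrightarrow> chd (pt (P \<zeta>) (Q \<zeta>)) (pt (P \<zeta>0) (Q \<zeta>0)) \<le> C * cmod (\<zeta> - \<zeta>0) / R"
    using spherical_omit_three[OF distinct] by metis
  show thesis
  proof (rule that[of "C * pi"])
    show "0 < C * pi" using C by simp
    fix P Q :: "complex \<Rightarrow> complex" and a z z0 :: complex and s R :: real
    assume R: "4 * pi \<le> R" and s: "0 < s" and hol: "P holomorphic_on UNIV" "Q holomorphic_on UNIV"
      and nz: "\<And>z. P z \<noteq> 0 \<or> Q z \<noteq> 0"
      and om: "\<And>z. s * exp (- R) \<le> cmod (z - a) \<Longrightarrow> cmod (z - a) \<le> s * exp R \<Longrightarrow> pt (P z) (Q z) \<notin> {u, v, w}"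
      and z: "cmod (z - a) = s" "cmod (z0 - a) = s"
    have R0: "0 < R" using R pi_gt_zero by linarith
    have nz0: "z - a \<noteq> 0" "z0 - a \<noteq> 0" using z s by auto
    \<comment> \<open>Logarithms of z0 - a and z - a. Both points lie on the same circle, so the two
      logarithms differ by an imaginary number of modulus at most pi, and 4 pi \<le> R puts \<zeta>
      into the disc of radius R / 4.\<close>
    define \<zeta>0 \<zeta> where "\<zeta>0 = Ln (z0 - a)" and "\<zeta> = \<zeta>0 + Ln ((z - a) / (z0 - a))"
    have e0: "a + exp \<zeta>0 = z0" using nz0 by (simp add: \<zeta>0_def)
    have e1: "a + exp \<zeta> = z" using nz0 by (simp add: \<zeta>_def \<zeta>0_def exp_add)
    have "Re (Ln ((z - a) / (z0 - a))) = 0" using nz0 z s by (simp add: Re_Ln norm_divide)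
    moreover have "\<bar>Im (Ln ((z - a) / (z0 - a)))\<bar> \<le> pi"
      using nz0 Im_Ln_le_pi[of "(z - a) / (z0 - a)"] mpi_less_Im_Ln[of "(z - a) / (z0 - a)"] by auto
    ultimately have d: "cmod (\<zeta> - \<zeta>0) \<le> pi" by (simp add: \<zeta>_def cmod_def)
    have "chd (pt ((P \<circ> (\<lambda>x. a + exp x)) \<zeta>) ((Q \<circ> (\<lambda>x. a + exp x)) \<zeta>))
        (pt ((P \<circ> (\<lambda>x. a + exp x)) \<zeta>0) ((Q \<circ> (\<lambda>x. a + exp x)) \<zeta>0)) \<le> C * cmod (\<zeta> - \<zeta>0) / R"
    proof (rule C(2)[OF R0])
      show "(P \<circ> (\<lambda>x. a + exp x)) holomorphic_on cball \<zeta>0 R"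
        by (rule holomorphic_on_compose_gen[OF _ hol(1)]) (auto intro!: holomorphic_intros)
      show "(Q \<circ> (\<lambda>x. a + exp x)) holomorphic_on cball \<zeta>0 R"
        by (rule holomorphic_on_compose_gen[OF _ hol(2)]) (auto intro!: holomorphic_intros)
      show "\<zeta> \<in> cball \<zeta>0 (R / 4)" using d R by (simp add: dist_norm norm_minus_commute)
      fix x assume "x \<in> cball \<zeta>0 R"
      then have "\<bar>Re x - Re \<zeta>0\<bar> \<le> R"
        using abs_Re_le_cmod[of "x - \<zeta>0"] by (simp add: dist_norm norm_minus_commute)
      moreover have "exp (Re \<zeta>0) = s" using nz0 z s by (simp add: \<zeta>0_def Re_Ln)
      ultimately have "s * exp (- R) \<le> cmod (exp x)" "cmod (exp x) \<le> s * exp R"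
        by (auto simp: exp_add[symmetric] simp flip: \<open>exp (Re \<zeta>0) = s\<close>)
      then have "pt (P (a + exp x)) (Q (a + exp x)) \<notin> {u, v, w}" by (intro om) simp_all
      then show "((P \<circ> (\<lambda>x. a + exp x)) x \<noteq> 0 \<or> (Q \<circ> (\<lambda>x. a + exp x)) x \<noteq> 0) \<and>
          pt ((P \<circ> (\<lambda>x. a + exp x)) x) ((Q \<circ> (\<lambda>x. a + exp x)) x) \<notin> {u, v, w}" using nz by simp
    qed
    also have "\<dots> \<le> C * pi / R" using d C R0 by (intro divide_right_mono mult_left_mono) auto
    finally show "chd (pt (P z) (Q z)) (pt (P z0) (Q z0)) \<le> C * pi / R" by (simp add: e0 e1)
  qed
qed

text \<open>The isometry of the sphere given by the unitary matrix with rows \<open>(Q0, - P0)\<close> and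
  \<open>(cnj P0, cnj Q0)\<close> moves \<open>[P0 : Q0]\<close> to \<open>0\<close>.\<close>

context
  fixes P0 Q0 :: complex
  assumes nrm0: "nrm P0 Q0 = 1"
begin

definition rotX where "rotX P Q = P * Q0 - P0 * Q"
definition rotY where "rotY P Q = P * cnj P0 + Q * cnj Q0"

lemma rot_det: "rotX P Q * rotY R S - rotX R S * rotY P Q = P * S - R * Q"
proof -
  have "P0 * cnj P0 + Q0 * cnj Q0 = of_real ((nrm P0 Q0)\<^sup>2)"
    by (simp only: nrm_sq of_real_add complex_norm_square)
  then have 1: "P0 * cnj P0 + Q0 * cnj Q0 = 1" using nrm0 by simp
  have "rotX P Q * rotY R S - rotX R S * rotY P Q = (P * S - R * Q) * (P0 * cnj P0 + Q0 * cnj Q0)"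
    by (simp add: rotX_def rotY_def algebra_simps)
  then show ?thesis by (simp add: 1)
qed

lemma rot_nrm: "nrm (rotX P Q) (rotY P Q) = nrm P Q"
proof -
  have "complex_of_real ((cmod (rotX P Q))\<^sup>2 + (cmod (rotY P Q))\<^sup>2) =
      of_real (((cmod P)\<^sup>2 + (cmod Q)\<^sup>2) * ((cmod P0)\<^sup>2 + (cmod Q0)\<^sup>2))"
    by (simp only: of_real_add of_real_mult complex_norm_square) (simp add: rotX_def rotY_def algebra_simps)
  then have "(cmod (rotX P Q))\<^sup>2 + (cmod (rotY P Q))\<^sup>2 = ((cmod P)\<^sup>2 + (cmod Q)\<^sup>2) * (nrm P0 Q0)\<^sup>2"
    unfolding nrm_sq of_real_eq_iff .
  then show ?thesis by (simp add: nrm_def nrm0[unfolded nrm_def])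
qed

lemma chd_rot:
  assumes "P \<noteq> 0 \<or> Q \<noteq> 0" "R \<noteq> 0 \<or> S \<noteq> 0"
  shows "chd (pt P Q) (pt R S) = chd (pt (rotX P Q) (rotY P Q)) (pt (rotX R S) (rotY R S))"
proof -
  have *: "rotX P Q \<noteq> 0 \<or> rotY P Q \<noteq> 0" if "P \<noteq> 0 \<or> Q \<noteq> 0" for P Q
    using nrm_pos[OF that] rot_nrm[of P Q] by (auto simp: nrm_def)
  show ?thesis using assms *[OF assms(1)] *[OF assms(2)]
    by (simp add: chd_pt rot_det rot_nrm)
qed

lemma chd_rot_base:
  assumes "P \<noteq> 0 \<or> Q \<noteq> 0" shows "chd (pt P Q) (pt P0 Q0) = cmod (rotX P Q) / nrm P Q"
  using assms nrm0 by (subst chd_pt) (auto simp: rotX_def nrm_def)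

text \<open>The chordal distance to the base point is the sine of an angle whose tangent is the
  modulus of the quotient; for a sine of at most 1 / 2 they agree up to a factor 2.\<close>

lemma rot_quotient:
  assumes nz: "P \<noteq> 0 \<or> Q \<noteq> 0" and le: "chd (pt P Q) (pt P0 Q0) \<le> 1 / 2"
  shows "rotY P Q \<noteq> 0" "chd (pt P Q) (pt P0 Q0) \<le> cmod (rotX P Q / rotY P Q)"
    "cmod (rotX P Q / rotY P Q) \<le> 2 * chd (pt P Q) (pt P0 Q0)"
proof -
  define N x y where "N = nrm P Q" and "x = cmod (rotX P Q)" and "y = cmod (rotY P Q)"
  have N: "N > 0" using nrm_pos[OF nz] by (simp add: N_def)
  have chd: "chd (pt P Q) (pt P0 Q0) = x / N" using chd_rot_base[OF nz] by (simp add: x_def N_def)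
  have xy: "x\<^sup>2 + y\<^sup>2 = N\<^sup>2" using rot_nrm[of P Q] by (metis N_def nrm_sq x_def y_def)
  have xN: "2 * x \<le> N" using le chd N by (simp add: divide_le_eq)
  have x0: "0 \<le> x" "0 \<le> y" by (simp_all add: x_def y_def)
  have "(2 * x)\<^sup>2 \<le> N\<^sup>2" using xN x0 by (intro power_mono) auto
  then have "4 * x\<^sup>2 \<le> N\<^sup>2" by simp
  then have "N\<^sup>2 \<le> 4 * y\<^sup>2" using xy zero_le_power2[of N] by linarith
  then have "N\<^sup>2 \<le> (2 * y)\<^sup>2" by simp
  then have Ny: "N \<le> 2 * y" by (rule power2_le_imp_le) (use x0 in simp)
  have "y\<^sup>2 \<le> N\<^sup>2" using xy zero_le_power2[of x] by linarith
  then have yN: "y \<le> N" by (rule power2_le_imp_le) (use N in simp)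
  have y: "y > 0" using Ny N by linarith
  then show "rotY P Q \<noteq> 0" by (simp add: y_def)
  show "chd (pt P Q) (pt P0 Q0) \<le> cmod (rotX P Q / rotY P Q)"
    unfolding chd norm_divide x_def[symmetric] y_def[symmetric] using yN y N x0 by (intro divide_left_mono) auto
  have "x / y \<le> x / (N / 2)" using Ny y N x0 by (intro divide_left_mono) auto
  also have "x / (N / 2) = 2 * (x / N)" by simp
  finally show "cmod (rotX P Q / rotY P Q) \<le> 2 * chd (pt P Q) (pt P0 Q0)"
    unfolding chd norm_divide x_def[symmetric] y_def[symmetric] .
qed

end

text \<open>After rotating y to 0 the bound 1 / 2 excludes poles on the disc, and the maximum
  modulus principle applies to the quotient. The factor 2 is the loss in
  \<open>rot_quotient\<close>.\<close>

lemma spherical_max_modulus: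
  assumes hol: "P holomorphic_on UNIV" "Q holomorphic_on UNIV" and nz: "\<And>z. P z \<noteq> 0 \<or> Q z \<noteq> 0"
    and s: "0 < s" and half: "\<And>z. z \<in> cball a s \<Longrightarrow> chd (pt (P z) (Q z)) y \<le> 1 / 2"
    and bdry: "\<And>z. cmod (z - a) = s \<Longrightarrow> chd (pt (P z) (Q z)) y \<le> \<eta>" and z: "z \<in> cball a s"
  shows "chd (pt (P z) (Q z)) y \<le> 2 * \<eta>"
proof -
  obtain P0 Q0 where y: "y = pt P0 Q0" and n0: "nrm P0 Q0 = 1" by (rule pt_surj)
  define \<theta> where "\<theta> z = rotX P0 Q0 (P z) (Q z) / rotY P0 Q0 (P z) (Q z)" for z
  have rq: "rotY P0 Q0 (P z) (Q z) \<noteq> 0" "chd (pt (P z) (Q z)) y \<le> cmod (\<theta> z)"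
    "cmod (\<theta> z) \<le> 2 * chd (pt (P z) (Q z)) y" if "z \<in> cball a s" for z
    using rot_quotient[OF n0 nz, of z] half[OF that] by (simp_all add: y \<theta>_def)
  have hol\<theta>: "\<theta> holomorphic_on cball a s"
    unfolding \<theta>_def rotX_def[OF n0] rotY_def[OF n0]
    by (intro holomorphic_intros holomorphic_on_subset[OF hol(1)] holomorphic_on_subset[OF hol(2)])
      (use rq(1) in \<open>auto simp: rotY_def[OF n0]\<close>)
  have "cmod (\<theta> z) \<le> 2 * \<eta>"
  proof (rule maximum_modulus_frontier[of \<theta> "cball a s"])
    show "\<theta> holomorphic_on interior (cball a s)" using hol\<theta> holomorphic_on_subset interior_subset by blast
    show "continuous_on (closure (cball a s)) \<theta>" using hol\<theta> by (simp add: holomorphic_on_imp_continuous_on)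
    fix w assume "w \<in> frontier (cball a s)"
    then have "cmod (w - a) = s" "w \<in> cball a s" using s by (auto simp: dist_norm norm_minus_commute)
    then show "cmod (\<theta> w) \<le> 2 * \<eta>" using rq(3)[of w] bdry[of w] by linarith
  qed (use z in auto)
  then show ?thesis using rq(2)[OF z] by linarith
qed

text \<open>In the rotated coordinate the map is holomorphic and bounded by 1, so Cauchy's
  inequality applies; rotations preserve chordal distances.\<close>

lemma spherical_schwarz:
  assumes hol: "P holomorphic_on UNIV" "Q holomorphic_on UNIV" and nz: "\<And>z. P z \<noteq> 0 \<or> Q z \<noteq> 0"
    and s: "0 < s" and half: "\<And>z. z \<in> cball a s \<Longrightarrow> chd (pt (P z) (Q z)) y \<le> 1 / 2"
    and z: "z \<in> cball a (s / 2)" "z' \<in> cball a (s / 2)"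
  shows "chd (pt (P z) (Q z)) (pt (P z') (Q z')) \<le> 2 / s * cmod (z - z')"
proof -
  obtain P0 Q0 where y: "y = pt P0 Q0" and n0: "nrm P0 Q0 = 1" by (rule pt_surj)
  define \<theta> where "\<theta> z = rotX P0 Q0 (P z) (Q z) / rotY P0 Q0 (P z) (Q z)" for z
  have rq: "rotY P0 Q0 (P z) (Q z) \<noteq> 0" "cmod (\<theta> z) \<le> 2 * chd (pt (P z) (Q z)) y" if "z \<in> cball a s" for z
    using rot_quotient[OF n0 nz, of z] half[OF that] by (simp_all add: y \<theta>_def)
  have hol\<theta>: "\<theta> holomorphic_on cball a s"
    unfolding \<theta>_def rotX_def[OF n0] rotY_def[OF n0]
    by (intro holomorphic_intros holomorphic_on_subset[OF hol(1)] holomorphic_on_subset[OF hol(2)])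
      (use rq(1) in \<open>auto simp: rotY_def[OF n0]\<close>)
  have zs: "z \<in> cball a s" "z' \<in> cball a s" using z s by auto
  have "chd (pt (P z) (Q z)) (pt (P z') (Q z')) \<le> cmod (\<theta> z - \<theta> z')"
    using chd_affine_le[OF rq(1)[OF zs(1)] rq(1)[OF zs(2)]] nz by (simp add: chd_rot[OF n0] \<theta>_def)
  also have "\<dots> \<le> 1 / (s / 2) * cmod (z - z')"
  proof (rule holomorphic_lipschitz[OF _ _ _ z])
    show "\<theta> holomorphic_on cball a (2 * (s / 2))" using hol\<theta> by simp
    show "cmod (\<theta> w) \<le> 1" if "w \<in> cball a (2 * (s / 2))" for w
      using rq(2)[of w] half[of w] that by simp
  qed (use s in simp)
  finally show ?thesis by simp
qed

section \<open>Iterates on annuli around a point of the Julia set\<close>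

context rational
begin

text \<open>The n-fold lift of \<open>f\<close> along chart \<open>b\<close>. It presents
  \<open>f ^^ n\<close> by two entire functions without common zeros, so no iterate has to be
  treated separately at its poles.\<close>

definition hpair :: "bool \<Rightarrow> nat \<Rightarrow> complex \<Rightarrow> complex \<times> complex" where
  "hpair b n z = ((\<lambda>(P, Q). (hom p P Q, hom q P Q)) ^^ n) (if b then (z, 1) else (1, z))"

lemma hpair_0: "hpair b 0 z = (if b then (z, 1) else (1, z))"
  by (simp add: hpair_def)

lemma hpair_Suc: "hpair b (Suc n) z =
    (hom p (fst (hpair b n z)) (snd (hpair b n z)), hom q (fst (hpair b n z)) (snd (hpair b n z)))"
  by (simp add: hpair_def case_prod_beta)

lemma hpair_nz: "fst (hpair b n z) \<noteq> 0 \<or> snd (hpair b n z) \<noteq> 0"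
  by (induction n) (use hom_nonzero in \<open>auto simp: hpair_0 hpair_Suc\<close>)

lemma hpair_pt: "(f ^^ n) (chart b z) = pt (fst (hpair b n z)) (snd (hpair b n z))"
proof (induction n)
  case (Suc n)
  then show ?case using f_pt[OF hpair_nz[of b n z]] by (simp add: hpair_Suc)
qed (simp add: hpair_0 chart_def)

lemma hpair_holomorphic:
  "(\<lambda>z. fst (hpair b n z)) holomorphic_on X \<and> (\<lambda>z. snd (hpair b n z)) holomorphic_on X"
proof (induction n)
  case 0
  then show ?case by (cases b) (auto simp: hpair_0 intro!: holomorphic_intros)
next
  case (Suc n)
  then show ?case unfolding hpair_Suc hom_def fst_conv snd_conv
    by (auto intro!: holomorphic_intros)
qed

text \<open>Otherwise the iterates would be small on the core circle of a thick annulus, hence by the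
  maximum principle on the disc inside it, and so \<open>x\<close> would be in the Fatou set.\<close>

lemma uniformly_perfect_julia:
  obtains \<kappa> s0 where "1 \<le> \<kappa>" "0 < s0" "s0 \<le> 1"
    "\<And>x s. x \<in> julia_set f \<Longrightarrow> 0 < s \<Longrightarrow> s \<le> s0 \<Longrightarrow> \<exists>x'\<in>julia_set f. s / \<kappa> \<le> chd x x' \<and> chd x x' \<le> s"
proof (cases "julia_set f = {}")
  case True
  then show ?thesis using that[of 1 1] by auto
next
  case False
  then have inf: "infinite (julia_set f)" by (rule infinite_julia)
  \<comment> \<open>If an annulus misses the Julia set, so do all its images, and hence every
    iterate omits u, v and w there.\<close>
  obtain T where T: "T \<subseteq> julia_set f" "card T = 3" "finite T"
    using infinite_arbitrarily_large[OF inf] by metis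
  then obtain u v w where uvw: "u \<noteq> v" "u \<noteq> w" "v \<noteq> w" "{u, v, w} \<subseteq> julia_set f"
    by (metis card_3_iff)
  obtain L where L: "L \<ge> 1" "\<And>x y. chd (f x) (f y) \<le> L * chd x y" using lipschitz by metis
  obtain C where C: "C > 0"
    "\<And>P Q a s R z z0. 4 * pi \<le> R \<Longrightarrow> 0 < s \<Longrightarrow> P holomorphic_on UNIV \<Longrightarrow> Q holomorphic_on UNIV \<Longrightarrow>
      (\<And>z. P z \<noteq> 0 \<or> Q z \<noteq> 0) \<Longrightarrow>
      (\<And>z. s * exp (- R) \<le> cmod (z - a) \<Longrightarrow> cmod (z - a) \<le> s * exp R \<Longrightarrow> pt (P z) (Q z) \<notin> {u, v, w}) \<Longrightarrow>
      cmod (z - a) = s \<Longrightarrow> cmod (z0 - a) = s \<Longrightarrow> chd (pt (P z) (Q z)) (pt (P z0) (Q z0)) \<le> C / R"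
  proof (rule core_circle_small[OF uvw(1-3)], goal_cases)
    case (1 C)
    show ?case by (rule 1(1)) (fact 1)+
  qed
  \<comment> \<open>One application of \<open>f\<close> enlarges 2 \<eta> to at most 2 L \<eta> = 1
    / 2, the bound that \<open>spherical_max_modulus\<close> requires.\<close>
  define \<eta> where "\<eta> = 1 / (4 * L)"
  have \<eta>: "0 < \<eta>" "\<eta> \<le> 1 / 4" "2 * L * \<eta> = 1 / 2" using L by (auto simp: \<eta>_def field_simps)
  define R where "R = max (4 * pi) (C / \<eta>)"
  have R: "4 * pi \<le> R" "C / \<eta> \<le> R" by (auto simp: R_def)
  have R0: "0 < R" using R pi_gt_zero by linarith
  have CR: "C / R \<le> \<eta>" using R R0 \<eta> by (simp add: field_simps)
  \<comment> \<open>9 is the distortion of the charts, \<open>exp (2 * R)\<close> the ratio of the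
    outer to the inner radius of the annulus.\<close>
  define \<kappa> where "\<kappa> = 9 * exp (2 * R)"
  show thesis
  proof (rule that[of \<kappa> \<eta>])
    show "1 \<le> \<kappa>" using R0 one_le_exp_iff[of "2 * R"] by (simp add: \<kappa>_def del: one_le_exp_iff)
    fix x s assume x: "x \<in> julia_set f" and s: "0 < s" "s \<le> \<eta>"
    obtain b a where a: "x = chart b a" "cmod a \<le> 1" by (rule chart_cover)
    \<comment> \<open>The radius of the core circle, chosen so that the outer circle has radius
      s.\<close>
    define s0 where "s0 = s * exp (- R)"
    have s0: "0 < s0" "s0 * exp R = s" "s0 * exp (- R) = s * exp (- (2 * R))" "s0 \<le> \<eta>"
    proof -
      show "0 < s0" "s0 * exp R = s" "s0 * exp (- R) = s * exp (- (2 * R))"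
        using s by (simp_all add: s0_def flip: exp_add)
      have "s0 \<le> s * 1" unfolding s0_def using s R0 by (intro mult_left_mono) auto
      then show "s0 \<le> \<eta>" using s by simp
    qed
    have "\<exists>z. s0 * exp (- R) \<le> cmod (z - a) \<and> cmod (z - a) \<le> s0 * exp R \<and> chart b z \<in> julia_set f"
    proof (rule ccontr)
      assume *: "\<not> ?thesis"
      define h where "h m z = (f ^^ m) (chart b z)" for m z
      define z0 where "z0 = a + of_real s0"
      have z0: "cmod (z0 - a) = s0" using s0 by (simp add: z0_def)
      have circ: "chd (h m z) (h m z0) \<le> \<eta>" if "cmod (z - a) = s0" for m z
      proof -
        have "chd (h m z) (h m z0) \<le> C / R"
          unfolding h_def hpair_pt
        proof (rule C(2)[OF R(1) s0(1) _ _ hpair_nz _ that z0])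
          fix z assume "s0 * exp (- R) \<le> cmod (z - a)" "cmod (z - a) \<le> s0 * exp R"
          then have "(f ^^ m) (chart b z) \<notin> julia_set f" using * by (auto simp: funpow_julia_iff)
          then show "pt (fst (hpair b m z)) (snd (hpair b m z)) \<notin> {u, v, w}"
            using uvw(4) by (auto simp: hpair_pt)
        qed (use hpair_holomorphic in blast)+
        then show ?thesis using CR by linarith
      qed
      \<comment> \<open>The induction loses nothing: 2 \<eta> at time m gives 1 / 2 on the disc at
        time m + 1, and with \<eta> on the circle the maximum principle returns to 2 \<eta>.\<close>
      have disc: "chd (h m z) (h m z0) \<le> 2 * \<eta>" if "z \<in> cball a s0" for m z
        using that
      proof (induction m arbitrary: z)
        case 0
        have "chd (h 0 z) (h 0 z0) \<le> cmod (z - z0)" using chd_chart_le by (simp add: h_def)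
        also have "\<dots> \<le> 2 * s0"
          using norm_triangle_ineq4[of "z - a" "z0 - a"] 0 z0 by (simp add: dist_norm norm_minus_commute)
        finally show ?case using s0 by simp
      next
        case (Suc m)
        have half: "chd (h (Suc m) z') (h (Suc m) z0) \<le> 1 / 2" if "z' \<in> cball a s0" for z'
        proof -
          have "chd (h (Suc m) z') (h (Suc m) z0) \<le> L * chd (h m z') (h m z0)" using L by (simp add: h_def)
          also have "\<dots> \<le> L * (2 * \<eta>)" using Suc.IH[OF that] L by (intro mult_left_mono) auto
          finally show ?thesis using \<eta>(3) by simp
        qed
        show ?case
          unfolding h_def hpair_pt[of "Suc m" b z]
        proof (rule spherical_max_modulus[OF _ _ hpair_nz s0(1) _ _ Suc.prems])
          show "(\<lambda>z. fst (hpair b (Suc m) z)) holomorphic_on UNIV" "(\<lambda>z. snd (hpair b (Suc m) z)) holomorphic_on UNIV"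
            using hpair_holomorphic by blast+
          show "chd (pt (fst (hpair b (Suc m) z)) (snd (hpair b (Suc m) z))) ((f ^^ Suc m) (chart b z0)) \<le> 1 / 2"
            if "z \<in> cball a s0" for z
            using half[OF that] unfolding h_def hpair_pt[of "Suc m" b z] .
          show "chd (pt (fst (hpair b (Suc m) z)) (snd (hpair b (Suc m) z))) ((f ^^ Suc m) (chart b z0)) \<le> \<eta>"
            if "cmod (z - a) = s0" for z
            using circ[OF that, of "Suc m"] unfolding h_def hpair_pt[of "Suc m" b z] .
        qed
      qed
      have lip: "chd (h m z) (h m z') \<le> 2 / s0 * cmod (z - z')"
        if "z \<in> cball a (s0 / 2)" "z' \<in> cball a (s0 / 2)" for m z z'
        unfolding h_def hpair_pt
      proof (rule spherical_schwarz[OF _ _ hpair_nz s0(1) _ that])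
        show "(\<lambda>z. fst (hpair b m z)) holomorphic_on UNIV" "(\<lambda>z. snd (hpair b m z)) holomorphic_on UNIV"
          using hpair_holomorphic by blast+
        show "chd (pt (fst (hpair b m z)) (snd (hpair b m z))) (h m z0) \<le> 1 / 2" if "z \<in> cball a s0" for z
          using disc[OF that, of m] \<eta>(2) unfolding h_def hpair_pt[of m b z] by linarith
      qed
      define e where "e = s0 / 2"
      have e: "0 < e" "e \<le> 1" using s0 \<eta> by (auto simp: e_def)
      have "x \<in> fatou_set f"
      proof (rule fatou_if_equilipschitz)
        show "0 < e / ((2 + cmod a) * (1 + cmod a))"
          using e by (intro divide_pos_pos mult_pos_pos add_pos_nonneg) auto
        show "0 < 2 / s0 * 9" using s0 by simp
        fix n y y'
        assume "chd x y < e / ((2 + cmod a) * (1 + cmod a))" "chd x y' < e / ((2 + cmod a) * (1 + cmod a))"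
        then obtain z z' where z: "y = chart b z" "cmod (z - a) < e" "y' = chart b z'" "cmod (z' - a) < e"
          using chart_near[OF e, of y b a] chart_near[OF e, of y' b a] by (metis a(1) chd_commute)
        have "cmod z \<le> 2" "cmod z' \<le> 2"
          using z e a norm_triangle_ineq[of "z - a" a] norm_triangle_ineq[of "z' - a" a] by auto
        then have zz: "cmod (z - z') \<le> 9 * chd y y'" using cmod_le_chd_chart[of z 2 z' b] z by simp
        have "chd (h n z) (h n z') \<le> 2 / s0 * cmod (z - z')"
          using z by (intro lip) (auto simp: e_def dist_norm norm_minus_commute)
        also have "\<dots> \<le> 2 / s0 * (9 * chd y y')" using zz s0 by (intro mult_left_mono) auto
        finally show "chd ((f ^^ n) y) ((f ^^ n) y') \<le> 2 / s0 * 9 * chd y y'" using z by (simp add: h_def)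
      qed
      then show False using x by (simp add: julia_set_def)
    qed
    then obtain z where z: "s * exp (- (2 * R)) \<le> cmod (z - a)" "cmod (z - a) \<le> s" "chart b z \<in> julia_set f"
      unfolding s0(2,3) by blast
    have "cmod z \<le> 2" using z(2) s \<eta> a norm_triangle_ineq[of "z - a" a] by simp
    then have "cmod (z - a) \<le> 9 * chd x (chart b z)"
      using cmod_le_chd_chart[of z 2 a b] a by (simp add: chd_commute)
    then have "s * exp (- (2 * R)) \<le> 9 * chd x (chart b z)" using z(1) by linarith
    then have "s / \<kappa> \<le> chd x (chart b z)" by (simp add: \<kappa>_def exp_minus field_simps)
    moreover have "chd x (chart b z) \<le> s" using chd_chart_le[of b a z] z(2) a by (simp add: norm_minus_commute)
    ultimately show "\<exists>x'\<in>julia_set f. s / \<kappa> \<le> chd x x' \<and> chd x x' \<le> s" using z(3) by blast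
  qed (use \<eta> in auto)
qed

end

section \<open>Points with large derivative along the orbit\<close>

context rational
begin

text \<open>Each step moves the point at the first time its orbit comes too close to some \<open>c\<close>. After the
  move its orbit stays off \<open>c\<close> at that time by uniform perfectness and at all other times
  because \<open>c\<close> does not return early, so \<open>c\<close> joins the set \<open>S\<close> of critical points already
  dealt with.\<close>

lemma avoid_critical_points:
  assumes \<theta>: "0 < \<theta>" "\<theta> \<le> 1"
  shows "\<exists>q>0. q \<le> 1 \<and> (\<forall>n\<ge>1. \<forall>x\<in>julia_set f. \<exists>y\<in>julia_set f. \<exists>S\<subseteq>crit_julia.
    min k (card crit_julia) \<le> card S \<and> chd x y \<le> real k * \<theta> ^ n \<and>
    (\<forall>c\<in>S. \<forall>l<n. q ^ n \<le> chd ((f ^^ l) y) c))"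
proof (induction k)
  case 0
  show ?case by (intro exI[of _ 1] conjI allI impI ballI) (auto intro!: bexI exI[of _ "{}"])
next
  case (Suc k)
  then obtain q0 where q0: "0 < q0" "q0 \<le> 1" and IH: "\<And>n x. 1 \<le> n \<Longrightarrow> x \<in> julia_set f \<Longrightarrow>
    \<exists>y\<in>julia_set f. \<exists>S\<subseteq>crit_julia. min k (card crit_julia) \<le> card S \<and> chd x y \<le> real k * \<theta> ^ n \<and>
      (\<forall>c\<in>S. \<forall>l<n. q0 ^ n \<le> chd ((f ^^ l) y) c)" by auto
  obtain L where L: "L \<ge> 1" "\<And>x y. chd (f x) (f y) \<le> L * chd x y" using lipschitz by metis
  obtain B where B: "1 \<le> B"
    "\<And>c n R i j y. c \<in> crit_julia \<Longrightarrow> 0 < R \<Longrightarrow> B ^ n * R < 1 \<Longrightarrow> i < j \<Longrightarrow> j \<le> n \<Longrightarrow>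
      chd ((f ^^ i) y) c \<le> R \<Longrightarrow> chd ((f ^^ j) y) c \<le> R \<Longrightarrow> False"
    using no_early_return_julia by metis
  obtain \<kappa> s0 where \<kappa>: "1 \<le> \<kappa>" "0 < s0" "s0 \<le> 1"
    "\<And>x s. x \<in> julia_set f \<Longrightarrow> 0 < s \<Longrightarrow> s \<le> s0 \<Longrightarrow> \<exists>x'\<in>julia_set f. s / \<kappa> \<le> chd x x' \<and> chd x x' \<le> s"
    using uniformly_perfect_julia by metis
  obtain E N where E: "0 < E" "E \<le> 1"
    "\<And>y y' n \<rho>. y \<in> julia_set f \<Longrightarrow> 0 < \<rho> \<Longrightarrow> \<rho> \<le> 1 \<Longrightarrow>
      (\<And>c l. c \<in> crit_julia \<Longrightarrow> l < n \<Longrightarrow> \<rho> \<le> chd ((f ^^ l) y) c) \<Longrightarrow>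
      chd y y' \<le> E ^ Suc n * \<rho> ^ N \<Longrightarrow> E ^ n * \<rho> ^ N * chd y y' \<le> chd ((f ^^ n) y) ((f ^^ n) y')"
  proof (rule orbit_expansion, goal_cases)
    case (1 E N)
    show ?case by (rule 1(1)) (fact 1)+
  qed
  \<comment> \<open>q \<le> q0 keeps the new threshold \<rho> = q^n below the one already reached on
    S; the bound 1 / (4 B) makes 2 \<rho> too small for two visits to c within n steps.\<close>
  define q where "q = min q0 (1 / (4 * B))"
  have q: "0 < q" "q \<le> q0" "q * B \<le> 1 / 4" "q \<le> 1"
  proof -
    show "0 < q" "q \<le> q0" "q \<le> 1" using q0 B by (auto simp: q_def)
    have "q * B \<le> 1 / (4 * B) * B" using B by (intro mult_right_mono) (auto simp: q_def)
    then show "q * B \<le> 1 / 4" using B by simp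
  qed
  \<comment> \<open>A move will have size \<sigma>^n. The four factors, all at most 1, in turn keep
    it below \<theta>^n, in the range of uniform perfectness, small enough that the orbits stay
    within \<rho> / 2 of each other, and within the radius of \<open>orbit_expansion\<close>; there
    \<open>E\<^sup>2\<close> covers the exponent Suc j, which is at most 2 n.\<close>
  define \<sigma> where "\<sigma> = \<theta> * s0 * (q / (2 * L)) * (E\<^sup>2 * q ^ N)"
  have fac: "0 < q / (2 * L)" "q / (2 * L) \<le> 1" "0 < E\<^sup>2 * q ^ N" "E\<^sup>2 * q ^ N \<le> 1"
    using q L E by (auto simp: divide_le_eq intro!: mult_le_one power_le_one)
  have four: "a * b * c * e \<le> a \<and> a * b * c * e \<le> b \<and> a * b * c * e \<le> c \<and> a * b * c * e \<le> e"
    if "0 < a" "a \<le> 1" "0 < b" "b \<le> 1" "0 < c" "c \<le> 1" "0 < e" "e \<le> 1" for a b c e :: real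
  proof -
    have "a * b \<le> a" "a * b \<le> b" using that by (simp_all add: mult_left_le mult_left_le_one_le)
    moreover have "a * b * c \<le> a * b" "a * b * c \<le> c"
      using that by (simp_all add: mult_left_le mult_left_le_one_le mult_le_one)
    moreover have "a * b * c * e \<le> a * b * c" "a * b * c * e \<le> e"
      using that by (simp_all add: mult_left_le mult_left_le_one_le mult_le_one)
    ultimately show ?thesis by linarith
  qed
  have \<sigma>: "0 < \<sigma>" "\<sigma> \<le> \<theta>" "\<sigma> \<le> s0" "\<sigma> \<le> q / (2 * L)" "\<sigma> \<le> E\<^sup>2 * q ^ N"
  proof -
    show "0 < \<sigma>" unfolding \<sigma>_def by (intro mult_pos_pos \<theta>(1) \<kappa>(2) fac(1,3))
    show "\<sigma> \<le> \<theta>" "\<sigma> \<le> s0" "\<sigma> \<le> q / (2 * L)" "\<sigma> \<le> E\<^sup>2 * q ^ N"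
      using four[OF \<theta> \<kappa>(2,3) fac] unfolding \<sigma>_def by blast+
  qed
  define q1 where "q1 = min (E * q ^ N * \<sigma> / (2 * \<kappa>)) (q / 2)"
  have q1: "0 < q1" "q1 \<le> E * q ^ N * \<sigma> / (2 * \<kappa>)" "q1 \<le> q / 2" "q1 \<le> 1"
    using E q \<sigma> \<kappa> by (auto simp: q1_def min_le_iff_disj)
  show ?case
  proof (intro exI[of _ q1] conjI allI impI ballI q1(1,4))
    fix n :: nat and x assume n: "1 \<le> n" and x: "x \<in> julia_set f"
    obtain y S where y: "y \<in> julia_set f" and S: "S \<subseteq> crit_julia" "min k (card crit_julia) \<le> card S"
      and xy: "chd x y \<le> real k * \<theta> ^ n"
      and off: "\<And>c l. c \<in> S \<Longrightarrow> l < n \<Longrightarrow> q0 ^ n \<le> chd ((f ^^ l) y) c"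
      using IH[OF n x] by blast
    define \<rho> where "\<rho> = q ^ n"
    have \<rho>: "0 < \<rho>" "\<rho> \<le> 1" "\<rho> \<le> q0 ^ n" using q by (auto simp: \<rho>_def power_le_one intro: power_mono)
    have half: "(1 / 2) ^ n \<le> (1 / 2 :: real)" using power_decreasing[OF n, of "1 / 2 :: real"] by simp
    have q1\<rho>: "q1 ^ n \<le> \<rho> / 2"
    proof -
      have "q1 ^ n \<le> (q / 2) ^ n" using q1 by (intro power_mono) auto
      also have "\<dots> = \<rho> * (1 / 2) ^ n" by (simp add: \<rho>_def power_divide)
      also have "\<dots> \<le> \<rho> * (1 / 2)" using half \<rho> by (intro mult_left_mono) auto
      finally show ?thesis by simp
    qed
    show "\<exists>y\<in>julia_set f. \<exists>S\<subseteq>crit_julia. min (Suc k) (card crit_julia) \<le> card S \<and>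
      chd x y \<le> real (Suc k) * \<theta> ^ n \<and> (\<forall>c\<in>S. \<forall>l<n. q1 ^ n \<le> chd ((f ^^ l) y) c)"
    proof (cases "\<forall>c\<in>crit_julia. \<forall>l<n. \<rho> \<le> chd ((f ^^ l) y) c")
      case True
      then have "\<forall>c\<in>crit_julia. \<forall>l<n. q1 ^ n \<le> chd ((f ^^ l) y) c" using q1\<rho> \<rho> by force
      moreover have "chd x y \<le> real (Suc k) * \<theta> ^ n" using xy \<theta> by (simp add: algebra_simps add_increasing)
      ultimately show ?thesis using y by (intro bexI[of _ y] exI[of _ crit_julia]) auto
    next
      case False
      define bad where "bad l \<longleftrightarrow> l < n \<and> (\<exists>c\<in>crit_julia. chd ((f ^^ l) y) c < \<rho>)" for l
      have "\<exists>l. bad l" using False by (auto simp: bad_def not_le)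
      define j where "j = (LEAST l. bad l)"
      have "bad j" unfolding j_def by (rule LeastI_ex) fact
      then obtain c where j: "j < n" and c: "c \<in> crit_julia" "chd ((f ^^ j) y) c < \<rho>" by (auto simp: bad_def)
      have before: "\<rho> \<le> chd ((f ^^ l) y) c" if "c \<in> crit_julia" "l < j" for c l
        using not_less_Least[of l bad] that j by (force simp: bad_def j_def)
      \<comment> \<open>On S the orbit of y keeps a distance of at least q0^n, hence of at least
        \<rho>.\<close>
      have cS: "c \<notin> S" using off[of c j] j c \<rho> by auto
      define s where "s = \<sigma> ^ n"
      have s: "0 < s" "s \<le> \<theta> ^ n" using \<sigma> by (auto simp: s_def intro: power_mono)
      have ss0: "s \<le> s0"
        using \<sigma> \<kappa>(3) power_decreasing[OF n, of \<sigma>] by (simp add: s_def)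
      have Ls: "L ^ n * s \<le> \<rho> / 2"
      proof -
        have "L ^ n * s = (L * \<sigma>) ^ n" by (simp add: s_def power_mult_distrib)
        also have "\<dots> \<le> (q / 2) ^ n" using \<sigma> L by (intro power_mono) (auto simp: field_simps)
        also have "\<dots> = \<rho> * (1 / 2) ^ n" by (simp add: \<rho>_def power_divide)
        also have "\<dots> \<le> \<rho> * (1 / 2)" using half \<rho> by (intro mult_left_mono) auto
        finally show ?thesis by simp
      qed
      obtain y' where y': "y' \<in> julia_set f" "s / \<kappa> \<le> chd y y'" "chd y y' \<le> s"
        using \<kappa>(4)[OF y s(1) ss0] by blast
      \<comment> \<open>Before time j the orbit of y is at distance at least \<rho> from
        \<open>crit_julia\<close>, so \<open>orbit_expansion\<close> applies up to time j and keeps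
        the two images exponentially separated.\<close>
      have "E ^ j * \<rho> ^ N * chd y y' \<le> chd ((f ^^ j) y) ((f ^^ j) y')"
      proof (rule E(3)[OF y \<rho>(1,2) before])
        have "s \<le> (E\<^sup>2 * q ^ N) ^ n" unfolding s_def using \<sigma> by (intro power_mono) auto
        also have "\<dots> = E ^ (2 * n) * \<rho> ^ N"
          by (simp add: power_mult_distrib \<rho>_def power_mult[symmetric] mult.commute)
        also have "\<dots> \<le> E ^ Suc j * \<rho> ^ N"
          using E \<rho> j n by (intro mult_right_mono power_decreasing) auto
        finally show "chd y y' \<le> E ^ Suc j * \<rho> ^ N" using y' by linarith
      qed auto
      moreover have "(E * q ^ N * \<sigma> / \<kappa>) ^ n \<le> E ^ j * \<rho> ^ N * chd y y'"
      proof -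
        have "(E * q ^ N * \<sigma> / \<kappa>) ^ n = E ^ n * \<rho> ^ N * (s / \<kappa> ^ n)"
          by (simp add: power_mult_distrib power_divide \<rho>_def s_def power_mult[symmetric] mult.commute)
        also have "\<dots> \<le> E ^ j * \<rho> ^ N * (s / \<kappa>)"
          using E j \<rho> s \<kappa>(1) power_increasing[OF n \<kappa>(1)]
          by (intro mult_mono power_decreasing divide_left_mono) auto
        also have "\<dots> \<le> E ^ j * \<rho> ^ N * chd y y'" using y' E \<rho> by (intro mult_left_mono) auto
        finally show ?thesis .
      qed
      ultimately have "(E * q ^ N * \<sigma> / \<kappa>) ^ n \<le> chd ((f ^^ j) y) c + chd ((f ^^ j) y') c"
        using chd_triangle[of "(f ^^ j) y" "(f ^^ j) y'" c] by (simp add: chd_commute)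
      moreover have "q1 ^ n \<le> (E * q ^ N * \<sigma> / \<kappa>) ^ n / 2"
      proof -
        have "q1 ^ n \<le> (E * q ^ N * \<sigma> / \<kappa> / 2) ^ n" using q1 by (intro power_mono) auto
        also have "\<dots> = (E * q ^ N * \<sigma> / \<kappa>) ^ n * (1 / 2) ^ n" by (simp add: power_divide)
        also have "\<dots> \<le> (E * q ^ N * \<sigma> / \<kappa>) ^ n * (1 / 2)"
          using half E q \<sigma> \<kappa> by (intro mult_left_mono) auto
        finally show ?thesis by simp
      qed
      \<comment> \<open>The two images at time j cannot both be close to c. Either point may be the
        good one, possibly y itself.\<close>
      ultimately have "q1 ^ n \<le> chd ((f ^^ j) y) c \<or> q1 ^ n \<le> chd ((f ^^ j) y') c" by linarith
      then obtain z where z: "z = y \<or> z = y'" "q1 ^ n \<le> chd ((f ^^ j) z) c" by blast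
      have zJ: "z \<in> julia_set f" and yz: "chd y z \<le> s" using z y y' s by auto
      have track: "chd ((f ^^ l) y) ((f ^^ l) z) \<le> \<rho> / 2" if "l < n" for l
      proof -
        have "chd ((f ^^ l) y) ((f ^^ l) z) \<le> L ^ l * chd y z" by (rule lipschitz_funpow[OF L])
        also have "\<dots> \<le> L ^ n * s" using L yz that s by (intro mult_mono power_increasing) auto
        finally show ?thesis using Ls by simp
      qed
      \<comment> \<open>At time j the orbit of z is within 2 \<rho> of c because it follows that of
        y; a second such time would be an early return.\<close>
      have offc: "q1 ^ n \<le> chd ((f ^^ l) z) c" if "l < n" for l
      proof (rule ccontr)
        assume small: "\<not> q1 ^ n \<le> chd ((f ^^ l) z) c"
        then have "l \<noteq> j" using z by auto
        have l2: "chd ((f ^^ l) z) c \<le> 2 * \<rho>" using small q1\<rho> \<rho> by linarith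
        have j2: "chd ((f ^^ j) z) c \<le> 2 * \<rho>"
          using chd_triangle[of "(f ^^ j) z" c "(f ^^ j) y"] track[OF j] c(2) \<rho> by (simp add: chd_commute)
        have "B ^ n * \<rho> = (q * B) ^ n" by (simp add: \<rho>_def power_mult_distrib)
        also have "\<dots> \<le> (1 / 4) ^ n" using q B by (intro power_mono) auto
        also have "\<dots> \<le> 1 / 4" using power_decreasing[OF n, of "1 / 4 :: real"] by simp
        finally have "B ^ n * (2 * \<rho>) < 1" by simp
        moreover have "0 < 2 * \<rho>" using \<rho> by simp
        moreover have "l < j \<or> j < l" using \<open>l \<noteq> j\<close> by auto
        ultimately show False using B(2)[OF c(1), of "2 * \<rho>" n l j z] B(2)[OF c(1), of "2 * \<rho>" n j l z]
            l2 j2 j that by auto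
      qed
      have offS: "q1 ^ n \<le> chd ((f ^^ l) z) c'" if "c' \<in> S" "l < n" for c' l
        using off[OF that] track[OF that(2)] \<rho>(3) q1\<rho> chd_triangle[of "(f ^^ l) y" c' "(f ^^ l) z"] by linarith
      have "chd x z \<le> real (Suc k) * \<theta> ^ n"
        using chd_triangle[of x z y] xy yz s by (simp add: algebra_simps)
      moreover have "finite S" using S finite_crit_julia finite_subset by blast
      then have "min (Suc k) (card crit_julia) \<le> card (insert c S)" using S cS by simp
      ultimately show ?thesis using zJ c S offc offS
        by (intro bexI[of _ z] exI[of _ "insert c S"]) auto
    qed
  qed
qed

text \<open>The spherical derivative is the limit of quotients of chordal distances, as
  \<open>chd_chart\<close> carries the same density factors, so a lower bound for these quotients
  near y passes to the limit. The charts \<open>b\<close> and \<open>b'\<close> are the ones that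
  \<open>flip\<close> selects in \<open>sph_deriv\<close>.\<close>

lemma sph_deriv_ge:
  assumes \<delta>: "0 < \<delta>" and low: "\<And>y'. chd y y' < \<delta> \<Longrightarrow> \<Lambda> * chd y y' \<le> chd ((f ^^ n) y) ((f ^^ n) y')"
  shows "\<Lambda> \<le> sph_deriv (f ^^ n) y"
proof -
  define b where "b = (y \<noteq> Infty)"
  define a where "a = affine_coord (flip y y)"
  have flip: "flip y (Fin z) = chart b z" for z
    by (simp add: flip_def b_def chart_True chart_False)
  have ya: "chart b a = y"
    by (cases y) (simp_all add: a_def b_def flip_def chart_True chart_False)
  define P Q where "P z = fst (hpair b n z)" and "Q z = snd (hpair b n z)" for z
  have PQ: "(f ^^ n) (chart b z) = pt (P z) (Q z)" "P z \<noteq> 0 \<or> Q z \<noteq> 0" for z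
    using hpair_nz[of b n z] by (simp_all add: hpair_pt P_def Q_def)
  have hol: "P holomorphic_on UNIV" "Q holomorphic_on UNIV"
    using hpair_holomorphic[of b n UNIV] by (simp_all add: P_def[abs_def] Q_def[abs_def])
  define b' where "b' = (Q a \<noteq> 0)"
  define A D where "A = (if b' then P else Q)" and "D = (if b' then Q else P)"
  have Da: "D a \<noteq> 0" using PQ(2)[of a] by (auto simp: D_def b'_def)
  have fy: "(f ^^ n) y = pt (P a) (Q a)" using PQ(1)[of a] ya by simp
  have b'eq: "((f ^^ n) y = Infty) \<longleftrightarrow> \<not> b'" by (simp add: fy pt_def b'_def)
  define g where "g z = A z / D z" for z
  have g: "affine_coord (flip ((f ^^ n) y) ((f ^^ n) (flip y (Fin z)))) = g z" for z
    unfolding flip flip_def[of "(f ^^ n) y"] b'eq PQ(1) g_def A_def D_def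
    by (cases b') (auto simp: pt_def)
  have sd: "sph_deriv (f ^^ n) y = cmod (deriv g a) * (1 + (cmod a)\<^sup>2) / (1 + (cmod (g a))\<^sup>2)"
    unfolding sph_deriv_def Let_def g a_def[symmetric] by simp
  have "open {z. D z \<noteq> 0}"
    using hol by (intro open_Collect_neq continuous_on_const) (auto simp: D_def holomorphic_on_imp_continuous_on)
  moreover have hol_g: "g holomorphic_on {z. D z \<noteq> 0}"
    unfolding g_def[abs_def]
    by (intro holomorphic_intros) (auto simp: A_def D_def intro: hol[THEN holomorphic_on_subset])
  ultimately have der: "(g has_field_derivative deriv g a) (at a)"
    using Da by (intro holomorphic_derivI) auto
  have lim: "((\<lambda>z. cmod ((g z - g a) / (z - a))) \<longlongrightarrow> cmod (deriv g a)) (at a)"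
    using der by (intro tendsto_norm) (simp add: has_field_derivative_iff)
  have gcont: "(g \<longlongrightarrow> g a) (at a)"
    using der DERIV_isCont isCont_def by blast
  define w where "w z = sqrt (1 + (cmod z)\<^sup>2)" for z
  have w: "w z > 0" "(w z)\<^sup>2 = 1 + (cmod z)\<^sup>2" for z using sqrt_pos'[of z] by (simp_all add: w_def)
  have lim2: "((\<lambda>z. \<Lambda> * (w (g z) * w (g a)) / (w z * w a)) \<longlongrightarrow> \<Lambda> * (w (g a) * w (g a)) / (w a * w a)) (at a)"
    unfolding w_def using w(1)[of a] gcont
    by (intro tendsto_intros) (auto simp: w_def)
  have "\<forall>\<^sub>F z in at a. D z \<noteq> 0"
    using \<open>open {z. D z \<noteq> 0}\<close> Da eventually_at_topological by (metis (mono_tags, lifting) mem_Collect_eq)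
  moreover have "\<forall>\<^sub>F z in at a. dist z a < \<delta>" using \<delta> by (auto simp: eventually_at)
  moreover have "\<forall>\<^sub>F z in at a. z \<noteq> a" by (simp add: eventually_at_filter)
  ultimately have "\<forall>\<^sub>F z in at a. \<Lambda> * (w (g z) * w (g a)) / (w z * w a) \<le> cmod ((g z - g a) / (z - a))"
  proof eventually_elim
    case (elim z)
    have gz: "(f ^^ n) (chart b z) = chart b' (g z)" if "D z \<noteq> 0" for z
      unfolding PQ(1) using that by (cases b') (simp_all add: chart_def pt_def g_def A_def D_def)
    have "chd y (chart b z) < \<delta>"
      using chd_chart_le[of b a z] elim(2) by (simp add: ya dist_norm norm_minus_commute)
    from low[OF this] have "\<Lambda> * chd (chart b a) (chart b z) \<le> chd (chart b' (g a)) (chart b' (g z))"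
      using gz[OF Da] gz[OF elim(1)] by (simp add: ya)
    then have "\<Lambda> * (cmod (z - a) / (w a * w z)) \<le> cmod (g z - g a) / (w (g a) * w (g z))"
      by (simp add: chd_chart w_def norm_minus_commute)
    moreover have "0 < w a * w z" "0 < w (g a) * w (g z)" "0 < cmod (z - a)" using w elim(3) by auto
    ultimately show ?case by (simp add: norm_divide field_simps)
  qed
  then have "\<Lambda> * (w (g a) * w (g a)) / (w a * w a) \<le> cmod (deriv g a)"
    by (rule tendsto_le[OF _ lim lim2, rotated]) simp
  then have "\<Lambda> * (w (g a))\<^sup>2 / (w a)\<^sup>2 \<le> cmod (deriv g a)" by (simp add: power2_eq_square)
  then show ?thesis
    unfolding sd w(2)[symmetric] using w(1)[of a] w(1)[of "g a"] by (simp add: field_simps)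
qed

text \<open>After as many stages as \<open>crit_julia\<close> has points, the set S of
  \<open>avoid_critical_points\<close> has full cardinality and is all of \<open>crit_julia\<close>;
  \<open>orbit_expansion\<close> with \<rho> = q^n then yields \<mu> = E q^N.\<close>

lemma large_derivative_nearby:
  assumes \<theta>: "0 < \<theta>" "\<theta> \<le> 1"
  obtains \<mu> K where "0 < \<mu>" "0 \<le> K"
    "\<And>n x. 1 \<le> n \<Longrightarrow> x \<in> julia_set f \<Longrightarrow> \<exists>y\<in>julia_set f. chd x y \<le> K * \<theta> ^ n \<and> \<mu> ^ n \<le> sph_deriv (f ^^ n) y"
proof -
  obtain E N where E: "0 < E" "E \<le> 1" 
    "\<And>y y' n \<rho>. y \<in> julia_set f \<Longrightarrow> 0 < \<rho> \<Longrightarrow> \<rho> \<le> 1 \<Longrightarrow>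
      (\<And>c l. c \<in> crit_julia \<Longrightarrow> l < n \<Longrightarrow> \<rho> \<le> chd ((f ^^ l) y) c) \<Longrightarrow>
      chd y y' \<le> E ^ Suc n * \<rho> ^ N \<Longrightarrow> E ^ n * \<rho> ^ N * chd y y' \<le> chd ((f ^^ n) y) ((f ^^ n) y')"
  proof (rule orbit_expansion, goal_cases)
    case (1 E N)
    show ?case by (rule 1(1)) (fact 1)+
  qed
  define k where "k = card crit_julia"
  obtain q where q: "0 < q" "q \<le> 1" and sel: "\<And>n x. 1 \<le> n \<Longrightarrow> x \<in> julia_set f \<Longrightarrow>
    \<exists>y\<in>julia_set f. \<exists>S\<subseteq>crit_julia. min k (card crit_julia) \<le> card S \<and> chd x y \<le> real k * \<theta> ^ n \<and>
      (\<forall>c\<in>S. \<forall>l<n. q ^ n \<le> chd ((f ^^ l) y) c)"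
    using avoid_critical_points[OF \<theta>, of k] by blast
  show thesis
  proof (rule that[of "E * q ^ N" "real k"])
    fix n :: nat and x assume "1 \<le> n" "x \<in> julia_set f"
    then obtain y S where y: "y \<in> julia_set f" "chd x y \<le> real k * \<theta> ^ n" and S: "S \<subseteq> crit_julia" "k \<le> card S"
      and off: "\<forall>c\<in>S. \<forall>l<n. q ^ n \<le> chd ((f ^^ l) y) c"
      using sel[of n x] by (auto simp: k_def)
    have "card S = card crit_julia" using S card_mono[OF finite_crit_julia S(1)] by (simp add: k_def)
    then have "S = crit_julia" using card_subset_eq[OF finite_crit_julia S(1)] by simp
    then have off': "q ^ n \<le> chd ((f ^^ l) y) c" if "c \<in> crit_julia" "l < n" for c l using off that by blast
    have "(E * q ^ N) ^ n \<le> sph_deriv (f ^^ n) y"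
    proof (rule sph_deriv_ge)
      show "0 < E ^ Suc n * (q ^ n) ^ N" using E q by simp
      fix y' assume "chd y y' < E ^ Suc n * (q ^ n) ^ N"
      then have "E ^ n * (q ^ n) ^ N * chd y y' \<le> chd ((f ^^ n) y) ((f ^^ n) y')"
        using q by (intro E(3)[OF y(1)] off') (auto intro: power_le_one)
      then show "(E * q ^ N) ^ n * chd y y' \<le> chd ((f ^^ n) y) ((f ^^ n) y')"
        by (simp add: power_mult_distrib power_mult[symmetric] mult.commute[of N])
    qed
    then show "\<exists>y\<in>julia_set f. chd x y \<le> real k * \<theta> ^ n \<and> (E * q ^ N) ^ n \<le> sph_deriv (f ^^ n) y"
      using y by blast
  qed (use E q in auto)
qed

end

section \<open>Counting and conclusion\<close>

text \<open>The sphere is cut by a grid of cells of side r in R^3, with one point of J chosen in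
  each cell that meets J. With m the ceiling of 1 / r there are 2 m + 1 \<le> 5 / r cells in each
  direction, and two points of a cell have chordal distance at most 3 r / 2.\<close>

lemma finite_net:
  fixes J :: "riemann_sphere set"
  assumes r: "0 < r" "r \<le> 1"
  obtains X where "X \<subseteq> J" "finite X" "real (card X) \<le> 125 / r ^ 3" "\<And>z. z \<in> J \<Longrightarrow> \<exists>x\<in>X. chd z x \<le> 2 * r"
proof -
  define cell where "cell z = (case stereo z of (w, h) \<Rightarrow> (\<lfloor>Re w / r\<rfloor>, \<lfloor>Im w / r\<rfloor>, \<lfloor>h / r\<rfloor>))" for z
  define m where "m = \<lceil>1 / r\<rceil>"
  define I where "I = {-m..m} \<times> {-m..m} \<times> {-m..m}"
  have bd: "\<lfloor>u / r\<rfloor> \<in> {-m..m}" if "\<bar>u\<bar> \<le> 1" for u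
  proof -
    have "u / r \<le> 1 / r" "- (1 / r) \<le> u / r" using that r by (auto simp: abs_le_iff field_simps)
    moreover have "1 / r \<le> of_int m" by (simp add: m_def)
    ultimately have "u / r \<le> of_int m" "of_int (- m) \<le> u / r" by auto
    then show ?thesis unfolding atLeastAtMost_iff by (metis floor_le_iff le_floor_iff floor_mono floor_of_int)
  qed
  have cellI: "cell z \<in> I" for z
  proof -
    obtain w h where wh: "stereo z = (w, h)" by (cases "stereo z")
    have "norm (w, h) = 1" using norm_stereo[of z] by (simp add: wh)
    then have "cmod w \<le> 1" "\<bar>h\<bar> \<le> 1" using norm_fst_le[of w h] norm_snd_le[of h w] by auto
    then have "\<bar>Re w\<bar> \<le> 1" "\<bar>Im w\<bar> \<le> 1" "\<bar>h\<bar> \<le> 1"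
      using abs_Re_le_cmod[of w] abs_Im_le_cmod[of w] by linarith+
    then show ?thesis by (simp only: cell_def wh prod.case I_def mem_Times_iff fst_conv snd_conv bd simp_thms)
  qed
  have finI: "finite I" by (simp add: I_def)
  have near: "chd z x \<le> 2 * r" if "cell z = cell x" for z x
  proof -
    obtain w h where wh: "stereo z = (w, h)" by (cases "stereo z")
    obtain w' h' where wh': "stereo x = (w', h')" by (cases "stereo x")
    have fl: "\<bar>u - v\<bar> \<le> r" if "\<lfloor>u / r\<rfloor> = \<lfloor>v / r\<rfloor>" for u v
    proof -
      have "\<bar>u / r - v / r\<bar> \<le> 1" using that by linarith
      then show ?thesis using r by (simp add: diff_divide_distrib[symmetric] abs_divide divide_le_eq)
    qed
    have "\<bar>Re w - Re w'\<bar> \<le> r" "\<bar>Im w - Im w'\<bar> \<le> r" "\<bar>h - h'\<bar> \<le> r"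
      using that by (auto simp: cell_def wh wh' intro: fl)
    moreover have "norm (stereo z - stereo x) \<le> cmod (w - w') + \<bar>h - h'\<bar>"
      using norm_Pair_le[of "w - w'" "h - h'"] by (simp add: wh wh')
    moreover have "cmod (w - w') \<le> \<bar>Re w - Re w'\<bar> + \<bar>Im w - Im w'\<bar>"
      using cmod_le[of "w - w'"] by simp
    ultimately show ?thesis using r unfolding chd_def by linarith
  qed
  define rep where "rep i = (SOME z. z \<in> J \<and> cell z = i)" for i
  define X where "X = rep ` (cell ` J)"
  have rep: "rep (cell z) \<in> J" "cell (rep (cell z)) = cell z" if "z \<in> J" for z
    using someI_ex[of "\<lambda>x. x \<in> J \<and> cell x = cell z"] that by (auto simp: rep_def)
  have finc: "finite (cell ` J)" using finI cellI by (meson finite_subset image_subsetI)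
  have "card X \<le> card (cell ` J)" unfolding X_def by (rule card_image_le[OF finc])
  also have "\<dots> \<le> card I" using finI cellI by (intro card_mono) auto
  also have "card I = nat (2 * m + 1) ^ 3" by (simp add: I_def card_cartesian_product power3_eq_cube)
  finally have "real (card X) \<le> real (nat (2 * m + 1)) ^ 3" by (metis of_nat_le_iff of_nat_power)
  also have "\<dots> \<le> (5 / r) ^ 3"
  proof (rule power_mono)
    have "0 < 1 / r" using r by simp
    then have "0 \<le> m" unfolding m_def by linarith
    moreover have "of_int m \<le> 1 / r + 1" by (simp add: m_def)
    moreover have "1 \<le> 1 / r" using r by simp
    moreover have "5 / r = 5 * (1 / r)" by simp
    ultimately show "real (nat (2 * m + 1)) \<le> 5 / r" by (simp only: of_nat_nat)
  qed simp
  finally have "real (card X) \<le> 125 / r ^ 3" by (simp add: power_divide)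
  moreover have "X \<subseteq> J" "finite X" using rep finc by (auto simp: X_def)
  moreover have "\<exists>x\<in>X. chd z x \<le> 2 * r" if "z \<in> J" for z
    using rep(2)[OF that] that by (intro bexI[of _ "rep (cell z)"] near) (auto simp: X_def)
  ultimately show thesis using that by blast
qed

context rational
begin

lemma spanning_sum_le:
  assumes t: "0 < t"
  obtains G where "1 \<le> G"
    "\<And>\<epsilon>. 0 < \<epsilon> \<Longrightarrow> \<forall>\<^sub>F n in sequentially. spanning_sum f t n \<epsilon> \<le> ennreal (125 * G ^ n)"
proof -
  obtain L where L: "L \<ge> 1" "\<And>x y. chd (f x) (f y) \<le> L * chd x y" using lipschitz by metis
  define \<theta> where "\<theta> = 1 / (2 * L)"
  have \<theta>: "0 < \<theta>" "\<theta> \<le> 1" using L by (auto simp: \<theta>_def)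
  obtain \<mu> K where \<mu>: "0 < \<mu>" "0 \<le> K"
    "\<And>n x. 1 \<le> n \<Longrightarrow> x \<in> julia_set f \<Longrightarrow> \<exists>y\<in>julia_set f. chd x y \<le> K * \<theta> ^ n \<and> \<mu> ^ n \<le> sph_deriv (f ^^ n) y"
    using large_derivative_nearby[OF \<theta>] by metis
  \<comment> \<open>\<open>1 / \<theta> ^ 3\<close> is the growth rate of the cardinality of the
    nets, \<open>\<mu> powr (- t)\<close> that of the bound for a single summand.\<close>
  define G where "G = max 1 (1 / \<theta> ^ 3 * \<mu> powr (- t))"
  show thesis
  proof (rule that[of G])
    show "1 \<le> G" by (simp add: G_def)
    fix \<epsilon> :: real assume \<epsilon>: "0 < \<epsilon>"
    \<comment> \<open>The only influence of \<epsilon>: it decides from which n on the moved net is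
      spanning. The 4 compares the two metrics, and 2 + K adds the mesh of the net to the
      displacement.\<close>
    have "(\<lambda>n. 4 * (2 + K) * (1 / 2) ^ n) \<longlonglongrightarrow> 4 * (2 + K) * 0"
      by (intro tendsto_mult tendsto_const LIMSEQ_realpow_zero) auto
    then have "\<forall>\<^sub>F n in sequentially. 4 * (2 + K) * (1 / 2) ^ n < \<epsilon>"
      using \<epsilon> by (intro order_tendstoD) auto
    moreover have "\<forall>\<^sub>F n in sequentially. 1 \<le> (n :: nat)" by (rule eventually_ge_at_top)
    ultimately show "\<forall>\<^sub>F n in sequentially. spanning_sum f t n \<epsilon> \<le> ennreal (125 * G ^ n)"
    proof eventually_elim
      case (elim n)
      obtain X where X: "X \<subseteq> julia_set f" "finite X" "real (card X) \<le> 125 / (\<theta> ^ n) ^ 3"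
        "\<And>z. z \<in> julia_set f \<Longrightarrow> \<exists>x\<in>X. chd z x \<le> 2 * \<theta> ^ n"
        using finite_net[of "\<theta> ^ n" "julia_set f"] \<theta> by (metis power_le_one less_imp_le zero_less_power)
      obtain g where g: "\<And>x. x \<in> julia_set f \<Longrightarrow> g x \<in> julia_set f \<and> chd x (g x) \<le> K * \<theta> ^ n \<and>
          \<mu> ^ n \<le> sph_deriv (f ^^ n) (g x)"
        using \<mu>(3)[OF elim(2)] by metis
      define Y where "Y = g ` X"
      have Y: "finite Y" "card Y \<le> card X" using X by (auto simp: Y_def card_image_le)
      have "spanning f n \<epsilon> Y"
        unfolding spanning_def
      proof (intro conjI ballI)
        show "Y \<subseteq> julia_set f" using g X by (auto simp: Y_def)
        fix z assume "z \<in> julia_set f"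
        then obtain x where x: "x \<in> X" "chd z x \<le> 2 * \<theta> ^ n" using X by blast
        have zg: "chd z (g x) \<le> (2 + K) * \<theta> ^ n"
          using chd_triangle[of z "g x" x] x g[of x] X by (auto simp: algebra_simps)
        have "dist ((f ^^ j) z) ((f ^^ j) (g x)) < \<epsilon>" if "j \<le> n" for j
        proof -
          have "dist ((f ^^ j) z) ((f ^^ j) (g x)) \<le> 4 * chd ((f ^^ j) z) ((f ^^ j) (g x))"
            by (rule dist_le_chd)
          also have "\<dots> \<le> 4 * (L ^ j * chd z (g x))" using lipschitz_funpow[OF L] by simp
          also have "\<dots> \<le> 4 * (L ^ n * ((2 + K) * \<theta> ^ n))"
            using L that zg by (intro mult_left_mono mult_mono power_increasing) auto
          also have "\<dots> = 4 * (2 + K) * (L * \<theta>) ^ n" by (simp add: power_mult_distrib)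
          also have "L * \<theta> = 1 / 2" using L by (simp add: \<theta>_def)
          finally show ?thesis using elim(1) by simp
        qed
        then have "bowen_dist f n z (g x) < \<epsilon>" unfolding bowen_dist_def by (subst Max_less_iff) auto
        then show "\<exists>y\<in>Y. bowen_dist f n z y < \<epsilon>" using x by (auto simp: Y_def)
      qed
      then have "spanning_sum f t n \<epsilon> \<le> (\<Sum>\<^sub>\<infinity>y\<in>Y. neg_power (sph_deriv (f ^^ n) y) t)"
        unfolding spanning_sum_def by (intro INF_lower) auto
      also have "\<dots> = (\<Sum>y\<in>Y. neg_power (sph_deriv (f ^^ n) y) t)" using Y by simp
      also have "\<dots> \<le> (\<Sum>y\<in>Y. ennreal ((\<mu> ^ n) powr (- t)))"
      proof (rule sum_mono)
        fix y assume "y \<in> Y"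
        then have ge: "\<mu> ^ n \<le> sph_deriv (f ^^ n) y" using g X by (auto simp: Y_def)
        \<comment> \<open>Positivity of the derivative keeps the infinite value of
          \<open>neg_power\<close> out of the sum.\<close>
        moreover have "0 < \<mu> ^ n" using \<mu> by simp
        ultimately show "neg_power (sph_deriv (f ^^ n) y) t \<le> ennreal ((\<mu> ^ n) powr (- t))"
          using t by (auto simp: neg_power_def intro!: ennreal_leI powr_mono2')
      qed
      also have "\<dots> = ennreal (real (card Y) * (\<mu> ^ n) powr (- t))"
        by (simp add: ennreal_mult ennreal_of_nat_eq_real_of_nat)
      also have "\<dots> \<le> ennreal (125 * G ^ n)"
      proof (rule ennreal_leI)
        have "real (card Y) * (\<mu> ^ n) powr (- t) \<le> 125 / (\<theta> ^ n) ^ 3 * (\<mu> ^ n) powr (- t)"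
          using Y X(3) by (intro mult_right_mono) auto
        also have "\<dots> = 125 / (\<theta> ^ n) ^ 3 * (\<mu> powr (- t)) ^ n"
          using \<mu> by (simp add: powr_powr powr_realpow[symmetric] mult.commute)
        also have "\<dots> = 125 * (1 / \<theta> ^ 3 * \<mu> powr (- t)) ^ n"
          by (simp add: power_mult_distrib power_divide power_mult[symmetric] mult.commute)
        also have "\<dots> \<le> 125 * G ^ n"
          using \<theta> by (intro mult_left_mono power_mono) (auto simp: G_def)
        finally show "real (card Y) * (\<mu> ^ n) powr (- t) \<le> 125 * G ^ n" .
      qed
      finally show ?case .
    qed
  qed
qed

lemma P_spanning_finite:
  assumes t: "0 < t" shows "P_spanning f t < \<infinity>"
proof -
  obtain G where G: "1 \<le> G"
    "\<And>\<epsilon>. 0 < \<epsilon> \<Longrightarrow> \<forall>\<^sub>F n in sequentially. spanning_sum f t n \<epsilon> \<le> ennreal (125 * G ^ n)"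
    using spanning_sum_le[OF t] by metis
  \<comment> \<open>For n at least 1 the term ln 125 / n is at most ln 125, so one constant bounds
    the growth for every \<epsilon>.\<close>
  define M where "M = ln 125 + ln G"
  have growth: "spanning_growth f t \<epsilon> \<le> ereal M" if \<epsilon>: "0 < \<epsilon>" for \<epsilon>
    unfolding spanning_growth_def
  proof (rule Limsup_bounded)
    have "\<forall>\<^sub>F n in sequentially. 1 \<le> (n :: nat)" by (rule eventually_ge_at_top)
    then show "\<forall>\<^sub>F n in sequentially. ereal (1 / real n) * eln (spanning_sum f t n \<epsilon>) \<le> ereal M"
      using G(2)[OF \<epsilon>]
    proof eventually_elim
      case (elim n)
      have pos: "0 < 125 * G ^ n" using G(1) by simp
      have "eln (spanning_sum f t n \<epsilon>) \<le> eln (ennreal (125 * G ^ n))" using elim(2) by (rule eln_mono)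
      also have "\<dots> = ereal (ln (125 * G ^ n))"
        using pos by (simp add: eln_def ennreal_eq_0_iff)
      finally have "ereal (1 / real n) * eln (spanning_sum f t n \<epsilon>) \<le> ereal (1 / real n) * ereal (ln (125 * G ^ n))"
        by (intro ereal_mult_left_mono) auto
      also have "\<dots> = ereal (1 / real n * ln (125 * G ^ n))" by simp
      also have "1 / real n * ln (125 * G ^ n) = ln 125 / real n + ln G"
        using G(1) elim(1) by (simp add: ln_mult ln_realpow field_simps)
      also have "\<dots> \<le> M"
      proof -
        have "ln 125 / real n \<le> ln 125 / 1" using elim(1) by (intro divide_left_mono) auto
        then show ?thesis by (simp add: M_def)
      qed
      finally show ?case by simp
    qed
  qed
  have "P_spanning f t \<le> ereal M"
  proof (rule tendsto_upperbound[OF P_spanning_tendsto])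
    show "\<forall>\<^sub>F \<epsilon> in at_right 0. spanning_growth f t \<epsilon> \<le> ereal M"
      using growth by (auto simp: eventually_at_right_field intro!: exI[of _ 1])
  qed simp
  then show ?thesis by (rule le_less_trans) simp
qed

end

theorem theorem4p5:
  fixes f :: "riemann_sphere \<Rightarrow> riemann_sphere" and d :: nat and t :: real
  assumes "rational_map_of_degree d f" and "d \<ge> 2" and "t > 0"
  shows "P_spanning f t < \<infinity>"
proof -
  obtain p q where "coprime p q" "max (degree p) (degree q) = d" "f = rational_fun p q"
    using assms(1) unfolding rational_map_of_degree_def by blast
  then interpret rational p q d f
    using assms(2) by unfold_locales auto
  show ?thesis using assms(3) by (rule P_spanning_finite)
qed

end
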